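(* Let $T$ be a topos and let $\mathcal{C}$ be a $gr$-stack of $T$ with invariants the abelian groups $\pi_0(\mathcal{C})=B$ and $\pi_1(\mathcal{C})=A$ of $T$, such that the $B$-module structure on $A$ is trivial and the associated trilinear map $\varphi_{\mathcal{C}}:\Lambda^3B\to A$ is trivial. Suppose that the associated commutator biextension $E$ of $B\times B$ by $A$ is trivial as an alternating biextension. Then $\mathcal{C}$ is the underlying $gr$-stack of a strict Picard stack.
   Context: A $gr$-stack of $T$ is a stack in groupoids $\mathcal{C}$ on $T$ with a monoidal structure (tensor product written $XY$, unit $I$, associativity $a_{X,Y,Z}:X(YZ)\to(XY)Z$) which is group-like (every object is invertible up to isomorphism for the tensor product). $\pi_0(\mathcal{C})$ is the sheaf associated to the presheaf of isomorphism classes of objects, $\pi_1(\mathcal{C})=\mathrm{Aut}(I)$. $A$ is written multiplicatively, $B$ additively. Automorphism sheaves $\mathrm{Aut}(X)$ are identified with $A$ by $a\mapsto a\otimes X$; $a\mapsto X\otimes a$ then defines the action of $B$ on $A$, assumed trivial. Locally on $T$ one may choose, for each section $x$ of $B$, an object $X_x$ of class $x$, and arrows $c_{x,y}:X_xX_y\to X_{x+y}$, and define a local 3-cocycle $f(x,y,z)\in A$ by $c_{x+y,z}\circ(c_{x,y}X_z)\circ a_{x,y,z}=f(x,y,z)\circ c_{x,y+z}\circ(X_xc_{y,z})$. The expressions $$\varphi_{\mathcal{C}}(x,y,z)=\frac{f(x,y,z)\,f(z,x,y)\,f(y,z,x)}{f(x,z,y)\,f(z,y,x)\,f(y,x,z)}$$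 are independent of choices and glue to the global map $\varphi_{\mathcal{C}}$. Commutator: the $A$-torsor $E$ on $B\times B$ obtained by gluing the local torsors with fibres $E_{x,y}=\mathrm{Isom}_{\mathcal{C}}(X_yX_x,X_xX_y)$. Partial laws, defined locally and glued: for $u\in E_{x,y}$, $v\in E_{x',y}$, $u\stackrel{1}{+}v\in E_{x+x',y}$ is $$X_yX_{x+x'}\to X_y(X_xX_{x'})\to(X_yX_x)X_{x'}\xrightarrow{u}(X_xX_y)X_{x'}\to X_x(X_yX_{x'})\xrightarrow{v}X_x(X_{x'}X_y)\to(X_xX_{x'})X_y\to X_{x+x'}X_y;$$ for $u\in E_{x,y}$, $w\in E_{x,y'}$, $u\stackrel{2}{+}w\in E_{x,y+y'}$ is $$X_{y+y'}X_x\to(X_yX_{y'})X_x\to X_y(X_{y'}X_x)\xrightarrow{w}X_y(X_xX_{y'})\to(X_yX_x)X_{y'}\xrightarrow{u}(X_xX_y)X_{y'}\to X_x(X_yX_{y'})\to X_xX_{y+y'}$$ (unlabelled arrows: associativity isomorphisms, and arrows induced by $c^{\pm1}$ at the ends). When $\varphi_{\mathcal{C}}$ is trivial, $E$ is a biextension (both laws are associative, commutative and compatible), alternating via the section of its diagonal restriction given locally by $t(x)=1_{X_xX_x}\in E_{x,x}$. $E$ is trivial as an alternating biextension when it has a global section $s(x,y)\in E_{x,y}$ with $s(x+x',y)=s(x,y)\stackrel{1}{+}s(x',y)$, $s(x,y+y')=s(x,y)\stackrel{2}{+}s(x,y')$ and $s(x,x)=t(x)$. A strict Picard stack is a $gr$-stack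 with functorial commutativity isomorphisms $s_{X,Y}:YX\to XY$ satisfying the hexagon axioms, with $s_{Y,X}\circ s_{X,Y}=1$ and $s_{X,X}=1_{XX}$ for all objects $X,Y$. *)

theory Defs
  imports "HOL-Algebra.Group"
begin

section \<open>Categories and sites\<close>

record ('o, 'm) cat =
  obj :: "'o set"
  arr :: "'m set"
  src :: "'m \<Rightarrow> 'o"
  tgt :: "'m \<Rightarrow> 'o"
  ide :: "'o \<Rightarrow> 'm"
  cmp :: "'m \<Rightarrow> 'm \<Rightarrow> 'm"  (infixr "\<bullet>\<index>" 75)

definition homs :: "('o, 'm, 'z) cat_scheme \<Rightarrow> 'o \<Rightarrow> 'o \<Rightarrow> 'm set" where
  "homs C X Y = {h \<in> arr C. src C h = X \<and> tgt C h = Y}"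

text \<open>Composition is in the usual order: \<open>g \<bullet> f\<close> is ``first \<open>f\<close>, then \<open>g\<close>''.\<close>

locale category =
  fixes C :: "('o, 'm, 'z) cat_scheme" (structure)
  assumes src_obj: "h \<in> arr C \<Longrightarrow> src C h \<in> obj C"
    and tgt_obj: "h \<in> arr C \<Longrightarrow> tgt C h \<in> obj C"
    and ide_homs: "X \<in> obj C \<Longrightarrow> ide C X \<in> homs C X X"
    and cmp_homs: "\<lbrakk>f \<in> homs C X Y; g \<in> homs C Y Z\<rbrakk> \<Longrightarrow> g \<bullet> f \<in> homs C X Z"
    and cmp_ide: "f \<in> homs C X Y \<Longrightarrow> f \<bullet> ide C X = f"
    and ide_cmp: "f \<in> homs C X Y \<Longrightarrow> ide C Y \<bullet> f = f"
    and cmp_assoc: "\<lbrakk>f \<in> homs C W X; g \<in> homs C X Y; h \<in> homs C Y Z\<rbrakk>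
      \<Longrightarrow> (h \<bullet> g) \<bullet> f = h \<bullet> (g \<bullet> f)"

definition arr_inv :: "('o, 'm, 'z) cat_scheme \<Rightarrow> 'm \<Rightarrow> 'm" where
  "arr_inv C h = (THE k. k \<in> homs C (tgt C h) (src C h)
     \<and> k \<bullet>\<^bsub>C\<^esub> h = ide C (src C h) \<and> h \<bullet>\<^bsub>C\<^esub> k = ide C (tgt C h))"

text \<open>A topos is given by a site of definition: its sheaves are the sheaves on the site, and its
  stacks are the stacks on the site. No finiteness, smallness or fibre product condition is put on
  the site, so a topos with its canonical topology is itself an admissible choice.\<close>

record ('u, 's) site = "('u, 's) cat" +
  cov :: "'u \<Rightarrow> 's set set"

definition sieve :: "('u, 's) site \<Rightarrow> 'u \<Rightarrow> 's set \<Rightarrow> bool" where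
  "sieve T U R \<longleftrightarrow> R \<subseteq> {f \<in> arr T. tgt T f = U}
     \<and> (\<forall>f\<in>R. \<forall>g\<in>arr T. tgt T g = src T f \<longrightarrow> f \<bullet>\<^bsub>T\<^esub> g \<in> R)"

definition max_sieve :: "('u, 's) site \<Rightarrow> 'u \<Rightarrow> 's set" where
  "max_sieve T U = {f \<in> arr T. tgt T f = U}"

definition pull_sieve :: "('u, 's) site \<Rightarrow> 's \<Rightarrow> 's set \<Rightarrow> 's set" where
  "pull_sieve T g R = {f \<in> arr T. tgt T f = src T g \<and> g \<bullet>\<^bsub>T\<^esub> f \<in> R}"

locale grothendieck_site = category T for T :: "('u, 's) site" +
  assumes cov_sieve: "\<lbrakk>U \<in> obj T; R \<in> cov T U\<rbrakk> \<Longrightarrow> sieve T U R"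
    and cov_max: "U \<in> obj T \<Longrightarrow> max_sieve T U \<in> cov T U"
    and cov_pull: "\<lbrakk>g \<in> arr T; R \<in> cov T (tgt T g)\<rbrakk> \<Longrightarrow> pull_sieve T g R \<in> cov T (src T g)"
    and cov_local: "\<lbrakk>U \<in> obj T; R \<in> cov T U; sieve T U R';
        \<And>f. f \<in> R \<Longrightarrow> pull_sieve T f R' \<in> cov T (src T f)\<rbrakk> \<Longrightarrow> R' \<in> cov T U"


section \<open>Sheaves of groups\<close>

text \<open>All group laws are written multiplicatively, as in \<^theory>\<open>HOL-Algebra.Group\<close>;
  this includes the law of the sheaf \<open>B\<close> below.\<close>

record ('u, 's, 'x) presheaf =
  sec :: "'u \<Rightarrow> 'x monoid"
  res :: "'s \<Rightarrow> 'x \<Rightarrow> 'x"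

definition matching ::
    "('u, 's) site \<Rightarrow> ('u, 's, 'x) presheaf \<Rightarrow> 's set \<Rightarrow> ('s \<Rightarrow> 'x) set" where
  "matching T F R = {t \<in> (\<Pi>\<^sub>E f\<in>R. carrier (sec F (src T f))).
     \<forall>f\<in>R. \<forall>g\<in>arr T. tgt T g = src T f \<longrightarrow> t (f \<bullet>\<^bsub>T\<^esub> g) = res F g (t f)}"

locale abelian_sheaf =
  fixes T :: "('u, 's) site" and F :: "('u, 's, 'x) presheaf"
  assumes sec_comm_group: "U \<in> obj T \<Longrightarrow> comm_group (sec F U)"
    and res_hom: "f \<in> arr T \<Longrightarrow> res F f \<in> hom (sec F (tgt T f)) (sec F (src T f))"
    and res_ide: "\<lbrakk>U \<in> obj T; x \<in> carrier (sec F U)\<rbrakk> \<Longrightarrow> res F (ide T U) x = x"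
    and res_cmp: "\<lbrakk>f \<in> arr T; g \<in> arr T; tgt T g = src T f; x \<in> carrier (sec F (tgt T f))\<rbrakk>
      \<Longrightarrow> res F (f \<bullet>\<^bsub>T\<^esub> g) x = res F g (res F f x)"
    and amalgamation: "\<lbrakk>U \<in> obj T; R \<in> cov T U; t \<in> matching T F R\<rbrakk>
      \<Longrightarrow> \<exists>!x. x \<in> carrier (sec F U) \<and> (\<forall>f\<in>R. res F f x = t f)"

definition presheaf_iso :: "('u, 's) site \<Rightarrow> ('u, 's, 'x) presheaf \<Rightarrow> ('u, 's, 'y) presheaf
    \<Rightarrow> ('u \<Rightarrow> 'x \<Rightarrow> 'y) \<Rightarrow> bool" where
  "presheaf_iso T F G h \<longleftrightarrow> (\<forall>U\<in>obj T. h U \<in> iso (sec F U) (sec G U))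
     \<and> (\<forall>f\<in>arr T. \<forall>x\<in>carrier (sec F (tgt T f)). h (src T f) (res F f x) = res G f (h (tgt T f) x))"

text \<open>The plus construction: sections over \<open>U\<close> are the elements of the filtered colimit,
  over the covering sieves of \<open>U\<close>, of the sets of matching families. A class is represented
  by the set of pairs (covering sieve, matching family) in it. Applying the construction twice
  gives the associated sheaf.\<close>

type_synonym ('s, 'x) germ = "('s set \<times> ('s \<Rightarrow> 'x)) set"

definition germ_of :: "('u, 's) site \<Rightarrow> ('u, 's, 'x) presheaf \<Rightarrow> 'u \<Rightarrow> 's set \<Rightarrow> ('s \<Rightarrow> 'x)
    \<Rightarrow> ('s, 'x) germ" where
  "germ_of T F U R t = {(S, w). S \<in> cov T U \<and> w \<in> matching T F S
     \<and> (\<exists>Q\<in>cov T U. Q \<subseteq> R \<inter> S \<and> (\<forall>f\<in>Q. t f = w f))}"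

definition plus_presheaf ::
    "('u, 's) site \<Rightarrow> ('u, 's, 'x) presheaf \<Rightarrow> ('u, 's, ('s, 'x) germ) presheaf" where
  "plus_presheaf T F = \<lparr>
     sec = (\<lambda>U. \<lparr>
       carrier = {germ_of T F U R t | R t. R \<in> cov T U \<and> t \<in> matching T F R},
       monoid.mult = (\<lambda>p q. \<Union>(R, t)\<in>p. \<Union>(S, w)\<in>q.
         germ_of T F U (R \<inter> S) (\<lambda>f\<in>R \<inter> S. t f \<otimes>\<^bsub>sec F (src T f)\<^esub> w f)),
       one = germ_of T F U (max_sieve T U) (\<lambda>f\<in>max_sieve T U. \<one>\<^bsub>sec F (src T f)\<^esub>) \<rparr>),
     res = (\<lambda>g p. \<Union>(R, t)\<in>p.
       germ_of T F (src T g) (pull_sieve T g R) (\<lambda>f\<in>pull_sieve T g R. t (g \<bullet>\<^bsub>T\<^esub> f))) \<rparr>"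

definition plus_unit :: "('u, 's) site \<Rightarrow> ('u, 's, 'x) presheaf \<Rightarrow> 'u \<Rightarrow> 'x \<Rightarrow> ('s, 'x) germ" where
  "plus_unit T F U x = germ_of T F U (max_sieve T U) (\<lambda>f\<in>max_sieve T U. res F f x)"

definition sheafify ::
    "('u, 's) site \<Rightarrow> ('u, 's, 'x) presheaf \<Rightarrow> ('u, 's, ('s, ('s, 'x) germ) germ) presheaf" where
  "sheafify T F = plus_presheaf T (plus_presheaf T F)"

definition sheafify_unit :: "('u, 's) site \<Rightarrow> ('u, 's, 'x) presheaf \<Rightarrow> 'u \<Rightarrow> 'x
    \<Rightarrow> ('s, ('s, 'x) germ) germ" where
  "sheafify_unit T F U x = plus_unit T (plus_presheaf T F) U (plus_unit T F U x)"


section \<open>Stacks in groupoids\<close>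

text \<open>Stacks are described without a cleavage, as categories over the site. An arrow
  \<open>X' \<rightarrow> X\<close> over \<open>f : V \<rightarrow> U\<close> exhibits \<open>X'\<close> as a restriction of \<open>X\<close> along \<open>f\<close>.\<close>

record ('u, 's, 'o, 'm) fibred = "('o, 'm) cat" +
  base_obj :: "'o \<Rightarrow> 'u"
  base_arr :: "'m \<Rightarrow> 's"

definition obj_over :: "('u, 's, 'o, 'm, 'z) fibred_scheme \<Rightarrow> 'u \<Rightarrow> 'o set" where
  "obj_over C U = {X \<in> obj C. base_obj C X = U}"

definition homs_over ::
    "('u, 's, 'o, 'm, 'z) fibred_scheme \<Rightarrow> 's \<Rightarrow> 'o \<Rightarrow> 'o \<Rightarrow> 'm set" where
  "homs_over C f X Y = {h \<in> homs C X Y. base_arr C h = f}"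

definition fib_homs ::
    "('u, 's) site \<Rightarrow> ('u, 's, 'o, 'm, 'z) fibred_scheme \<Rightarrow> 'o \<Rightarrow> 'o \<Rightarrow> 'm set" where
  "fib_homs T C X Y = homs_over C (ide T (base_obj C X)) X Y"

locale fibred_in_groupoids = category C
  for T :: "('u, 's) site" and C :: "('u, 's, 'o, 'm, 'z) fibred_scheme" (structure) +
  assumes base_obj: "X \<in> obj C \<Longrightarrow> base_obj C X \<in> obj T"
    and base_arr: "h \<in> homs C X Y \<Longrightarrow> base_arr C h \<in> homs T (base_obj C X) (base_obj C Y)"
    and base_ide: "X \<in> obj C \<Longrightarrow> base_arr C (ide C X) = ide T (base_obj C X)"
    and base_cmp: "\<lbrakk>h \<in> homs C X Y; k \<in> homs C Y Z\<rbrakk>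
      \<Longrightarrow> base_arr C (k \<bullet> h) = base_arr C k \<bullet>\<^bsub>T\<^esub> base_arr C h"
    and lift: "\<lbrakk>f \<in> homs T V U; X \<in> obj_over C U\<rbrakk>
      \<Longrightarrow> \<exists>Y\<in>obj_over C V. \<exists>h. h \<in> homs_over C f Y X"
    and cartesian: "\<lbrakk>h \<in> homs C Y X; k \<in> homs C Z X; g \<in> homs T (base_obj C Z) (base_obj C Y);
        base_arr C k = base_arr C h \<bullet>\<^bsub>T\<^esub> g\<rbrakk>
      \<Longrightarrow> \<exists>!l. l \<in> homs_over C g Z Y \<and> h \<bullet> l = k"

text \<open>A descent datum for a sieve \<open>R\<close> is a functor from \<open>R\<close> (as a full subcategory of the
  category of arrows to \<open>U\<close>) to \<open>C\<close> over the site: an object \<open>D f\<close> for each \<open>f\<close> in \<open>R\<close>, and an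
  arrow \<open>d f g : D (f \<bullet> g) \<rightarrow> D f\<close> over \<open>g\<close>.\<close>

definition descent_datum :: "('u, 's) site \<Rightarrow> ('u, 's, 'o, 'm, 'z) fibred_scheme \<Rightarrow> 's set
    \<Rightarrow> ('s \<Rightarrow> 'o) \<Rightarrow> ('s \<Rightarrow> 's \<Rightarrow> 'm) \<Rightarrow> bool" where
  "descent_datum T C R D d \<longleftrightarrow>
     (\<forall>f\<in>R. D f \<in> obj_over C (src T f) \<and> d f (ide T (src T f)) = ide C (D f))
     \<and> (\<forall>f\<in>R. \<forall>g\<in>arr T. tgt T g = src T f \<longrightarrow> d f g \<in> homs_over C g (D (f \<bullet>\<^bsub>T\<^esub> g)) (D f))
     \<and> (\<forall>f\<in>R. \<forall>g\<in>arr T. \<forall>h\<in>arr T. tgt T g = src T f \<and> tgt T h = src T g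
          \<longrightarrow> d f (g \<bullet>\<^bsub>T\<^esub> h) = d f g \<bullet>\<^bsub>C\<^esub> d (f \<bullet>\<^bsub>T\<^esub> g) h)"

text \<open>The first axiom below is the sheaf condition for the presheaf of arrows from \<open>X\<close> to \<open>Y\<close>.
  A section of it over \<open>f\<close> is an arrow from the restriction of \<open>X\<close> along \<open>f\<close> to that of \<open>Y\<close>, i.e.
  a choice, natural in the restriction \<open>h : X' \<rightarrow> X\<close> over \<open>f\<close>, of an arrow \<open>X' \<rightarrow> Y\<close> over \<open>f\<close>.\<close>

locale stack_in_groupoids = grothendieck_site T + fibred_in_groupoids T C
  for T :: "('u, 's) site" and C :: "('u, 's, 'o, 'm, 'z) fibred_scheme" (structure) +
  assumes homs_sheaf: "\<lbrakk>U \<in> obj T; R \<in> cov T U; X \<in> obj_over C U; Y \<in> obj_over C U;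
        \<And>f X' h. \<lbrakk>f \<in> R; h \<in> homs_over C f X' X\<rbrakk> \<Longrightarrow> k h \<in> homs_over C f X' Y;
        \<And>f X' X'' h l. \<lbrakk>f \<in> R; h \<in> homs_over C f X' X; l \<in> homs C X'' X'\<rbrakk>
          \<Longrightarrow> k (h \<bullet>\<^bsub>C\<^esub> l) = k h \<bullet>\<^bsub>C\<^esub> l\<rbrakk>
      \<Longrightarrow> \<exists>!m. m \<in> fib_homs T C X Y
            \<and> (\<forall>f\<in>R. \<forall>X'. \<forall>h\<in>homs_over C f X' X. m \<bullet>\<^bsub>C\<^esub> h = k h)"
    and descent: "\<lbrakk>U \<in> obj T; R \<in> cov T U; descent_datum T C R D d\<rbrakk>
      \<Longrightarrow> \<exists>X\<in>obj_over C U. \<exists>e. (\<forall>f\<in>R. e f \<in> homs_over C f (D f) X)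
            \<and> (\<forall>f\<in>R. \<forall>g\<in>arr T. tgt T g = src T f \<longrightarrow> e (f \<bullet>\<^bsub>T\<^esub> g) = e f \<bullet>\<^bsub>C\<^esub> d f g)"


section \<open>gr-stacks and strict Picard stacks\<close>

text \<open>The associativity constraint \<open>asc X Y Z\<close> goes from \<open>X \<odot> (Y \<odot> Z)\<close> to
  \<open>(X \<odot> Y) \<odot> Z\<close>. The unit \<open>I\<close> is a section of \<open>C\<close> over the site, with
  \<open>unit_obj U\<close> its value over \<open>U\<close>.\<close>

record ('u, 's, 'o, 'm) monoidal = "('u, 's, 'o, 'm) fibred" +
  tens_obj :: "'o \<Rightarrow> 'o \<Rightarrow> 'o"  (infixl "\<odot>\<index>" 80)
  tens_arr :: "'m \<Rightarrow> 'm \<Rightarrow> 'm"  (infixl "\<star>\<index>" 80)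
  unit_obj :: "'u \<Rightarrow> 'o"
  unit_arr :: "'s \<Rightarrow> 'm"
  asc :: "'o \<Rightarrow> 'o \<Rightarrow> 'o \<Rightarrow> 'm"
  lunit :: "'o \<Rightarrow> 'm"
  runit :: "'o \<Rightarrow> 'm"

text \<open>The constraints are isomorphisms automatically, since all arrows over an identity are.
  Naturality is required with respect to arrows over arbitrary arrows of the site, which includes
  compatibility with restriction.\<close>

locale gr_stack = stack_in_groupoids T C
  for T :: "('u, 's) site" and C :: "('u, 's, 'o, 'm) monoidal" (structure) +
  assumes tens_obj: "\<lbrakk>X \<in> obj_over C U; Y \<in> obj_over C U\<rbrakk> \<Longrightarrow> X \<odot> Y \<in> obj_over C U"
    and tens_arr: "\<lbrakk>h \<in> homs_over C f X X'; k \<in> homs_over C f Y Y'\<rbrakk>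
      \<Longrightarrow> h \<star> k \<in> homs_over C f (X \<odot> Y) (X' \<odot> Y')"
    and tens_ide: "\<lbrakk>X \<in> obj_over C U; Y \<in> obj_over C U\<rbrakk>
      \<Longrightarrow> ide C X \<star> ide C Y = ide C (X \<odot> Y)"
    and tens_cmp: "\<lbrakk>h \<in> homs_over C f X X'; k \<in> homs_over C f Y Y';
        h' \<in> homs_over C g X' X''; k' \<in> homs_over C g Y' Y''\<rbrakk>
      \<Longrightarrow> (h' \<bullet> h) \<star> (k' \<bullet> k) = (h' \<star> k') \<bullet> (h \<star> k)"
    and unit_obj: "U \<in> obj T \<Longrightarrow> unit_obj C U \<in> obj_over C U"
    and unit_arr: "f \<in> homs T V U \<Longrightarrow> unit_arr C f \<in> homs_over C f (unit_obj C V) (unit_obj C U)"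
    and unit_ide: "U \<in> obj T \<Longrightarrow> unit_arr C (ide T U) = ide C (unit_obj C U)"
    and unit_cmp: "\<lbrakk>g \<in> homs T W V; f \<in> homs T V U\<rbrakk>
      \<Longrightarrow> unit_arr C (f \<bullet>\<^bsub>T\<^esub> g) = unit_arr C f \<bullet> unit_arr C g"
    and asc_homs: "\<lbrakk>X \<in> obj_over C U; Y \<in> obj_over C U; Z \<in> obj_over C U\<rbrakk>
      \<Longrightarrow> asc C X Y Z \<in> fib_homs T C (X \<odot> (Y \<odot> Z)) ((X \<odot> Y) \<odot> Z)"
    and asc_natural: "\<lbrakk>h \<in> homs_over C f X X'; k \<in> homs_over C f Y Y'; l \<in> homs_over C f Z Z'\<rbrakk>
      \<Longrightarrow> asc C X' Y' Z' \<bullet> (h \<star> (k \<star> l)) = ((h \<star> k) \<star> l) \<bullet> asc C X Y Z"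
    and lunit_homs: "X \<in> obj_over C U \<Longrightarrow> lunit C X \<in> fib_homs T C (unit_obj C U \<odot> X) X"
    and lunit_natural: "h \<in> homs_over C f X X'
      \<Longrightarrow> lunit C X' \<bullet> (unit_arr C f \<star> h) = h \<bullet> lunit C X"
    and runit_homs: "X \<in> obj_over C U \<Longrightarrow> runit C X \<in> fib_homs T C (X \<odot> unit_obj C U) X"
    and runit_natural: "h \<in> homs_over C f X X'
      \<Longrightarrow> runit C X' \<bullet> (h \<star> unit_arr C f) = h \<bullet> runit C X"
    and pentagon: "\<lbrakk>X \<in> obj_over C U; Y \<in> obj_over C U; Z \<in> obj_over C U; Z' \<in> obj_over C U\<rbrakk>
      \<Longrightarrow> asc C (X \<odot> Y) Z Z' \<bullet> asc C X Y (Z \<odot> Z')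
        = (asc C X Y Z \<star> ide C Z') \<bullet> asc C X (Y \<odot> Z) Z' \<bullet> (ide C X \<star> asc C Y Z Z')"
    and triangle: "\<lbrakk>X \<in> obj_over C U; Y \<in> obj_over C U\<rbrakk>
      \<Longrightarrow> (runit C X \<star> ide C Y) \<bullet> asc C X (unit_obj C U) Y = ide C X \<star> lunit C Y"
    and group_like: "X \<in> obj_over C U \<Longrightarrow> \<exists>Y\<in>obj_over C U.
        fib_homs T C (X \<odot> Y) (unit_obj C U) \<noteq> {} \<and> fib_homs T C (Y \<odot> X) (unit_obj C U) \<noteq> {}"

text \<open>Following the convention of the commutator, the commutativity constraint \<open>s X Y\<close> goes
  from \<open>Y \<odot> X\<close> to \<open>X \<odot> Y\<close>.\<close>

locale strict_picard_stack = gr_stack T C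
  for T :: "('u, 's) site" and C :: "('u, 's, 'o, 'm) monoidal" (structure) +
  fixes s :: "'o \<Rightarrow> 'o \<Rightarrow> 'm"
  assumes sym_homs: "\<lbrakk>X \<in> obj_over C U; Y \<in> obj_over C U\<rbrakk>
      \<Longrightarrow> s X Y \<in> fib_homs T C (Y \<odot> X) (X \<odot> Y)"
    and sym_natural: "\<lbrakk>h \<in> homs_over C f X X'; k \<in> homs_over C f Y Y'\<rbrakk>
      \<Longrightarrow> s X' Y' \<bullet> (k \<star> h) = (h \<star> k) \<bullet> s X Y"
    and hexagon1: "\<lbrakk>X \<in> obj_over C U; X' \<in> obj_over C U; Y \<in> obj_over C U\<rbrakk>
      \<Longrightarrow> s (X \<odot> X') Y = asc C X X' Y \<bullet> (ide C X \<star> s X' Y) \<bullet> arr_inv C (asc C X Y X')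
            \<bullet> (s X Y \<star> ide C X') \<bullet> asc C Y X X'"
    and hexagon2: "\<lbrakk>X \<in> obj_over C U; Y \<in> obj_over C U; Y' \<in> obj_over C U\<rbrakk>
      \<Longrightarrow> s X (Y \<odot> Y') = arr_inv C (asc C X Y Y') \<bullet> (s X Y \<star> ide C Y') \<bullet> asc C Y X Y'
            \<bullet> (ide C Y \<star> s X Y') \<bullet> arr_inv C (asc C Y Y' X)"
    and sym_sym: "\<lbrakk>X \<in> obj_over C U; Y \<in> obj_over C U\<rbrakk>
      \<Longrightarrow> s Y X \<bullet> s X Y = ide C (Y \<odot> X)"
    and sym_strict: "X \<in> obj_over C U \<Longrightarrow> s X X = ide C (X \<odot> X)"


section \<open>The invariants of a gr-stack\<close>

definition iso_class :: "('u, 's) site \<Rightarrow> ('u, 's, 'o, 'm) monoidal \<Rightarrow> 'o \<Rightarrow> 'o set" where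
  "iso_class T C X = {Y \<in> obj_over C (base_obj C X). fib_homs T C X Y \<noteq> {}}"

definition iso_classes ::
    "('u, 's) site \<Rightarrow> ('u, 's, 'o, 'm) monoidal \<Rightarrow> ('u, 's, 'o set) presheaf" where
  "iso_classes T C = \<lparr>
     sec = (\<lambda>U. \<lparr>
       carrier = iso_class T C ` obj_over C U,
       monoid.mult = (\<lambda>p q. \<Union>X\<in>p. \<Union>Y\<in>q. iso_class T C (X \<odot>\<^bsub>C\<^esub> Y)),
       one = iso_class T C (unit_obj C U) \<rparr>),
     res = (\<lambda>f p. {Y. \<exists>X\<in>p. homs_over C f Y X \<noteq> {}}) \<rparr>"

definition pi0 :: "('u, 's) site \<Rightarrow> ('u, 's, 'o, 'm) monoidal
    \<Rightarrow> ('u, 's, ('s, ('s, 'o set) germ) germ) presheaf" where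
  "pi0 T C = sheafify T (iso_classes T C)"

definition pi1 :: "('u, 's) site \<Rightarrow> ('u, 's, 'o, 'm) monoidal \<Rightarrow> ('u, 's, 'm) presheaf" where
  "pi1 T C = \<lparr>
     sec = (\<lambda>U. \<lparr>
       carrier = fib_homs T C (unit_obj C U) (unit_obj C U),
       monoid.mult = (\<lambda>a b. a \<bullet>\<^bsub>C\<^esub> b),
       one = ide C (unit_obj C U) \<rparr>),
     res = (\<lambda>f a. THE a'. a' \<in> fib_homs T C (unit_obj C (src T f)) (unit_obj C (src T f))
       \<and> unit_arr C f \<bullet>\<^bsub>C\<^esub> a' = a \<bullet>\<^bsub>C\<^esub> unit_arr C f) \<rparr>"

text \<open>The automorphisms \<open>a \<otimes> X\<close> and \<open>X \<otimes> a\<close> of \<open>X\<close> attached to an automorphism \<open>a\<close> of the unit.\<close>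

definition left_aut :: "('u, 's, 'o, 'm) monoidal \<Rightarrow> 'm \<Rightarrow> 'o \<Rightarrow> 'm" where
  "left_aut C a X = lunit C X \<bullet>\<^bsub>C\<^esub> (a \<star>\<^bsub>C\<^esub> ide C X) \<bullet>\<^bsub>C\<^esub> arr_inv C (lunit C X)"

definition right_aut :: "('u, 's, 'o, 'm) monoidal \<Rightarrow> 'o \<Rightarrow> 'm \<Rightarrow> 'm" where
  "right_aut C X a = runit C X \<bullet>\<^bsub>C\<^esub> (ide C X \<star>\<^bsub>C\<^esub> a) \<bullet>\<^bsub>C\<^esub> arr_inv C (runit C X)"

text \<open>Abelian groups \<open>A\<close> and \<open>B\<close> of the topos, identified with \<open>\<pi>\<^sub>1\<close> by \<open>al\<close>
  and with \<open>\<pi>\<^sub>0\<close> by \<open>be\<close>.\<close>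

definition has_invariants :: "('u, 's) site \<Rightarrow> ('u, 's, 'o, 'm) monoidal
    \<Rightarrow> ('u, 's, 'b) presheaf \<Rightarrow> ('u \<Rightarrow> ('s, ('s, 'o set) germ) germ \<Rightarrow> 'b)
    \<Rightarrow> ('u, 's, 'a) presheaf \<Rightarrow> ('u \<Rightarrow> 'a \<Rightarrow> 'm) \<Rightarrow> bool" where
  "has_invariants T C B be A al \<longleftrightarrow> abelian_sheaf T B \<and> presheaf_iso T (pi0 T C) B be
     \<and> abelian_sheaf T A \<and> presheaf_iso T A (pi1 T C) al"

locale gr_invariants =
  fixes T :: "('u, 's) site" and C :: "('u, 's, 'o, 'm) monoidal" (structure)
    and B :: "('u, 's, 'b) presheaf" and be :: "'u \<Rightarrow> ('s, ('s, 'o set) germ) germ \<Rightarrow> 'b"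
    and A :: "('u, 's, 'a) presheaf" and al :: "'u \<Rightarrow> 'a \<Rightarrow> 'm"
begin

definition cls :: "'o \<Rightarrow> 'b" where
  "cls X = be (base_obj C X) (sheafify_unit T (iso_classes T C) (base_obj C X) (iso_class T C X))"

text \<open>The objects of class \<open>x\<close> over \<open>U\<close>.\<close>

definition objs_of_class :: "'u \<Rightarrow> 'b \<Rightarrow> 'o set" where
  "objs_of_class U x = {X \<in> obj_over C U. cls X = x}"

text \<open>The action of \<open>b\<close> on \<open>a\<close> is the section \<open>a'\<close> of \<open>A\<close> with \<open>X \<otimes> a = a' \<otimes> X\<close> for all local
  objects \<open>X\<close> of class \<open>b\<close>.\<close>

definition action :: "'u \<Rightarrow> 'b \<Rightarrow> 'a \<Rightarrow> 'a" where
  "action U b a = (THE a'. a' \<in> carrier (sec A U)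
     \<and> (\<forall>f\<in>arr T. tgt T f = U \<longrightarrow> (\<forall>X\<in>objs_of_class (src T f) (res B f b).
          right_aut C X (al (src T f) (res A f a)) = left_aut C (al (src T f) (res A f a')) X)))"

definition trivial_action :: bool where
  "trivial_action \<longleftrightarrow>
     (\<forall>U\<in>obj T. \<forall>b\<in>carrier (sec B U). \<forall>a\<in>carrier (sec A U). action U b a = a)"


subsection \<open>The trilinear map\<close>

text \<open>A choice of \<open>X\<^sub>x\<close> and \<open>c\<^sub>x\<^sub>,\<^sub>y\<close> over \<open>U\<close>, for the classes \<open>x\<close>, \<open>y\<close>, \<open>x + y\<close> in a set \<open>S\<close>
  of sections of \<open>B\<close>. Such a choice exists locally when \<open>S\<close> is finite.\<close>

definition local_choice ::
    "'u \<Rightarrow> 'b set \<Rightarrow> ('b \<Rightarrow> 'o) \<Rightarrow> ('b \<Rightarrow> 'b \<Rightarrow> 'm) \<Rightarrow> bool" where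
  "local_choice U S ob c \<longleftrightarrow> (\<forall>x\<in>S. ob x \<in> objs_of_class U x)
     \<and> (\<forall>x\<in>S. \<forall>y\<in>S. x \<otimes>\<^bsub>sec B U\<^esub> y \<in> S \<longrightarrow>
          c x y \<in> fib_homs T C (ob x \<odot> ob y) (ob (x \<otimes>\<^bsub>sec B U\<^esub> y)))"

definition cocycle ::
    "'u \<Rightarrow> ('b \<Rightarrow> 'o) \<Rightarrow> ('b \<Rightarrow> 'b \<Rightarrow> 'm) \<Rightarrow> 'b \<Rightarrow> 'b \<Rightarrow> 'b \<Rightarrow> 'a" where
  "cocycle U ob c x y z = (THE a. a \<in> carrier (sec A U)
     \<and> c (x \<otimes>\<^bsub>sec B U\<^esub> y) z \<bullet> (c x y \<star> ide C (ob z)) \<bullet> asc C (ob x) (ob y) (ob z)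
       = left_aut C (al U a) (ob (x \<otimes>\<^bsub>sec B U\<^esub> y \<otimes>\<^bsub>sec B U\<^esub> z))
           \<bullet> c x (y \<otimes>\<^bsub>sec B U\<^esub> z) \<bullet> (ide C (ob x) \<star> c y z))"

definition local_phi ::
    "'u \<Rightarrow> ('b \<Rightarrow> 'o) \<Rightarrow> ('b \<Rightarrow> 'b \<Rightarrow> 'm) \<Rightarrow> 'b \<Rightarrow> 'b \<Rightarrow> 'b \<Rightarrow> 'a" where
  "local_phi U ob c x y z = (let f = cocycle U ob c in
     (f x y z \<otimes>\<^bsub>sec A U\<^esub> f z x y \<otimes>\<^bsub>sec A U\<^esub> f y z x)
     \<otimes>\<^bsub>sec A U\<^esub> inv\<^bsub>sec A U\<^esub> (f x z y \<otimes>\<^bsub>sec A U\<^esub> f z y x \<otimes>\<^bsub>sec A U\<^esub> f y x z))"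

definition partial_sums :: "'u \<Rightarrow> 'b \<Rightarrow> 'b \<Rightarrow> 'b \<Rightarrow> 'b set" where
  "partial_sums U x y z = {x, y, z, x \<otimes>\<^bsub>sec B U\<^esub> y, y \<otimes>\<^bsub>sec B U\<^esub> z, z \<otimes>\<^bsub>sec B U\<^esub> x,
     x \<otimes>\<^bsub>sec B U\<^esub> y \<otimes>\<^bsub>sec B U\<^esub> z}"

definition phi :: "'u \<Rightarrow> 'b \<Rightarrow> 'b \<Rightarrow> 'b \<Rightarrow> 'a" where
  "phi U x y z = (THE a. a \<in> carrier (sec A U)
     \<and> (\<forall>f\<in>arr T. tgt T f = U \<longrightarrow> (\<forall>ob c.
          local_choice (src T f) (partial_sums (src T f) (res B f x) (res B f y) (res B f z)) ob c
          \<longrightarrow> res A f a = local_phi (src T f) ob c (res B f x) (res B f y) (res B f z))))"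

text \<open>A homomorphism out of the sheaf \<open>\<Lambda>\<^sup>3B\<close> is trivial iff it is trivial on the sections
  \<open>x \<and> y \<and> z\<close>.\<close>

definition trivial_phi :: bool where
  "trivial_phi \<longleftrightarrow> (\<forall>U\<in>obj T. \<forall>x\<in>carrier (sec B U). \<forall>y\<in>carrier (sec B U). \<forall>z\<in>carrier (sec B U).
     phi U x y z = \<one>\<^bsub>sec A U\<^esub>)"


subsection \<open>The commutator\<close>

text \<open>The index set of all local choices \<open>(f : V \<rightarrow> U, X, Y)\<close> of objects of classes \<open>x\<close>, \<open>y\<close>
  over \<open>V\<close>.\<close>

definition choices :: "'u \<Rightarrow> 'b \<Rightarrow> 'b \<Rightarrow> ('s \<times> 'o \<times> 'o) set" where
  "choices U x y = {(f, X, Y). f \<in> arr T \<and> tgt T f = U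
     \<and> X \<in> objs_of_class (src T f) (res B f x) \<and> Y \<in> objs_of_class (src T f) (res B f y)}"

text \<open>The sections of \<open>E\<close> over a section \<open>(x, y)\<close> of \<open>B \<times> B\<close> over \<open>U\<close>. The local torsors
  \<open>Isom(Y \<odot> X, X \<odot> Y)\<close> attached to different choices of \<open>X\<close> and \<open>Y\<close> are glued along the
  bijections induced by isomorphisms of the \<open>X\<close>'s and of the \<open>Y\<close>'s; so a section is a
  compatible family of elements of the local torsors.\<close>

definition E :: "'u \<Rightarrow> 'b \<Rightarrow> 'b \<Rightarrow> ('s \<times> 'o \<times> 'o \<Rightarrow> 'm) set" where
  "E U x y = {u \<in> (\<Pi>\<^sub>E (f, X, Y)\<in>choices U x y. fib_homs T C (Y \<odot> X) (X \<odot> Y)).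
     \<forall>(f, X, Y)\<in>choices U x y. \<forall>g\<in>arr T. tgt T g = src T f \<longrightarrow>
       (\<forall>X' Y'. \<forall>h\<in>homs_over C g X' X. \<forall>k\<in>homs_over C g Y' Y.
          u (f, X, Y) \<bullet> (k \<star> h) = (h \<star> k) \<bullet> u (f \<bullet>\<^bsub>T\<^esub> g, X', Y'))}"

definition E_res :: "'s \<Rightarrow> 'b \<Rightarrow> 'b \<Rightarrow> ('s \<times> 'o \<times> 'o \<Rightarrow> 'm) \<Rightarrow> ('s \<times> 'o \<times> 'o \<Rightarrow> 'm)" where
  "E_res g x y u = (\<lambda>(f, X, Y)\<in>choices (src T g) (res B g x) (res B g y). u (g \<bullet>\<^bsub>T\<^esub> f, X, Y))"

text \<open>The section of \<open>E\<close> over \<open>(x, y)\<close> glued from local expressions, where \<open>L f X Y\<close> is the set of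
  elements of \<open>Isom(Y \<odot> X, X \<odot> Y)\<close> given by the local expression: its component at \<open>(X, Y)\<close> is the
  arrow which corresponds to the local expressions on all restrictions of \<open>X\<close> and \<open>Y\<close>.\<close>

definition glue :: "'u \<Rightarrow> 'b \<Rightarrow> 'b \<Rightarrow> ('s \<Rightarrow> 'o \<Rightarrow> 'o \<Rightarrow> 'm set) \<Rightarrow> ('s \<times> 'o \<times> 'o \<Rightarrow> 'm)" where
  "glue U x y L = (\<lambda>(f, X, Y)\<in>choices U x y. THE m. m \<in> fib_homs T C (Y \<odot> X) (X \<odot> Y)
     \<and> (\<forall>g\<in>arr T. tgt T g = src T f \<longrightarrow>
          (\<forall>X' Y'. \<forall>h\<in>homs_over C g X' X. \<forall>k\<in>homs_over C g Y' Y. \<forall>l\<in>L (f \<bullet>\<^bsub>T\<^esub> g) X' Y'.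
             m \<bullet> (k \<star> h) = (h \<star> k) \<bullet> l)))"

definition law1 :: "'u \<Rightarrow> 'b \<Rightarrow> 'b \<Rightarrow> 'b
    \<Rightarrow> ('s \<times> 'o \<times> 'o \<Rightarrow> 'm) \<Rightarrow> ('s \<times> 'o \<times> 'o \<Rightarrow> 'm) \<Rightarrow> ('s \<times> 'o \<times> 'o \<Rightarrow> 'm)" where
  "law1 U x x' y u v = glue U (x \<otimes>\<^bsub>sec B U\<^esub> x') y (\<lambda>f Z Y.
     {(c \<star> ide C Y) \<bullet> asc C X X' Y \<bullet> (ide C X \<star> v (f, X', Y)) \<bullet> arr_inv C (asc C X Y X')
        \<bullet> (u (f, X, Y) \<star> ide C X') \<bullet> asc C Y X X' \<bullet> (ide C Y \<star> arr_inv C c)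
      | X X' c. X \<in> objs_of_class (src T f) (res B f x) \<and> X' \<in> objs_of_class (src T f) (res B f x')
          \<and> c \<in> fib_homs T C (X \<odot> X') Z})"

definition law2 :: "'u \<Rightarrow> 'b \<Rightarrow> 'b \<Rightarrow> 'b
    \<Rightarrow> ('s \<times> 'o \<times> 'o \<Rightarrow> 'm) \<Rightarrow> ('s \<times> 'o \<times> 'o \<Rightarrow> 'm) \<Rightarrow> ('s \<times> 'o \<times> 'o \<Rightarrow> 'm)" where
  "law2 U x y y' u w = glue U x (y \<otimes>\<^bsub>sec B U\<^esub> y') (\<lambda>f X Z.
     {(ide C X \<star> c) \<bullet> arr_inv C (asc C X Y Y') \<bullet> (u (f, X, Y) \<star> ide C Y') \<bullet> asc C Y X Y'
        \<bullet> (ide C Y \<star> w (f, X, Y')) \<bullet> arr_inv C (asc C Y Y' X) \<bullet> (arr_inv C c \<star> ide C X)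
      | Y Y' c. Y \<in> objs_of_class (src T f) (res B f y) \<and> Y' \<in> objs_of_class (src T f) (res B f y')
          \<and> c \<in> fib_homs T C (Y \<odot> Y') Z})"

definition diag :: "'u \<Rightarrow> 'b \<Rightarrow> ('s \<times> 'o \<times> 'o \<Rightarrow> 'm)" where
  "diag U x = glue U x x (\<lambda>f X Y. if X = Y then {ide C (X \<odot> X)} else {})"

text \<open>There is a global section of \<open>E\<close> over \<open>B \<times> B\<close>, additive for both partial laws and with diagonal
  restriction \<open>diag\<close>.\<close>

definition trivial_alternating_biextension :: bool where
  "trivial_alternating_biextension \<longleftrightarrow> (\<exists>s.
     (\<forall>U\<in>obj T. \<forall>x\<in>carrier (sec B U). \<forall>y\<in>carrier (sec B U). s U x y \<in> E U x y)
     \<and> (\<forall>g\<in>arr T. \<forall>x\<in>carrier (sec B (tgt T g)). \<forall>y\<in>carrier (sec B (tgt T g)).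
          s (src T g) (res B g x) (res B g y) = E_res g x y (s (tgt T g) x y))
     \<and> (\<forall>U\<in>obj T. \<forall>x\<in>carrier (sec B U). \<forall>x'\<in>carrier (sec B U). \<forall>y\<in>carrier (sec B U).
          s U (x \<otimes>\<^bsub>sec B U\<^esub> x') y = law1 U x x' y (s U x y) (s U x' y))
     \<and> (\<forall>U\<in>obj T. \<forall>x\<in>carrier (sec B U). \<forall>y\<in>carrier (sec B U). \<forall>y'\<in>carrier (sec B U).
          s U x (y \<otimes>\<^bsub>sec B U\<^esub> y') = law2 U x y y' (s U x y) (s U x y'))
     \<and> (\<forall>U\<in>obj T. \<forall>x\<in>carrier (sec B U). s U x x = diag U x))"

end

end

theory Submission
  imports Defs
begin

text \<open>Evaluate the trivializing section \<open>s\<close> of the commutator at the classes of two objects \<open>X\<close>, \<open>Y\<close>: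
  its component at the pair \<open>(X, Y)\<close> is an arrow \<open>Y \<odot> X \<rightarrow> X \<odot> Y\<close>. Compatibility of \<open>s\<close> with
  restriction gives naturality, the two additivity properties become the hexagons, and the diagonal
  condition becomes strictness; symmetry then follows by polarization. Additivity is stated through
  glued local expressions, so one needs their independence of the local choices. This holds
  because objects of the same class are locally isomorphic and because automorphisms are central:
  \<open>\<rho> \<bullet> (Y \<otimes> \<theta>) = (\<theta> \<otimes> Y) \<bullet> \<rho>\<close> for \<open>\<theta> \<in> Aut Z\<close> and \<open>\<rho> : Y \<odot> Z \<rightarrow> Z \<odot> Y\<close>, a consequence of the
  triviality of the action of \<open>B\<close> on \<open>A\<close>.\<close>

section \<open>Categories and sites\<close>

text \<open>Two obstacles shape the work. Equality in \<open>B\<close> is equality in an associated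
  sheaf, so two objects of one class become isomorphic only after restriction along a cover;
  comparisons of choices are made there and brought back by separatedness of arrows. And the action
  is a definite description over all local objects of a class, so its triviality yields
  \<open>Y \<otimes> a = a \<otimes> Y\<close> only once that description is known to have exactly
  one solution. Centrality rests on tensoring with \<open>Z\<close> being fully faithful at the
  unit: an automorphism \<theta> of \<open>Z\<close> is \<open>a \<otimes> Z\<close> for an
  automorphism \<open>a\<close> of the unit, which passes \<open>Y\<close> by triviality of the
  action and passes \<rho> by functoriality of the tensor product. The constraints met on the way
  need no coherence computation: between objects with commutative automorphism groups, conjugation
  does not depend on the isomorphism used.\<close>

context category
begin

lemma cmp_simps [simp]:
  assumes "f \<in> arr C" "g \<in> arr C" "src C g = tgt C f"
  shows "g \<bullet> f \<in> arr C" "src C (g \<bullet> f) = src C f" "tgt C (g \<bullet> f) = tgt C g"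
  using cmp_homs[of f "src C f" "tgt C f" g "tgt C g"] assms by (auto simp: homs_def)

lemma ide_simps [simp]:
  assumes "X \<in> obj C"
  shows "ide C X \<in> arr C" "src C (ide C X) = X" "tgt C (ide C X) = X"
  using ide_homs[OF assms] by (auto simp: homs_def)

lemma cmp_ide' [simp]: "f \<in> arr C \<Longrightarrow> src C f = X \<Longrightarrow> f \<bullet> ide C X = f"
  using cmp_ide[of f X "tgt C f"] by (simp add: homs_def)

lemma ide_cmp' [simp]: "f \<in> arr C \<Longrightarrow> tgt C f = X \<Longrightarrow> ide C X \<bullet> f = f"
  using ide_cmp[of f "src C f" X] by (simp add: homs_def)

lemma assoc:
  assumes "f \<in> arr C" "g \<in> arr C" "h \<in> arr C" "src C g = tgt C f" "src C h = tgt C g"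
  shows "(h \<bullet> g) \<bullet> f = h \<bullet> (g \<bullet> f)"
  using cmp_assoc[of f "src C f" "tgt C f" g "tgt C g" h "tgt C h"] assms by (simp add: homs_def)

end

context grothendieck_site
begin

lemma cov_arr: "\<lbrakk>U \<in> obj T; R \<in> cov T U; f \<in> R\<rbrakk> \<Longrightarrow> f \<in> arr T \<and> tgt T f = U"
  using cov_sieve unfolding sieve_def by blast

lemma cov_closed:
  "\<lbrakk>U \<in> obj T; R \<in> cov T U; f \<in> R; g \<in> arr T; tgt T g = src T f\<rbrakk> \<Longrightarrow> f \<bullet>\<^bsub>T\<^esub> g \<in> R"
  using cov_sieve unfolding sieve_def by blast

text \<open>Pulled back along a member of \<open>R\<close>, the larger sieve becomes maximal, so
  local character applies.\<close>

lemma cov_superset: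
  assumes "U \<in> obj T" "R \<in> cov T U" "R \<subseteq> S" "sieve T U S"
  shows "S \<in> cov T U"
proof (rule cov_local[OF assms(1,2,4)])
  fix f assume f: "f \<in> R"
  have "pull_sieve T f S = max_sieve T (src T f)"
    unfolding pull_sieve_def max_sieve_def using cov_closed[OF assms(1,2) f] assms(3) by blast
  then show "pull_sieve T f S \<in> cov T (src T f)"
    using cov_max src_obj cov_arr[OF assms(1,2) f] by simp
qed

text \<open>Along a member of \<open>R\<close> the intersection pulls back to the same sieve as
  \<open>S\<close>, which is a cover by stability.\<close>

lemma cov_inter:
  assumes U: "U \<in> obj T" and R: "R \<in> cov T U" and S: "S \<in> cov T U"
  shows "R \<inter> S \<in> cov T U"
proof (rule cov_local[OF U R])
  show "sieve T U (R \<inter> S)"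
    using cov_sieve[OF U R] cov_sieve[OF U S] unfolding sieve_def by blast
next
  fix f assume f: "f \<in> R"
  have "pull_sieve T f (R \<inter> S) = pull_sieve T f S"
    unfolding pull_sieve_def using cov_closed[OF U R f] by blast
  then show "pull_sieve T f (R \<inter> S) \<in> cov T (src T f)"
    using cov_pull cov_arr[OF U R f] S by simp
qed

end


section \<open>The plus construction\<close>

text \<open>The axioms are those that the plus construction reproduces: a law compatible with
  functorial restriction. The locale thus applies to isomorphism classes of objects and again to
  their plus presheaf.\<close>

locale magma_presheaf = grothendieck_site T
  for T :: "('u, 's) site" and F :: "('u, 's, 'x) presheaf" +
  assumes mult_closed: "\<lbrakk>U \<in> obj T; x \<in> carrier (sec F U); y \<in> carrier (sec F U)\<rbrakk>
      \<Longrightarrow> x \<otimes>\<^bsub>sec F U\<^esub> y \<in> carrier (sec F U)"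
    and res_closed: "\<lbrakk>f \<in> arr T; x \<in> carrier (sec F (tgt T f))\<rbrakk>
      \<Longrightarrow> res F f x \<in> carrier (sec F (src T f))"
    and res_mult: "\<lbrakk>f \<in> arr T; x \<in> carrier (sec F (tgt T f)); y \<in> carrier (sec F (tgt T f))\<rbrakk>
      \<Longrightarrow> res F f (x \<otimes>\<^bsub>sec F (tgt T f)\<^esub> y) = res F f x \<otimes>\<^bsub>sec F (src T f)\<^esub> res F f y"
    and res_cmp: "\<lbrakk>f \<in> arr T; g \<in> arr T; tgt T g = src T f; x \<in> carrier (sec F (tgt T f))\<rbrakk>
      \<Longrightarrow> res F (f \<bullet>\<^bsub>T\<^esub> g) x = res F g (res F f x)"
begin

lemma matching_closed: "\<lbrakk>t \<in> matching T F R; f \<in> R\<rbrakk> \<Longrightarrow> t f \<in> carrier (sec F (src T f))"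
  unfolding matching_def by (auto simp: PiE_iff)

lemma matching_res:
  "\<lbrakk>t \<in> matching T F R; f \<in> R; g \<in> arr T; tgt T g = src T f\<rbrakk> \<Longrightarrow> t (f \<bullet>\<^bsub>T\<^esub> g) = res F g (t f)"
  unfolding matching_def by auto

lemma matching_mult:
  assumes U: "U \<in> obj T" and R: "R \<in> cov T U" and S: "S \<in> cov T U"
    and t: "t \<in> matching T F R" and w: "w \<in> matching T F S"
  shows "(\<lambda>f\<in>R \<inter> S. t f \<otimes>\<^bsub>sec F (src T f)\<^esub> w f) \<in> matching T F (R \<inter> S)"
proof -
  let ?p = "\<lambda>f. t f \<otimes>\<^bsub>sec F (src T f)\<^esub> w f"
  have 1: "?p f \<in> carrier (sec F (src T f))" if "f \<in> R \<inter> S" for f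
    using that cov_arr[OF U R] matching_closed[OF t] matching_closed[OF w]
    by (intro mult_closed src_obj) auto
  have 2: "f \<bullet>\<^bsub>T\<^esub> g \<in> R \<inter> S \<and> ?p (f \<bullet>\<^bsub>T\<^esub> g) = res F g (?p f)"
    if f: "f \<in> R \<inter> S" and g: "g \<in> arr T" "tgt T g = src T f" for f g
    using f g cov_arr[OF U R] cov_closed[OF U R _ g] cov_closed[OF U S _ g]
      matching_closed[OF t] matching_closed[OF w] matching_res[OF t _ g] matching_res[OF w _ g]
      res_mult[of g "t f" "w f"]
    by auto
  show ?thesis
    unfolding matching_def using 1 2 by auto
qed

lemma matching_pull:
  assumes g: "g \<in> arr T" and R: "R \<in> cov T (tgt T g)" and t: "t \<in> matching T F R"
  shows "(\<lambda>f\<in>pull_sieve T g R. t (g \<bullet>\<^bsub>T\<^esub> f)) \<in> matching T F (pull_sieve T g R)"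
proof -
  have 1: "t (g \<bullet>\<^bsub>T\<^esub> f) \<in> carrier (sec F (src T f))" if "f \<in> pull_sieve T g R" for f
    using that matching_closed[OF t] g by (fastforce simp: pull_sieve_def)
  have 2: "f \<bullet>\<^bsub>T\<^esub> k \<in> pull_sieve T g R \<and> t (g \<bullet>\<^bsub>T\<^esub> (f \<bullet>\<^bsub>T\<^esub> k)) = res F k (t (g \<bullet>\<^bsub>T\<^esub> f))"
    if "f \<in> pull_sieve T g R" "k \<in> arr T" "tgt T k = src T f" for f k
  proof -
    have "g \<bullet>\<^bsub>T\<^esub> (f \<bullet>\<^bsub>T\<^esub> k) = (g \<bullet>\<^bsub>T\<^esub> f) \<bullet>\<^bsub>T\<^esub> k"
      using that g by (auto simp: pull_sieve_def assoc)
    then show ?thesis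
      using that g cov_closed[OF tgt_obj[OF g] R, of "g \<bullet>\<^bsub>T\<^esub> f" k] matching_res[OF t, of "g \<bullet>\<^bsub>T\<^esub> f" k]
      by (auto simp: pull_sieve_def)
  qed
  show ?thesis
    unfolding matching_def using 1 2 by auto
qed

lemma matching_unit:
  assumes "U \<in> obj T" "x \<in> carrier (sec F U)"
  shows "(\<lambda>f\<in>max_sieve T U. res F f x) \<in> matching T F (max_sieve T U)"
  unfolding matching_def using assms by (auto simp: max_sieve_def res_closed res_cmp)

section \<open>Germs, and the plus construction as a presheaf with a law\<close>

lemma germ_of_self:
  "\<lbrakk>R \<in> cov T U; t \<in> matching T F R\<rbrakk> \<Longrightarrow> (R, t) \<in> germ_of T F U R t"
  unfolding germ_of_def by blast

lemma germ_of_eqI: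
  assumes U: "U \<in> obj T" and R: "R \<in> cov T U" and S: "S \<in> cov T U"
    and t: "t \<in> matching T F R" and w: "w \<in> matching T F S"
    and Q: "Q \<in> cov T U" "Q \<subseteq> R \<inter> S" "\<And>f. f \<in> Q \<Longrightarrow> t f = w f"
  shows "germ_of T F U R t = germ_of T F U S w"
proof -
  \<comment> \<open>Stated for arbitrary data, so that exchanging the two families gives the reverse
    inclusion. Agreement is transitive because two covering refinements have a common one.\<close>
  have sub: "germ_of T F U R t \<subseteq> germ_of T F U S w"
    if Q: "Q \<in> cov T U" "Q \<subseteq> R \<inter> S" "\<And>f. f \<in> Q \<Longrightarrow> t f = w f" for R S t w
  proof (rule subrelI)
    fix P p assume "(P, p) \<in> germ_of T F U R t"
    then obtain Q' where "P \<in> cov T U" "p \<in> matching T F P" "Q' \<in> cov T U" "Q' \<subseteq> R \<inter> P"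
      "\<forall>f\<in>Q'. t f = p f"
      unfolding germ_of_def by blast
    moreover from this have "Q \<inter> Q' \<in> cov T U" using cov_inter[OF U] Q by blast
    moreover have "Q \<inter> Q' \<subseteq> S \<inter> P" "\<forall>f\<in>Q \<inter> Q'. w f = p f" using calculation Q by force+
    ultimately show "(P, p) \<in> germ_of T F U S w"
      unfolding germ_of_def by blast
  qed
  show ?thesis
    by (rule subset_antisym; rule sub[OF Q(1)]) (use Q in auto)
qed

lemma germ_of_eqD:
  assumes "S \<in> cov T U" "w \<in> matching T F S" "germ_of T F U R t = germ_of T F U S w"
  shows "\<exists>Q\<in>cov T U. Q \<subseteq> R \<inter> S \<and> (\<forall>f\<in>Q. t f = w f)"
proof -
  have "(S, w) \<in> germ_of T F U R t"
    using germ_of_self[OF assms(1,2)] assms(3) by simp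
  then show ?thesis
    unfolding germ_of_def by auto
qed

lemma plus_carrier:
  "carrier (sec (plus_presheaf T F) U)
    = {germ_of T F U R t | R t. R \<in> cov T U \<and> t \<in> matching T F R}"
  by (simp add: plus_presheaf_def)

text \<open>The product is defined as a union over all representatives. Any two choices of
  representatives give the same germ, so this is a union of copies of one set over a nonempty index.
  \<open>plus_res\<close> follows the same pattern.\<close>

lemma plus_mult:
  assumes U: "U \<in> obj T" and R: "R \<in> cov T U" and S: "S \<in> cov T U"
    and t: "t \<in> matching T F R" and w: "w \<in> matching T F S"
  shows "germ_of T F U R t \<otimes>\<^bsub>sec (plus_presheaf T F) U\<^esub> germ_of T F U S w
    = germ_of T F U (R \<inter> S) (\<lambda>f\<in>R \<inter> S. t f \<otimes>\<^bsub>sec F (src T f)\<^esub> w f)"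
proof -
  have "germ_of T F U (R' \<inter> S') (\<lambda>f\<in>R' \<inter> S'. t' f \<otimes>\<^bsub>sec F (src T f)\<^esub> w' f)
      = germ_of T F U (R \<inter> S) (\<lambda>f\<in>R \<inter> S. t f \<otimes>\<^bsub>sec F (src T f)\<^esub> w f)"
    if "(R', t') \<in> germ_of T F U R t" "(S', w') \<in> germ_of T F U S w" for R' t' S' w'
  proof -
    from that obtain P Q where P: "R' \<in> cov T U" "t' \<in> matching T F R'" "P \<in> cov T U"
        "P \<subseteq> R \<inter> R'" "\<forall>f\<in>P. t f = t' f"
      and Q: "S' \<in> cov T U" "w' \<in> matching T F S'" "Q \<in> cov T U" "Q \<subseteq> S \<inter> S'" "\<forall>f\<in>Q. w f = w' f"
      unfolding germ_of_def by blast
    show ?thesis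
      by (rule germ_of_eqI[OF U cov_inter[OF U P(1) Q(1)] cov_inter[OF U R S]
            matching_mult[OF U P(1) Q(1) P(2) Q(2)] matching_mult[OF U R S t w]
            cov_inter[OF U P(3) Q(3)]])
        (use P Q in auto)
  qed
  then have "(\<Union>(R', t')\<in>germ_of T F U R t. \<Union>(S', w')\<in>germ_of T F U S w.
         germ_of T F U (R' \<inter> S') (\<lambda>f\<in>R' \<inter> S'. t' f \<otimes>\<^bsub>sec F (src T f)\<^esub> w' f))
      = (\<Union>(R', t')\<in>germ_of T F U R t. \<Union>(S', w')\<in>germ_of T F U S w.
         germ_of T F U (R \<inter> S) (\<lambda>f\<in>R \<inter> S. t f \<otimes>\<^bsub>sec F (src T f)\<^esub> w f))"
    by (intro SUP_cong refl) (auto split: prod.splits)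
  also have "\<dots> = germ_of T F U (R \<inter> S) (\<lambda>f\<in>R \<inter> S. t f \<otimes>\<^bsub>sec F (src T f)\<^esub> w f)"
    using germ_of_self[OF R t] germ_of_self[OF S w] by auto
  finally show ?thesis
    by (simp add: plus_presheaf_def)
qed

lemma plus_res:
  assumes g: "g \<in> arr T" and R: "R \<in> cov T (tgt T g)" and t: "t \<in> matching T F R"
  shows "res (plus_presheaf T F) g (germ_of T F (tgt T g) R t)
    = germ_of T F (src T g) (pull_sieve T g R) (\<lambda>f\<in>pull_sieve T g R. t (g \<bullet>\<^bsub>T\<^esub> f))"
proof -
  have "germ_of T F (src T g) (pull_sieve T g R') (\<lambda>f\<in>pull_sieve T g R'. t' (g \<bullet>\<^bsub>T\<^esub> f))
      = germ_of T F (src T g) (pull_sieve T g R) (\<lambda>f\<in>pull_sieve T g R. t (g \<bullet>\<^bsub>T\<^esub> f))"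
    if "(R', t') \<in> germ_of T F (tgt T g) R t" for R' t'
  proof -
    from that obtain P where P: "R' \<in> cov T (tgt T g)" "t' \<in> matching T F R'" "P \<in> cov T (tgt T g)"
        "P \<subseteq> R \<inter> R'" "\<forall>f\<in>P. t f = t' f"
      unfolding germ_of_def by blast
    show ?thesis
      by (rule germ_of_eqI[OF src_obj[OF g] cov_pull[OF g P(1)] cov_pull[OF g R]
            matching_pull[OF g P(1,2)] matching_pull[OF g R t] cov_pull[OF g P(3)]])
        (use P in \<open>auto simp: pull_sieve_def\<close>)
  qed
  then have "(\<Union>(R', t')\<in>germ_of T F (tgt T g) R t.
        germ_of T F (src T g) (pull_sieve T g R') (\<lambda>f\<in>pull_sieve T g R'. t' (g \<bullet>\<^bsub>T\<^esub> f)))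
      = (\<Union>(R', t')\<in>germ_of T F (tgt T g) R t.
        germ_of T F (src T g) (pull_sieve T g R) (\<lambda>f\<in>pull_sieve T g R. t (g \<bullet>\<^bsub>T\<^esub> f)))"
    by (intro SUP_cong refl) (auto split: prod.splits)
  also have "\<dots> = germ_of T F (src T g) (pull_sieve T g R) (\<lambda>f\<in>pull_sieve T g R. t (g \<bullet>\<^bsub>T\<^esub> f))"
    using germ_of_self[OF R t] by auto
  finally show ?thesis
    by (simp add: plus_presheaf_def)
qed

lemma plus_magma_presheaf: "magma_presheaf T (plus_presheaf T F)"
proof
  fix U x y
  assume U: "U \<in> obj T" and "x \<in> carrier (sec (plus_presheaf T F) U)"
    and "y \<in> carrier (sec (plus_presheaf T F) U)"
  then obtain R t S w where
      R: "R \<in> cov T U" "t \<in> matching T F R" "x = germ_of T F U R t"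
    and S: "S \<in> cov T U" "w \<in> matching T F S" "y = germ_of T F U S w"
    unfolding plus_carrier by blast
  then show "x \<otimes>\<^bsub>sec (plus_presheaf T F) U\<^esub> y \<in> carrier (sec (plus_presheaf T F) U)"
    using cov_inter[OF U R(1) S(1)] matching_mult[OF U R(1) S(1) R(2) S(2)]
      plus_mult[OF U R(1) S(1) R(2) S(2)] unfolding plus_carrier R(3) S(3) by blast
next
  fix f x
  assume f: "f \<in> arr T" and "x \<in> carrier (sec (plus_presheaf T F) (tgt T f))"
  then obtain R t where
      R: "R \<in> cov T (tgt T f)" "t \<in> matching T F R" "x = germ_of T F (tgt T f) R t"
    unfolding plus_carrier by blast
  then show "res (plus_presheaf T F) f x \<in> carrier (sec (plus_presheaf T F) (src T f))"
    using cov_pull[OF f R(1)] matching_pull[OF f R(1,2)] plus_res[OF f R(1,2)]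
    unfolding plus_carrier R(3) by blast
next
  fix f x y
  assume f: "f \<in> arr T" and "x \<in> carrier (sec (plus_presheaf T F) (tgt T f))"
    and "y \<in> carrier (sec (plus_presheaf T F) (tgt T f))"
  then obtain R t S w where
      R: "R \<in> cov T (tgt T f)" "t \<in> matching T F R" "x = germ_of T F (tgt T f) R t"
    and S: "S \<in> cov T (tgt T f)" "w \<in> matching T F S" "y = germ_of T F (tgt T f) S w"
    unfolding plus_carrier by blast
  note U = tgt_obj[OF f] and V = src_obj[OF f]
  have eq: "pull_sieve T f (R \<inter> S) = pull_sieve T f R \<inter> pull_sieve T f S"
    by (auto simp: pull_sieve_def)
  have "(\<lambda>g\<in>pull_sieve T f (R \<inter> S).
        (\<lambda>f\<in>R \<inter> S. t f \<otimes>\<^bsub>sec F (src T f)\<^esub> w f) (f \<bullet>\<^bsub>T\<^esub> g))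
      = (\<lambda>g\<in>pull_sieve T f R \<inter> pull_sieve T f S.
        (\<lambda>g\<in>pull_sieve T f R. t (f \<bullet>\<^bsub>T\<^esub> g)) g \<otimes>\<^bsub>sec F (src T g)\<^esub>
        (\<lambda>g\<in>pull_sieve T f S. w (f \<bullet>\<^bsub>T\<^esub> g)) g)"
    unfolding eq using f by (intro restrict_ext) (auto simp: pull_sieve_def)
  then show "res (plus_presheaf T F) f (x \<otimes>\<^bsub>sec (plus_presheaf T F) (tgt T f)\<^esub> y)
      = res (plus_presheaf T F) f x \<otimes>\<^bsub>sec (plus_presheaf T F) (src T f)\<^esub> res (plus_presheaf T F) f y"
    unfolding R(3) S(3) plus_mult[OF U R(1) S(1) R(2) S(2)] plus_res[OF f R(1,2)] plus_res[OF f S(1,2)]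
      plus_res[OF f cov_inter[OF U R(1) S(1)] matching_mult[OF U R(1) S(1) R(2) S(2)]]
      plus_mult[OF V cov_pull[OF f R(1)] cov_pull[OF f S(1)] matching_pull[OF f R(1,2)] matching_pull[OF f S(1,2)]]
    by (simp only: eq)
next
  fix f g x
  assume f: "f \<in> arr T" and g: "g \<in> arr T" and fg: "tgt T g = src T f"
    and "x \<in> carrier (sec (plus_presheaf T F) (tgt T f))"
  then obtain R t where R: "R \<in> cov T (tgt T f)" "t \<in> matching T F R" "x = germ_of T F (tgt T f) R t"
    unfolding plus_carrier by blast
  have eq: "pull_sieve T g (pull_sieve T f R) = pull_sieve T (f \<bullet>\<^bsub>T\<^esub> g) R"
    using f g fg by (auto simp: pull_sieve_def assoc)
  have c: "pull_sieve T f R \<in> cov T (tgt T g)"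
    using fg cov_pull[OF f R(1)] by simp
  have "res (plus_presheaf T F) g (res (plus_presheaf T F) f x)
      = res (plus_presheaf T F) g (germ_of T F (tgt T g) (pull_sieve T f R) (\<lambda>g\<in>pull_sieve T f R. t (f \<bullet>\<^bsub>T\<^esub> g)))"
    unfolding R(3) plus_res[OF f R(1,2)] fg ..
  also have "\<dots> = germ_of T F (src T g) (pull_sieve T g (pull_sieve T f R))
      (\<lambda>h\<in>pull_sieve T g (pull_sieve T f R). (\<lambda>g\<in>pull_sieve T f R. t (f \<bullet>\<^bsub>T\<^esub> g)) (g \<bullet>\<^bsub>T\<^esub> h))"
    by (rule plus_res[OF g c matching_pull[OF f R(1,2)]])
  also have "(\<lambda>h\<in>pull_sieve T g (pull_sieve T f R). (\<lambda>g\<in>pull_sieve T f R. t (f \<bullet>\<^bsub>T\<^esub> g)) (g \<bullet>\<^bsub>T\<^esub> h))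
      = (\<lambda>h\<in>pull_sieve T (f \<bullet>\<^bsub>T\<^esub> g) R. t ((f \<bullet>\<^bsub>T\<^esub> g) \<bullet>\<^bsub>T\<^esub> h))"
    unfolding eq using f g fg by (intro restrict_ext) (auto simp: pull_sieve_def assoc)
  finally show "res (plus_presheaf T F) (f \<bullet>\<^bsub>T\<^esub> g) x
      = res (plus_presheaf T F) g (res (plus_presheaf T F) f x)"
    unfolding R(3) using plus_res[of "f \<bullet>\<^bsub>T\<^esub> g" R t] R f g fg by (simp add: eq restrict_def)
qed

section \<open>The canonical map to the associated sheaf\<close>

lemma plus_unit_closed:
  "\<lbrakk>U \<in> obj T; x \<in> carrier (sec F U)\<rbrakk> \<Longrightarrow> plus_unit T F U x \<in> carrier (sec (plus_presheaf T F) U)"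
  unfolding plus_carrier plus_unit_def using cov_max matching_unit by blast

lemma plus_unit_mult:
  assumes U: "U \<in> obj T" and x: "x \<in> carrier (sec F U)" and y: "y \<in> carrier (sec F U)"
  shows "plus_unit T F U (x \<otimes>\<^bsub>sec F U\<^esub> y)
    = plus_unit T F U x \<otimes>\<^bsub>sec (plus_presheaf T F) U\<^esub> plus_unit T F U y"
proof -
  have "(\<lambda>f\<in>max_sieve T U. res F f (x \<otimes>\<^bsub>sec F U\<^esub> y))
      = (\<lambda>f\<in>max_sieve T U \<inter> max_sieve T U. (\<lambda>f\<in>max_sieve T U. res F f x) f
          \<otimes>\<^bsub>sec F (src T f)\<^esub> (\<lambda>f\<in>max_sieve T U. res F f y) f)"
    using x y by (simp only: Int_absorb, intro restrict_ext) (auto simp: max_sieve_def res_mult)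
  then show ?thesis
    unfolding plus_unit_def
      plus_mult[OF U cov_max[OF U] cov_max[OF U] matching_unit[OF U x] matching_unit[OF U y]]
    by simp
qed

lemma plus_unit_res:
  assumes g: "g \<in> arr T" and x: "x \<in> carrier (sec F (tgt T g))"
  shows "res (plus_presheaf T F) g (plus_unit T F (tgt T g) x) = plus_unit T F (src T g) (res F g x)"
proof -
  have eq: "pull_sieve T g (max_sieve T (tgt T g)) = max_sieve T (src T g)"
    using g by (auto simp: pull_sieve_def max_sieve_def)
  have "(\<lambda>f\<in>max_sieve T (src T g). (\<lambda>f\<in>max_sieve T (tgt T g). res F f x) (g \<bullet>\<^bsub>T\<^esub> f))
      = (\<lambda>f\<in>max_sieve T (src T g). res F f (res F g x))"
    using g x by (intro restrict_ext) (auto simp: max_sieve_def res_cmp)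
  then show ?thesis
    unfolding plus_unit_def
      plus_res[OF g cov_max[OF tgt_obj[OF g]] matching_unit[OF tgt_obj[OF g] x]] eq
    by simp
qed

text \<open>Equal germs have representatives agreeing on some covering sieve \<open>Q\<close>. The
  arrows along which \<open>x\<close> and \<open>y\<close> have equal restrictions form a sieve
  containing \<open>Q\<close>, hence a cover.\<close>

lemma plus_unit_locally_inj:
  assumes U: "U \<in> obj T" and x: "x \<in> carrier (sec F U)" and y: "y \<in> carrier (sec F U)"
    and eq: "plus_unit T F U x = plus_unit T F U y"
  shows "{f \<in> arr T. tgt T f = U \<and> res F f x = res F f y} \<in> cov T U" (is "?S \<in> _")
proof -
  from germ_of_eqD[OF cov_max[OF U] matching_unit[OF U y] eq[unfolded plus_unit_def]]
  obtain Q where Q: "Q \<in> cov T U" "Q \<subseteq> max_sieve T U \<inter> max_sieve T U"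
      "\<forall>f\<in>Q. (\<lambda>f\<in>max_sieve T U. res F f x) f = (\<lambda>f\<in>max_sieve T U. res F f y) f"
    by (elim bexE conjE)
  show ?thesis
  proof (rule cov_superset[OF U Q(1)])
    show "Q \<subseteq> ?S"
      using Q(2,3) by (auto simp: max_sieve_def subset_iff)
    show "sieve T U ?S"
      unfolding sieve_def using x y by (auto simp: res_cmp)
  qed
qed

lemma sheafify_unit_closed:
  "\<lbrakk>U \<in> obj T; x \<in> carrier (sec F U)\<rbrakk> \<Longrightarrow> sheafify_unit T F U x \<in> carrier (sec (sheafify T F) U)"
  unfolding sheafify_unit_def sheafify_def
  by (intro magma_presheaf.plus_unit_closed[OF plus_magma_presheaf] plus_unit_closed)

lemma sheafify_unit_mult:
  "\<lbrakk>U \<in> obj T; x \<in> carrier (sec F U); y \<in> carrier (sec F U)\<rbrakk>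
    \<Longrightarrow> sheafify_unit T F U (x \<otimes>\<^bsub>sec F U\<^esub> y)
      = sheafify_unit T F U x \<otimes>\<^bsub>sec (sheafify T F) U\<^esub> sheafify_unit T F U y"
  unfolding sheafify_unit_def sheafify_def
  by (simp add: magma_presheaf.plus_unit_mult[OF plus_magma_presheaf] plus_unit_closed plus_unit_mult)

lemma sheafify_unit_res:
  "\<lbrakk>g \<in> arr T; x \<in> carrier (sec F (tgt T g))\<rbrakk>
    \<Longrightarrow> res (sheafify T F) g (sheafify_unit T F (tgt T g) x) = sheafify_unit T F (src T g) (res F g x)"
  unfolding sheafify_unit_def sheafify_def
  by (simp add: magma_presheaf.plus_unit_res[OF plus_magma_presheaf] tgt_obj plus_unit_closed plus_unit_res)

text \<open>Equality after two plus steps gives, on a cover, equality after one step, and over each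
  member of that cover a further cover on which the restrictions agree. Local character composes the
  two.\<close>

lemma sheafify_unit_locally_inj:
  assumes U: "U \<in> obj T" and x: "x \<in> carrier (sec F U)" and y: "y \<in> carrier (sec F U)"
    and eq: "sheafify_unit T F U x = sheafify_unit T F U y"
  shows "{f \<in> arr T. tgt T f = U \<and> res F f x = res F f y} \<in> cov T U" (is "?S \<in> _")
proof (rule cov_local[OF U])
  let ?R = "{f \<in> arr T. tgt T f = U \<and>
    res (plus_presheaf T F) f (plus_unit T F U x) = res (plus_presheaf T F) f (plus_unit T F U y)}"
  show "?R \<in> cov T U"
    using magma_presheaf.plus_unit_locally_inj[OF plus_magma_presheaf U plus_unit_closed[OF U x]
        plus_unit_closed[OF U y] eq[unfolded sheafify_unit_def]] .
  show "sieve T U ?S"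
    unfolding sieve_def using x y by (auto simp: res_cmp)
  fix f assume f: "f \<in> ?R"
  then have "plus_unit T F (src T f) (res F f x) = plus_unit T F (src T f) (res F f y)"
    using plus_unit_res[of f x] plus_unit_res[of f y] x y by auto
  then have "{g \<in> arr T. tgt T g = src T f \<and> res F g (res F f x) = res F g (res F f y)} \<in> cov T (src T f)"
    using f x y by (intro plus_unit_locally_inj) (auto simp: src_obj res_closed)
  also have "{g \<in> arr T. tgt T g = src T f \<and> res F g (res F f x) = res F g (res F f y)}
      = pull_sieve T f ?S"
    using f x y by (auto simp: pull_sieve_def res_cmp)
  finally show "pull_sieve T f ?S \<in> cov T (src T f)" .
qed

end

section \<open>Stacks in groupoids\<close>

context stack_in_groupoids
begin

lemma category_site: "category T"
  by unfold_locales

lemma fib_homs_iff: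
  "h \<in> fib_homs T C X Y \<longleftrightarrow>
    h \<in> arr C \<and> src C h = X \<and> tgt C h = Y \<and> base_arr C h = ide T (base_obj C X)"
  by (auto simp: fib_homs_def homs_over_def homs_def)

lemma homs_over_iff:
  "h \<in> homs_over C f X Y \<longleftrightarrow> h \<in> arr C \<and> src C h = X \<and> tgt C h = Y \<and> base_arr C h = f"
  by (auto simp: homs_over_def homs_def)

lemma base_arr_simps:
  assumes "h \<in> arr C"
  shows "base_arr C h \<in> arr T" "src T (base_arr C h) = base_obj C (src C h)"
    "tgt T (base_arr C h) = base_obj C (tgt C h)"
  using base_arr[of h "src C h" "tgt C h"] assms by (auto simp: homs_def)

lemma homs_over_base:
  assumes "h \<in> homs_over C f X Y"
  shows "X \<in> obj C" "Y \<in> obj C" "base_obj C X = src T f" "base_obj C Y = tgt T f" "f \<in> arr T"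
  using assms base_arr_simps[of h] src_obj tgt_obj by (auto simp: homs_over_iff)

lemma fib_homs_base:
  assumes "h \<in> fib_homs T C X Y"
  shows "X \<in> obj C" "Y \<in> obj C" "base_obj C Y = base_obj C X"
  using assms base_arr_simps[of h] src_obj tgt_obj base_obj[of X]
    category.ide_simps[OF category_site] by (auto simp: fib_homs_iff)

lemma base_arr_cmp:
  assumes "h \<in> arr C" "k \<in> arr C" "src C k = tgt C h"
  shows "base_arr C (k \<bullet> h) = base_arr C k \<bullet>\<^bsub>T\<^esub> base_arr C h"
  using base_cmp[of h "src C h" "tgt C h" k "tgt C k"] assms by (auto simp: homs_def)

lemma homs_over_cmp:
  "\<lbrakk>h \<in> homs_over C f X Y; k \<in> homs_over C g Y Z\<rbrakk> \<Longrightarrow> k \<bullet> h \<in> homs_over C (g \<bullet>\<^bsub>T\<^esub> f) X Z"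
  by (auto simp: homs_over_iff base_arr_cmp)

lemma fib_cmp_over:
  assumes "h \<in> homs_over C f X Y" "k \<in> fib_homs T C Y Z"
  shows "k \<bullet> h \<in> homs_over C f X Z"
  using homs_over_cmp[OF assms[unfolded fib_homs_def]] homs_over_base[OF assms(1)]
    category.ide_cmp'[OF category_site, of f] by simp

lemma over_cmp_fib:
  assumes "k \<in> fib_homs T C X Y" "h \<in> homs_over C f Y Z"
  shows "h \<bullet> k \<in> homs_over C f X Z"
  using homs_over_cmp[OF assms[unfolded fib_homs_def]] homs_over_base[OF assms(2)]
    fib_homs_base[OF assms(1)] category.cmp_ide'[OF category_site, of f] by simp

lemma fib_homs_over_ide:
  "h \<in> fib_homs T C X Y \<Longrightarrow> base_obj C X = U \<Longrightarrow> h \<in> homs_over C (ide T U) X Y"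
  by (simp add: fib_homs_def)

lemma fib_cmp:
  assumes "k \<in> fib_homs T C X Y" "h \<in> fib_homs T C Y Z"
  shows "h \<bullet> k \<in> fib_homs T C X Z"
  using fib_cmp_over[OF assms(1)[unfolded fib_homs_def] assms(2)] by (simp add: fib_homs_def)

lemma fib_ide: "X \<in> obj C \<Longrightarrow> ide C X \<in> fib_homs T C X X"
  by (simp add: fib_homs_iff base_ide)

lemma over_factor:
  assumes h: "h \<in> homs_over C f Y X" and k: "k \<in> homs_over C (f \<bullet>\<^bsub>T\<^esub> g) Z X"
    and g: "g \<in> arr T" "src T g = base_obj C Z" "tgt T g = base_obj C Y"
  obtains l where "l \<in> homs_over C g Z Y" "h \<bullet> l = k"
  using cartesian[of h Y X k Z g] h k g by (auto simp: homs_over_def homs_def)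

lemma over_factor_fib:
  assumes h: "h \<in> homs_over C f Y X" and k: "k \<in> homs_over C f Z X"
  obtains l where "l \<in> fib_homs T C Z Y" "h \<bullet> l = k"
proof -
  have "f \<bullet>\<^bsub>T\<^esub> ide T (base_obj C Z) = f"
    using homs_over_base[OF k] category.cmp_ide'[OF category_site, of f] by simp
  then show ?thesis
    using over_factor[OF h, where g = "ide T (base_obj C Z)" and Z = Z] k homs_over_base[OF k] homs_over_base[OF h]
      category.ide_simps[OF category_site, of "base_obj C Z"] that base_obj[of Z]
    by (auto simp: fib_homs_def)
qed

lemma over_cancel:
  assumes h: "h \<in> homs_over C f Y X"
    and l: "l \<in> homs_over C g Z Y" "l' \<in> homs_over C g Z Y" and eq: "h \<bullet> l = h \<bullet> l'"
  shows "l = l'"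
proof -
  have "h \<bullet> l \<in> homs C Z X" "base_arr C (h \<bullet> l) = base_arr C h \<bullet>\<^bsub>T\<^esub> g" "h \<in> homs C Y X"
    "g \<in> homs T (base_obj C Z) (base_obj C Y)"
    using h l homs_over_cmp[OF l(1) h] homs_over_base[OF l(1)] by (auto simp: homs_over_def homs_def)
  from cartesian[OF this(3,1,4,2)] show ?thesis
    using l eq by metis
qed

lemma fib_cancel:
  assumes "h \<in> fib_homs T C Y X" "l \<in> homs_over C g Z Y" "l' \<in> homs_over C g Z Y" "h \<bullet> l = h \<bullet> l'"
  shows "l = l'"
  using over_cancel[OF assms(1)[unfolded fib_homs_def] assms(2-)] .

text \<open>Every arrow is cartesian, so the identity of \<open>Y\<close> lifts through
  \<open>h\<close> to a right inverse; cancelling \<open>h\<close> makes it two-sided. Uniqueness of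
  inverses then evaluates the description in \<open>arr_inv\<close>.\<close>

lemma fib_inv:
  assumes h: "h \<in> fib_homs T C X Y"
  shows "arr_inv C h \<in> fib_homs T C Y X" "arr_inv C h \<bullet> h = ide C X" "h \<bullet> arr_inv C h = ide C Y"
proof -
  note b = fib_homs_base[OF h]
  have h': "h \<in> homs_over C (ide T (base_obj C X)) X Y"
    using h by (simp add: fib_homs_def)
  have "ide C Y \<in> homs_over C (ide T (base_obj C X)) Y Y"
    using fib_ide[OF b(2)] b by (simp add: fib_homs_def)
  from over_factor_fib[OF h' this] obtain l where l: "l \<in> fib_homs T C Y X" "h \<bullet> l = ide C Y" .
  have "h \<bullet> (l \<bullet> h) = h \<bullet> ide C X"
    using h l b assoc[of h l h, symmetric] by (auto simp: fib_homs_iff)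
  then have lh: "l \<bullet> h = ide C X"
    using over_cancel[OF h' fib_cmp[OF h l(1), unfolded fib_homs_def] fib_ide[OF b(1), unfolded fib_homs_def]]
    by simp
  have "arr_inv C h = l"
    unfolding arr_inv_def
  proof (rule the_equality)
    show "l \<in> homs C (tgt C h) (src C h) \<and> l \<bullet> h = ide C (src C h) \<and> h \<bullet> l = ide C (tgt C h)"
      using h l lh by (auto simp: fib_homs_iff homs_def)
    fix k assume k: "k \<in> homs C (tgt C h) (src C h) \<and> k \<bullet> h = ide C (src C h) \<and> h \<bullet> k = ide C (tgt C h)"
    then have "k = k \<bullet> (h \<bullet> l)"
      using h l by (auto simp: fib_homs_iff homs_def)
    also have "\<dots> = (k \<bullet> h) \<bullet> l"
      using k h l by (intro assoc[symmetric]) (auto simp: fib_homs_iff homs_def)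
    also have "\<dots> = l"
      using k h l by (auto simp: fib_homs_iff)
    finally show "k = l" .
  qed
  then show "arr_inv C h \<in> fib_homs T C Y X" "arr_inv C h \<bullet> h = ide C X" "h \<bullet> arr_inv C h = ide C Y"
    using l lh by auto
qed

lemma fib_epi:
  assumes h: "h \<in> fib_homs T C X Y" and l: "l \<in> homs_over C f Y Z" "l' \<in> homs_over C f Y Z"
    and eq: "l \<bullet> h = l' \<bullet> h"
  shows "l = l'"
proof -
  have "k = (k \<bullet> h) \<bullet> arr_inv C h" if "k \<in> homs_over C f Y Z" for k
    using that h fib_inv[OF h] by (auto simp: fib_homs_iff homs_over_iff assoc)
  then show ?thesis
    using l eq by metis
qed

text \<open>This extends the uniqueness half of \<open>homs_sheaf\<close> in two directions: the
  arrows may lie over any \<open>f\<close>, and agreement is asked on a single restriction of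
  \<open>X\<close> for each member of the cover.\<close>

lemma separated:
  assumes R: "R \<in> cov T (base_obj C X)"
    and m: "m \<in> homs_over C f X Y" "m' \<in> homs_over C f X Y"
    and eq: "\<And>g. g \<in> R \<Longrightarrow> \<exists>W. \<exists>h\<in>homs_over C g W X. m \<bullet> h = m' \<bullet> h"
  shows "m = m'"
proof -
  let ?U = "base_obj C X"
  note b = homs_over_base[OF m(1)]
  \<comment> \<open>The sheaf axiom concerns arrows in a fibre, so the target is restricted along
    \<open>f\<close> and both arrows are factored through the cartesian arrow
    \<open>q\<close>.\<close>
  obtain Y1 q where q: "q \<in> homs_over C f Y1 Y"
    using lift[of f ?U "base_obj C Y" Y] b by (auto simp: homs_def obj_over_def)
  from over_factor_fib[OF q m(1)] obtain m1 where m1: "m1 \<in> fib_homs T C X Y1" "q \<bullet> m1 = m" .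
  from over_factor_fib[OF q m(2)] obtain m2 where m2: "m2 \<in> fib_homs T C X Y1" "q \<bullet> m2 = m'" .
  note Y1 = homs_over_base[OF q]
  have same: "m1 \<bullet> h = m2 \<bullet> h" if g: "g \<in> R" and h: "h \<in> homs_over C g X' X" for g X' h
  proof -
    obtain W h0 where h0: "h0 \<in> homs_over C g W X" "m \<bullet> h0 = m' \<bullet> h0"
      using eq[OF g] by blast
    have "q \<bullet> (m1 \<bullet> h0) = q \<bullet> (m2 \<bullet> h0)"
      using h0 m1 m2 q by (auto simp: assoc[symmetric] fib_homs_iff homs_over_iff)
    then have 1: "m1 \<bullet> h0 = m2 \<bullet> h0"
      by (rule over_cancel[OF q fib_cmp_over[OF h0(1) m1(1)] fib_cmp_over[OF h0(1) m2(1)]])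
    \<comment> \<open>Agreement on one restriction over \<open>g\<close> spreads to all of them,
      since they are isomorphic to it in the fibre.\<close>
    from over_factor_fib[OF h0(1) h] obtain l where l: "l \<in> fib_homs T C X' W" "h0 \<bullet> l = h" .
    have "m1 \<bullet> h = (m1 \<bullet> h0) \<bullet> l" "m2 \<bullet> h = (m2 \<bullet> h0) \<bullet> l"
      using l h0 m1 m2 by (auto simp: assoc fib_homs_iff homs_over_iff)
    with 1 show ?thesis by simp
  qed
  \<comment> \<open>Both \<open>m1\<close> and \<open>m2\<close> glue the family sending
    \<open>h\<close> to \<open>m1 \<bullet> h\<close>, so uniqueness of the gluing identifies
    them.\<close>
  have "\<exists>!n. n \<in> fib_homs T C X Y1 \<and> (\<forall>f\<in>R. \<forall>X'. \<forall>h\<in>homs_over C f X' X. n \<bullet> h = m1 \<bullet> h)"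
  proof (rule homs_sheaf[OF _ R])
    show "?U \<in> obj T" "X \<in> obj_over C ?U" "Y1 \<in> obj_over C ?U"
      using b Y1 base_obj[of X] by (auto simp: obj_over_def)
    show "m1 \<bullet> h \<in> homs_over C f X' Y1" if "h \<in> homs_over C f X' X" for f X' h
      using fib_cmp_over[OF that m1(1)] .
    show "m1 \<bullet> (h \<bullet> l) = (m1 \<bullet> h) \<bullet> l" if "h \<in> homs_over C f X' X" "l \<in> homs C X'' X'" for f X' X'' h l
      using that m1 by (auto simp: assoc fib_homs_iff homs_over_iff homs_def)
  qed
  then have "m1 = m2"
    using m1(1) m2(1) same by metis
  then show ?thesis
    using m1 m2 by simp
qed

text \<open>Commutative squares with vertical arrows \<open>p\<close>, \<open>q\<close> in the fibres and horizontal arrows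
  \<open>h\<close>, \<open>k\<close> over \<open>f\<close>; naturality of composite constraints is obtained by pasting them.\<close>

definition square :: "'s \<Rightarrow> 'm \<Rightarrow> 'm \<Rightarrow> 'm \<Rightarrow> 'm \<Rightarrow> bool" where
  "square f h p q k \<longleftrightarrow> (\<exists>X Y X' Y'. h \<in> homs_over C f X X' \<and> k \<in> homs_over C f Y Y'
     \<and> p \<in> fib_homs T C X Y \<and> q \<in> fib_homs T C X' Y' \<and> q \<bullet> h = k \<bullet> p)"

lemma squareI:
  "\<lbrakk>h \<in> homs_over C f X X'; k \<in> homs_over C f Y Y'; p \<in> fib_homs T C X Y; q \<in> fib_homs T C X' Y';
    q \<bullet> h = k \<bullet> p\<rbrakk> \<Longrightarrow> square f h p q k"
  unfolding square_def by blast

lemma squareD: "square f h p q k \<Longrightarrow> q \<bullet> h = k \<bullet> p"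
  unfolding square_def by blast

lemma squareE:
  assumes "square f h p q k" "h \<in> homs_over C f X X'" "k \<in> homs_over C f Y Y'"
  shows "p \<in> fib_homs T C X Y" "q \<in> fib_homs T C X' Y'" "q \<bullet> h = k \<bullet> p"
  using assms by (auto simp: square_def homs_over_iff fib_homs_iff)

lemma square_cmp:
  assumes "square f h p q k" "square f k p' q' l"
  shows "square f h (p' \<bullet> p) (q' \<bullet> q) l"
proof -
  from assms(1) obtain X Y X' Y' where 1: "h \<in> homs_over C f X X'" "k \<in> homs_over C f Y Y'"
      "p \<in> fib_homs T C X Y" "q \<in> fib_homs T C X' Y'" "q \<bullet> h = k \<bullet> p"
    unfolding square_def by blast
  from assms(2) 1(2) obtain Z Z' where 2: "l \<in> homs_over C f Z Z'"
      "p' \<in> fib_homs T C Y Z" "q' \<in> fib_homs T C Y' Z'" "q' \<bullet> k = l \<bullet> p'"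
    unfolding square_def homs_over_iff by blast
  have "(q' \<bullet> q) \<bullet> h = q' \<bullet> (k \<bullet> p)"
    using 1 2 by (auto simp: assoc fib_homs_iff homs_over_iff)
  also have "\<dots> = (q' \<bullet> k) \<bullet> p"
    using 1 2 by (subst assoc) (auto simp: fib_homs_iff homs_over_iff)
  also have "\<dots> = l \<bullet> (p' \<bullet> p)"
    using 1 2 by (auto simp: assoc fib_homs_iff homs_over_iff)
  finally show ?thesis
    using squareI[OF 1(1) 2(1) fib_cmp[OF 1(3) 2(2)] fib_cmp[OF 1(4) 2(3)]] by simp
qed

lemma square_inv:
  assumes "square f h p q k"
  shows "square f k (arr_inv C p) (arr_inv C q) h"
proof -
  from assms obtain X Y X' Y' where 1: "h \<in> homs_over C f X X'" "k \<in> homs_over C f Y Y'"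
      "p \<in> fib_homs T C X Y" "q \<in> fib_homs T C X' Y'" "q \<bullet> h = k \<bullet> p"
    unfolding square_def by blast
  note p = fib_inv[OF 1(3)] and q = fib_inv[OF 1(4)]
  have "q \<bullet> (h \<bullet> arr_inv C p) = (k \<bullet> p) \<bullet> arr_inv C p"
    using 1 p by (subst assoc[symmetric]) (auto simp: fib_homs_iff homs_over_iff)
  also have "\<dots> = k"
    using 1 p by (auto simp: assoc fib_homs_iff homs_over_iff)
  also have "\<dots> = (q \<bullet> arr_inv C q) \<bullet> k"
    using 1 q by (auto simp: fib_homs_iff homs_over_iff)
  also have "\<dots> = q \<bullet> (arr_inv C q \<bullet> k)"
    using 1 q by (subst assoc) (auto simp: fib_homs_iff homs_over_iff)
  finally have "h \<bullet> arr_inv C p = arr_inv C q \<bullet> k"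
    by (rule fib_cancel[OF 1(4) over_cmp_fib[OF p(1) 1(1)] fib_cmp_over[OF 1(2) q(1)]])
  then show ?thesis
    using squareI[OF 1(2,1) p(1) q(1)] by simp
qed

lemma square_ide:
  "h \<in> homs_over C f X X' \<Longrightarrow> square f h (ide C X) (ide C X') h"
  using homs_over_base[of h f X X'] by (intro squareI) (auto simp: fib_ide homs_over_iff)

lemma square_const:
  "\<lbrakk>p \<in> fib_homs T C X Y; base_obj C X = U\<rbrakk> \<Longrightarrow> square (ide T U) (ide C X) p p (ide C Y)"
  using fib_homs_base[of p X Y] fib_homs_over_ide[OF fib_ide[of X], of U] fib_homs_over_ide[OF fib_ide[of Y], of U]
  by (intro squareI[where X = X and Y = Y]) (auto simp: fib_homs_iff)

text \<open>Pasting along a common vertical arrow, as opposed to \<open>square_cmp\<close>, which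
  composes the vertical arrows; the base arrows are composed too.\<close>

lemma square_hcmp:
  assumes "square f h p q k" "square g h' q r k'"
  shows "square (g \<bullet>\<^bsub>T\<^esub> f) (h' \<bullet> h) p r (k' \<bullet> k)"
proof -
  from assms(1) obtain X Y X' Y' where 1: "h \<in> homs_over C f X X'" "k \<in> homs_over C f Y Y'"
      "p \<in> fib_homs T C X Y" "q \<in> fib_homs T C X' Y'" "q \<bullet> h = k \<bullet> p"
    unfolding square_def by blast
  from assms(2) 1(4) obtain X'' Y'' where 2: "h' \<in> homs_over C g X' X''" "k' \<in> homs_over C g Y' Y''"
      "r \<in> fib_homs T C X'' Y''" "r \<bullet> h' = k' \<bullet> q"
    unfolding square_def fib_homs_iff by blast
  have "r \<bullet> (h' \<bullet> h) = (k' \<bullet> q) \<bullet> h"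
    unfolding 2(4)[symmetric] using 1 2 by (intro assoc[symmetric]) (auto simp: fib_homs_iff homs_over_iff)
  also have "\<dots> = k' \<bullet> (k \<bullet> p)"
    unfolding 1(5)[symmetric] using 1 2 by (intro assoc) (auto simp: fib_homs_iff homs_over_iff)
  also have "\<dots> = (k' \<bullet> k) \<bullet> p"
    using 1 2 by (intro assoc[symmetric]) (auto simp: fib_homs_iff homs_over_iff)
  finally show ?thesis
    by (rule squareI[OF homs_over_cmp[OF 1(1) 2(1)] homs_over_cmp[OF 1(2) 2(2)] 1(3) 2(3)])
qed

end


section \<open>gr-stacks\<close>

context gr_stack
begin

lemma tens_obj_simps [simp]:
  assumes "X \<in> obj C" "Y \<in> obj C" "base_obj C X = base_obj C Y"
  shows "X \<odot> Y \<in> obj C" "base_obj C (X \<odot> Y) = base_obj C Y"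
  using tens_obj[of X "base_obj C Y" Y] assms by (auto simp: obj_over_def)

lemma unit_obj_simps [simp]:
  assumes "U \<in> obj T"
  shows "unit_obj C U \<in> obj C" "base_obj C (unit_obj C U) = U"
  using unit_obj[OF assms] by (auto simp: obj_over_def)

lemma tens_fib:
  assumes "h \<in> fib_homs T C X X'" "k \<in> fib_homs T C Y Y'" "base_obj C X = base_obj C Y"
  shows "h \<star> k \<in> fib_homs T C (X \<odot> Y) (X' \<odot> Y')"
  using tens_arr[OF assms(1)[unfolded fib_homs_def]] assms fib_homs_base[OF assms(1)] fib_homs_base[OF assms(2)]
  by (simp add: fib_homs_def)

lemma tens_fib_cmp:
  assumes "h \<in> fib_homs T C X X'" "k \<in> fib_homs T C Y Y'" "base_obj C X = base_obj C Y"
    "h' \<in> fib_homs T C X' X''" "k' \<in> fib_homs T C Y' Y''"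
  shows "(h' \<star> k') \<bullet> (h \<star> k) = (h' \<bullet> h) \<star> (k' \<bullet> k)"
  using tens_cmp[of h "ide T (base_obj C X)" X X' k Y Y' h' "ide T (base_obj C X)" X'' k' Y''] assms
    fib_homs_base[OF assms(1)] fib_homs_base[OF assms(2)]
  by (simp add: fib_homs_def)

lemma tens_ide_simp [simp]:
  "\<lbrakk>X \<in> obj C; Y \<in> obj C; base_obj C X = base_obj C Y\<rbrakk> \<Longrightarrow> ide C X \<star> ide C Y = ide C (X \<odot> Y)"
  by (rule tens_ide[of X "base_obj C Y" Y]) (auto simp: obj_over_def)

lemma unit_arr_over: "f \<in> arr T \<Longrightarrow> unit_arr C f \<in> homs_over C f (unit_obj C (src T f)) (unit_obj C (tgt T f))"
  by (rule unit_arr) (simp add: homs_def)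

lemma asc_fib:
  "\<lbrakk>X \<in> obj C; Y \<in> obj C; Z \<in> obj C; base_obj C X = base_obj C Y; base_obj C Y = base_obj C Z\<rbrakk>
    \<Longrightarrow> asc C X Y Z \<in> fib_homs T C (X \<odot> (Y \<odot> Z)) ((X \<odot> Y) \<odot> Z)"
  by (rule asc_homs[of X "base_obj C Z" Y Z]) (auto simp: obj_over_def)

lemma lunit_fib: "X \<in> obj C \<Longrightarrow> lunit C X \<in> fib_homs T C (unit_obj C (base_obj C X) \<odot> X) X"
  by (rule lunit_homs) (auto simp: obj_over_def)

lemma runit_fib: "X \<in> obj C \<Longrightarrow> runit C X \<in> fib_homs T C (X \<odot> unit_obj C (base_obj C X)) X"
  by (rule runit_homs) (auto simp: obj_over_def)

lemma square_tens:
  assumes "square f h p q k" "square f h' p' q' k'"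
  shows "square f (h \<star> h') (p \<star> p') (q \<star> q') (k \<star> k')"
proof -
  from assms(1) obtain X Y X' Y' where 1: "h \<in> homs_over C f X X'" "k \<in> homs_over C f Y Y'"
      "p \<in> fib_homs T C X Y" "q \<in> fib_homs T C X' Y'" "q \<bullet> h = k \<bullet> p"
    unfolding square_def by blast
  from assms(2) obtain Z V Z' V' where 2: "h' \<in> homs_over C f Z Z'" "k' \<in> homs_over C f V V'"
      "p' \<in> fib_homs T C Z V" "q' \<in> fib_homs T C Z' V'" "q' \<bullet> h' = k' \<bullet> p'"
    unfolding square_def by blast
  note b = homs_over_base[OF 1(1)] homs_over_base[OF 2(1)]
  have p: "p \<in> homs_over C (ide T (src T f)) X Y" "p' \<in> homs_over C (ide T (src T f)) Z V"
    and q: "q \<in> homs_over C (ide T (tgt T f)) X' Y'" "q' \<in> homs_over C (ide T (tgt T f)) Z' V'"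
    using 1(3,4) 2(3,4) b by (auto simp: fib_homs_def)
  have "(q \<star> q') \<bullet> (h \<star> h') = (k \<star> k') \<bullet> (p \<star> p')"
    using tens_cmp[OF 1(1) 2(1) q] tens_cmp[OF p 1(2) 2(2)] 1(5) 2(5) by simp
  then show ?thesis
    using squareI[OF tens_arr[OF 1(1) 2(1)] tens_arr[OF 1(2) 2(2)] tens_fib[OF 1(3) 2(3)] tens_fib[OF 1(4) 2(4)]] b
    by simp
qed

lemma square_asc:
  assumes "h \<in> homs_over C f X X'" "k \<in> homs_over C f Y Y'" "l \<in> homs_over C f Z Z'"
  shows "square f (h \<star> (k \<star> l)) (asc C X Y Z) (asc C X' Y' Z') ((h \<star> k) \<star> l)"
  using assms homs_over_base[OF assms(1)] homs_over_base[OF assms(2)] homs_over_base[OF assms(3)]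
  by (intro squareI[where X = "X \<odot> (Y \<odot> Z)" and X' = "X' \<odot> (Y' \<odot> Z')"
        and Y = "(X \<odot> Y) \<odot> Z" and Y' = "(X' \<odot> Y') \<odot> Z'"] asc_natural asc_fib tens_arr) auto

lemma square_lunit:
  assumes "h \<in> homs_over C f X X'"
  shows "square f (unit_arr C f \<star> h) (lunit C X) (lunit C X') h"
  using lunit_natural[OF assms] homs_over_base[OF assms] assms
    tens_arr[OF unit_arr_over assms] lunit_fib[of X] lunit_fib[of X'] by (intro squareI) auto

lemma square_runit:
  assumes "h \<in> homs_over C f X X'"
  shows "square f (h \<star> unit_arr C f) (runit C X) (runit C X') h"
  using runit_natural[OF assms] homs_over_base[OF assms] assms
    tens_arr[OF assms unit_arr_over] runit_fib[of X] runit_fib[of X'] by (intro squareI) auto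

section \<open>Translation by an object: faithfulness, and fullness at the unit\<close>

lemma tens_right_quasi_inverse:
  assumes X: "X \<in> obj C"
  obtains X' n where "X' \<in> obj C" "base_obj C X' = base_obj C X"
    "\<And>P. P \<in> obj_over C (base_obj C X) \<Longrightarrow> n P \<in> fib_homs T C P ((P \<odot> X) \<odot> X')"
    "\<And>P Q h. \<lbrakk>h \<in> fib_homs T C P Q; base_obj C P = base_obj C X\<rbrakk>
      \<Longrightarrow> n Q \<bullet> h = ((h \<star> ide C X) \<star> ide C X') \<bullet> n P"
proof -
  let ?U = "base_obj C X" and ?I = "unit_obj C (base_obj C X)"
  have U: "?U \<in> obj T" using base_obj[OF X] .
  obtain X' e where X': "X' \<in> obj C" "base_obj C X' = ?U" and e: "e \<in> fib_homs T C (X \<odot> X') ?I"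
    using group_like[of X ?U] X by (auto simp: obj_over_def)
  \<comment> \<open>Insert the unit on the right of \<open>P\<close>, expand it to
    \<open>X \<odot> X'\<close>, and reassociate. Naturality in \<open>P\<close> is the pasting of
    the squares of these three arrows.\<close>
  define n where "n P = asc C P X X' \<bullet> (ide C P \<star> arr_inv C e) \<bullet> arr_inv C (runit C P)" for P
  have sq: "square (ide T ?U) h (n P) (n Q) ((h \<star> ide C X) \<star> ide C X')"
    if h: "h \<in> fib_homs T C P Q" "base_obj C P = ?U" for P Q h
  proof -
    have h': "h \<in> homs_over C (ide T ?U) P Q"
      using h by (simp add: fib_homs_def)
    have iX: "ide C X \<in> homs_over C (ide T ?U) X X" "ide C X' \<in> homs_over C (ide T ?U) X' X'"
      using X X' fib_ide[of X] fib_ide[of X'] by (auto simp: fib_homs_def)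
    have e': "square (ide T ?U) (unit_arr C (ide T ?U)) (arr_inv C e) (arr_inv C e) (ide C X \<star> ide C X')"
      using square_inv[OF square_const[OF e]] X X' U by (simp add: unit_ide)
    show ?thesis
      unfolding n_def
      by (rule square_cmp[OF square_cmp[OF square_inv[OF square_runit[OF h']]
              square_tens[OF square_ide[OF h'] e']] square_asc[OF h' iX]])
  qed
  have nP: "n P \<in> fib_homs T C P ((P \<odot> X) \<odot> X')" if P: "P \<in> obj_over C ?U" for P
  proof -
    have P: "P \<in> obj C" "base_obj C P = ?U" using P by (auto simp: obj_over_def)
    show ?thesis
      unfolding n_def using P X X' U
      by (intro fib_cmp[OF fib_cmp[OF fib_inv(1)[OF runit_fib] tens_fib[OF fib_ide fib_inv(1)]] asc_fib])
        (auto intro: e)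
  qed
  show ?thesis
    using that[OF X' nP] squareD[OF sq] by blast
qed

lemma tens_left_quasi_inverse:
  assumes X: "X \<in> obj C"
  obtains X' n where "X' \<in> obj C" "base_obj C X' = base_obj C X"
    "\<And>P. P \<in> obj_over C (base_obj C X) \<Longrightarrow> n P \<in> fib_homs T C P (X' \<odot> (X \<odot> P))"
    "\<And>P Q h. \<lbrakk>h \<in> fib_homs T C P Q; base_obj C P = base_obj C X\<rbrakk>
      \<Longrightarrow> n Q \<bullet> h = (ide C X' \<star> (ide C X \<star> h)) \<bullet> n P"
proof -
  let ?U = "base_obj C X" and ?I = "unit_obj C (base_obj C X)"
  have U: "?U \<in> obj T" using base_obj[OF X] .
  obtain X' e where X': "X' \<in> obj C" "base_obj C X' = ?U" and e: "e \<in> fib_homs T C (X' \<odot> X) ?I"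
    using group_like[of X ?U] X by (auto simp: obj_over_def)
  define n where "n P = arr_inv C (asc C X' X P) \<bullet> (arr_inv C e \<star> ide C P) \<bullet> arr_inv C (lunit C P)" for P
  have sq: "square (ide T ?U) h (n P) (n Q) (ide C X' \<star> (ide C X \<star> h))"
    if h: "h \<in> fib_homs T C P Q" "base_obj C P = ?U" for P Q h
  proof -
    have h': "h \<in> homs_over C (ide T ?U) P Q"
      using h by (simp add: fib_homs_def)
    have iX: "ide C X' \<in> homs_over C (ide T ?U) X' X'" "ide C X \<in> homs_over C (ide T ?U) X X"
      using X X' fib_ide[of X] fib_ide[of X'] by (auto simp: fib_homs_def)
    have e': "square (ide T ?U) (unit_arr C (ide T ?U)) (arr_inv C e) (arr_inv C e) (ide C X' \<star> ide C X)"
      using square_inv[OF square_const[OF e]] X X' U by (simp add: unit_ide)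
    show ?thesis
      unfolding n_def
      by (rule square_cmp[OF square_cmp[OF square_inv[OF square_lunit[OF h']]
              square_tens[OF e' square_ide[OF h']]] square_inv[OF square_asc[OF iX h']]])
  qed
  have nP: "n P \<in> fib_homs T C P (X' \<odot> (X \<odot> P))" if P: "P \<in> obj_over C ?U" for P
  proof -
    have P: "P \<in> obj C" "base_obj C P = ?U" using P by (auto simp: obj_over_def)
    show ?thesis
      unfolding n_def using P X X' U
      by (intro fib_cmp[OF fib_cmp[OF fib_inv(1)[OF lunit_fib] tens_fib[OF fib_inv(1) fib_ide]] fib_inv(1)[OF asc_fib]])
        (auto intro: e)
  qed
  show ?thesis
    using that[OF X' nP] squareD[OF sq] by blast
qed

text \<open>Conjugation by the natural isomorphism \<open>n\<close> recovers \<open>h\<close> from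
  \<open>(h \<star> ide C X) \<star> ide C X'\<close>, which depends only on
  \<open>h \<star> ide C X\<close>.\<close>

lemma tens_right_faithful:
  assumes X: "X \<in> obj C" "base_obj C X = base_obj C P"
    and h: "h \<in> fib_homs T C P Q" "k \<in> fib_homs T C P Q" and eq: "h \<star> ide C X = k \<star> ide C X"
  shows "h = k"
proof -
  obtain X' n where n: "\<And>P. P \<in> obj_over C (base_obj C X) \<Longrightarrow> n P \<in> fib_homs T C P ((P \<odot> X) \<odot> X')"
    "\<And>P Q h. \<lbrakk>h \<in> fib_homs T C P Q; base_obj C P = base_obj C X\<rbrakk>
      \<Longrightarrow> n Q \<bullet> h = ((h \<star> ide C X) \<star> ide C X') \<bullet> n P"
    by (rule tens_right_quasi_inverse[OF X(1)]) blast
  have "n Q \<bullet> h = n Q \<bullet> k"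
    using n(2)[OF h(1)] n(2)[OF h(2)] X eq by simp
  moreover have "n Q \<in> fib_homs T C Q ((Q \<odot> X) \<odot> X')"
    using n(1)[of Q] fib_homs_base[OF h(1)] X by (simp add: obj_over_def)
  ultimately show ?thesis
    using fib_cancel h unfolding fib_homs_def by blast
qed

lemma tens_left_faithful:
  assumes X: "X \<in> obj C" "base_obj C X = base_obj C P"
    and h: "h \<in> fib_homs T C P Q" "k \<in> fib_homs T C P Q" and eq: "ide C X \<star> h = ide C X \<star> k"
  shows "h = k"
proof -
  obtain X' n where n: "\<And>P. P \<in> obj_over C (base_obj C X) \<Longrightarrow> n P \<in> fib_homs T C P (X' \<odot> (X \<odot> P))"
    "\<And>P Q h. \<lbrakk>h \<in> fib_homs T C P Q; base_obj C P = base_obj C X\<rbrakk>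
      \<Longrightarrow> n Q \<bullet> h = (ide C X' \<star> (ide C X \<star> h)) \<bullet> n P"
    by (rule tens_left_quasi_inverse[OF X(1)]) blast
  have "n Q \<bullet> h = n Q \<bullet> k"
    using n(2)[OF h(1)] n(2)[OF h(2)] X eq by simp
  moreover have "n Q \<in> fib_homs T C Q (X' \<odot> (X \<odot> Q))"
    using n(1)[of Q] fib_homs_base[OF h(1)] X by (simp add: obj_over_def)
  ultimately show ?thesis
    using fib_cancel h unfolding fib_homs_def by blast
qed

text \<open>A preimage of \<theta> is found by tensoring it with a quasi-inverse \<open>X'\<close>
  and conjugating back by \<open>n I\<close>. By construction it agrees with \<theta> after
  tensoring with \<open>X\<close> and then \<open>X'\<close>, and faithfulness of tensoring with
  \<open>X'\<close> removes the second factor.\<close>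

lemma tens_right_full_unit:
  assumes X: "X \<in> obj C" and I: "I = unit_obj C (base_obj C X)"
    and th: "\<theta> \<in> fib_homs T C (I \<odot> X) (I \<odot> X)"
  obtains a where "a \<in> fib_homs T C I I" "a \<star> ide C X = \<theta>"
proof -
  obtain X' n where X': "X' \<in> obj C" "base_obj C X' = base_obj C X"
    and n1: "\<And>P. P \<in> obj_over C (base_obj C X) \<Longrightarrow> n P \<in> fib_homs T C P ((P \<odot> X) \<odot> X')"
    and n2: "\<And>P Q h. \<lbrakk>h \<in> fib_homs T C P Q; base_obj C P = base_obj C X\<rbrakk>
      \<Longrightarrow> n Q \<bullet> h = ((h \<star> ide C X) \<star> ide C X') \<bullet> n P"
    by (rule tens_right_quasi_inverse[OF X]) blast
  have Io: "I \<in> obj C" "base_obj C I = base_obj C X"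
    using I base_obj[OF X] by auto
  have n: "n I \<in> fib_homs T C I ((I \<odot> X) \<odot> X')"
    using n1[of I] Io by (simp add: obj_over_def)
  have t: "\<theta> \<star> ide C X' \<in> fib_homs T C ((I \<odot> X) \<odot> X') ((I \<odot> X) \<odot> X')"
    using Io X X' by (intro tens_fib[OF th fib_ide]) auto
  define a where "a = arr_inv C (n I) \<bullet> (\<theta> \<star> ide C X') \<bullet> n I"
  have a: "a \<in> fib_homs T C I I"
    unfolding a_def by (rule fib_cmp[OF fib_cmp[OF n t] fib_inv(1)[OF n]])
  have aX: "a \<star> ide C X \<in> fib_homs T C (I \<odot> X) (I \<odot> X)"
    using Io X by (intro tens_fib[OF a fib_ide]) auto
  have aXX: "(a \<star> ide C X) \<star> ide C X' \<in> fib_homs T C ((I \<odot> X) \<odot> X') ((I \<odot> X) \<odot> X')"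
    using Io X X' by (intro tens_fib[OF aX fib_ide]) auto
  have "((a \<star> ide C X) \<star> ide C X') \<bullet> n I = n I \<bullet> a"
    using n2[OF a] Io by simp
  also have "\<dots> = (n I \<bullet> arr_inv C (n I)) \<bullet> ((\<theta> \<star> ide C X') \<bullet> n I)"
    unfolding a_def using n t fib_inv(1)[OF n] by (intro assoc[symmetric]) (auto simp: fib_homs_iff)
  also have "\<dots> = (\<theta> \<star> ide C X') \<bullet> n I"
    using n t fib_inv(3)[OF n] by (auto simp: fib_homs_iff)
  finally have "(a \<star> ide C X) \<star> ide C X' = \<theta> \<star> ide C X'"
    using fib_epi[OF n aXX[unfolded fib_homs_def] t[unfolded fib_homs_def]] by simp
  then have "a \<star> ide C X = \<theta>"
    using X X' Io by (intro tens_right_faithful[OF X'(1) _ aX th]) auto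
  with a show ?thesis by (rule that)
qed

section \<open>Automorphisms induced from the unit, and conjugacy\<close>

lemma square_left_aut:
  assumes h: "h \<in> homs_over C f X X'" and a: "square f (unit_arr C f) a a' (unit_arr C f)"
  shows "square f h (left_aut C a X) (left_aut C a' X') h"
  unfolding left_aut_def
  by (rule square_cmp[OF square_cmp[OF square_inv[OF square_lunit[OF h]]
          square_tens[OF a square_ide[OF h]]] square_lunit[OF h]])

lemma square_right_aut:
  assumes h: "h \<in> homs_over C f X X'" and a: "square f (unit_arr C f) a a' (unit_arr C f)"
  shows "square f h (right_aut C X a) (right_aut C X' a') h"
  unfolding right_aut_def
  by (rule square_cmp[OF square_cmp[OF square_inv[OF square_runit[OF h]]
          square_tens[OF square_ide[OF h] a]] square_runit[OF h]])

text \<open>Conjugacy of automorphisms of possibly different objects of a fibre. Hiding the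
  conjugating isomorphism lets chains of constraints be composed without recording them; once
  automorphism groups are known to commute, \<open>aut_equivD\<close> allows any isomorphism to be
  used in its place.\<close>

definition aut_equiv :: "'m \<Rightarrow> 'm \<Rightarrow> bool" where
  "aut_equiv \<theta> \<psi> \<longleftrightarrow> (\<exists>P Q p. \<theta> \<in> fib_homs T C P P \<and> \<psi> \<in> fib_homs T C Q Q
     \<and> p \<in> fib_homs T C P Q \<and> p \<bullet> \<theta> = \<psi> \<bullet> p)"

lemma aut_equivI:
  "\<lbrakk>p \<in> fib_homs T C P Q; \<theta> \<in> fib_homs T C P P; \<psi> \<in> fib_homs T C Q Q; p \<bullet> \<theta> = \<psi> \<bullet> p\<rbrakk>
    \<Longrightarrow> aut_equiv \<theta> \<psi>"
  unfolding aut_equiv_def by blast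

lemma aut_equiv_sym:
  assumes "aut_equiv \<theta> \<psi>"
  shows "aut_equiv \<psi> \<theta>"
proof -
  from assms obtain P Q p where p: "\<theta> \<in> fib_homs T C P P" "\<psi> \<in> fib_homs T C Q Q"
      "p \<in> fib_homs T C P Q" "p \<bullet> \<theta> = \<psi> \<bullet> p"
    unfolding aut_equiv_def by blast
  let ?i = "ide T (base_obj C P)"
  have h: "\<theta> \<in> homs_over C ?i P P" "\<psi> \<in> homs_over C ?i Q Q"
    using p fib_homs_base[OF p(3)] by (auto simp: fib_homs_def)
  from squareE[OF square_inv[OF squareI[OF h p(3,3,4)]] h(2,1)]
  show ?thesis
    using p by (intro aut_equivI)
qed

lemma aut_equiv_trans: "aut_equiv \<theta> \<psi> \<Longrightarrow> aut_equiv \<psi> \<chi> \<Longrightarrow> aut_equiv \<theta> \<chi>"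
proof -
  assume "aut_equiv \<theta> \<psi>" "aut_equiv \<psi> \<chi>"
  then obtain P Q R p q where p: "\<theta> \<in> fib_homs T C P P" "\<psi> \<in> fib_homs T C Q Q"
      "p \<in> fib_homs T C P Q" "p \<bullet> \<theta> = \<psi> \<bullet> p"
    and q: "\<chi> \<in> fib_homs T C R R" "q \<in> fib_homs T C Q R" "q \<bullet> \<psi> = \<chi> \<bullet> q"
    unfolding aut_equiv_def by (force simp: fib_homs_iff)
  have "(q \<bullet> p) \<bullet> \<theta> = q \<bullet> (\<psi> \<bullet> p)"
    using p q by (auto simp: assoc fib_homs_iff)
  also have "\<dots> = (q \<bullet> \<psi>) \<bullet> p"
    using p q by (subst assoc) (auto simp: fib_homs_iff)
  also have "\<dots> = \<chi> \<bullet> (q \<bullet> p)"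
    using p q by (auto simp: assoc fib_homs_iff)
  finally show ?thesis
    by (rule aut_equivI[OF fib_cmp[OF p(3) q(2)] p(1) q(1)])
qed

lemma aut_equiv_tens_right:
  assumes "aut_equiv \<theta> \<psi>" "X \<in> obj C" "base_obj C X = base_obj C (src C \<theta>)"
  shows "aut_equiv (\<theta> \<star> ide C X) (\<psi> \<star> ide C X)"
proof -
  from assms(1) obtain P Q p where p: "\<theta> \<in> fib_homs T C P P" "\<psi> \<in> fib_homs T C Q Q"
      "p \<in> fib_homs T C P Q" "p \<bullet> \<theta> = \<psi> \<bullet> p"
    unfolding aut_equiv_def by blast
  have X: "base_obj C P = base_obj C X" "base_obj C Q = base_obj C X" "src C \<theta> = P"
    using p assms(3) fib_homs_base[OF p(3)] by (auto simp: fib_homs_iff)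
  note i = fib_ide[OF assms(2)]
  show ?thesis
    using tens_fib_cmp[OF p(1) i X(1) p(3) i] tens_fib_cmp[OF p(3) i X(1) p(2) i] p(4)
    by (intro aut_equivI[OF tens_fib[OF p(3) i X(1)] tens_fib[OF p(1) i X(1)] tens_fib[OF p(2) i X(2)]]) simp
qed

lemma aut_equiv_tens_left:
  assumes "aut_equiv \<theta> \<psi>" "X \<in> obj C" "base_obj C X = base_obj C (src C \<theta>)"
  shows "aut_equiv (ide C X \<star> \<theta>) (ide C X \<star> \<psi>)"
proof -
  from assms(1) obtain P Q p where p: "\<theta> \<in> fib_homs T C P P" "\<psi> \<in> fib_homs T C Q Q"
      "p \<in> fib_homs T C P Q" "p \<bullet> \<theta> = \<psi> \<bullet> p"
    unfolding aut_equiv_def by blast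
  have X: "base_obj C X = base_obj C P" "base_obj C X = base_obj C Q" "src C \<theta> = P"
    using p assms(3) fib_homs_base[OF p(3)] by (auto simp: fib_homs_iff)
  note i = fib_ide[OF assms(2)]
  show ?thesis
    using tens_fib_cmp[OF i p(1) X(1) i p(3)] tens_fib_cmp[OF i p(3) X(1) i p(2)] p(4)
    by (intro aut_equivI[OF tens_fib[OF i p(3) X(1)] tens_fib[OF i p(1) X(1)] tens_fib[OF i p(2) X(2)]]) simp
qed

lemma aut_equiv_asc:
  assumes "\<theta> \<in> fib_homs T C X X" "\<psi> \<in> fib_homs T C Y Y" "\<chi> \<in> fib_homs T C Z Z"
    and "base_obj C X = U" "base_obj C Y = U" "base_obj C Z = U"
  shows "aut_equiv (\<theta> \<star> (\<psi> \<star> \<chi>)) ((\<theta> \<star> \<psi>) \<star> \<chi>)"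
  using asc_natural[of \<theta> "ide T U" X X \<psi> Y Y \<chi> Z Z] assms
    fib_homs_base[OF assms(1)] fib_homs_base[OF assms(2)] fib_homs_base[OF assms(3)]
  by (intro aut_equivI[OF asc_fib] tens_fib) (auto simp: fib_homs_def)

lemma left_aut_fib:
  assumes "X \<in> obj C" "a \<in> fib_homs T C I I" "I = unit_obj C (base_obj C X)"
  shows "left_aut C a X \<in> fib_homs T C X X" "left_aut C a X \<bullet> lunit C X = lunit C X \<bullet> (a \<star> ide C X)"
proof -
  note b = base_obj[OF assms(1)]
  have l: "lunit C X \<in> fib_homs T C (I \<odot> X) X"
    using lunit_fib assms by simp
  have t: "a \<star> ide C X \<in> fib_homs T C (I \<odot> X) (I \<odot> X)"
    using assms b by (intro tens_fib fib_ide) auto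
  show "left_aut C a X \<in> fib_homs T C X X"
    unfolding left_aut_def by (rule fib_cmp[OF fib_cmp[OF fib_inv(1)[OF l] t] l])
  show "left_aut C a X \<bullet> lunit C X = lunit C X \<bullet> (a \<star> ide C X)"
    unfolding left_aut_def using l t fib_inv[OF l] by (auto simp: assoc fib_homs_iff)
qed

lemma right_aut_fib:
  assumes "X \<in> obj C" "a \<in> fib_homs T C I I" "I = unit_obj C (base_obj C X)"
  shows "right_aut C X a \<in> fib_homs T C X X" "right_aut C X a \<bullet> runit C X = runit C X \<bullet> (ide C X \<star> a)"
proof -
  note b = base_obj[OF assms(1)]
  have l: "runit C X \<in> fib_homs T C (X \<odot> I) X"
    using runit_fib assms by simp
  have t: "ide C X \<star> a \<in> fib_homs T C (X \<odot> I) (X \<odot> I)"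
    using assms b by (intro tens_fib fib_ide) auto
  show "right_aut C X a \<in> fib_homs T C X X"
    unfolding right_aut_def by (rule fib_cmp[OF fib_cmp[OF fib_inv(1)[OF l] t] l])
  show "right_aut C X a \<bullet> runit C X = runit C X \<bullet> (ide C X \<star> a)"
    unfolding right_aut_def using l t fib_inv[OF l] by (auto simp: assoc fib_homs_iff)
qed

lemma aut_equiv_left_aut:
  assumes "X \<in> obj C" "a \<in> fib_homs T C I I" "I = unit_obj C (base_obj C X)"
  shows "aut_equiv (a \<star> ide C X) (left_aut C a X)"
  using left_aut_fib[OF assms] lunit_fib[of X] assms base_obj[of X] tens_fib[OF assms(2) fib_ide[OF assms(1)]]
  by (intro aut_equivI[where p = "lunit C X"]) auto

lemma aut_equiv_right_aut:
  assumes "X \<in> obj C" "a \<in> fib_homs T C I I" "I = unit_obj C (base_obj C X)"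
  shows "aut_equiv (ide C X \<star> a) (right_aut C X a)"
  using right_aut_fib[OF assms] runit_fib[of X] assms base_obj[of X] tens_fib[OF fib_ide[OF assms(1)] assms(2)]
  by (intro aut_equivI[where p = "runit C X"]) auto

lemma left_aut_cmp:
  assumes X: "X \<in> obj C" "I = unit_obj C (base_obj C X)"
    and a: "a \<in> fib_homs T C I I" and b: "b \<in> fib_homs T C I I"
  shows "left_aut C (a \<bullet> b) X = left_aut C a X \<bullet> left_aut C b X"
proof -
  have base: "base_obj C I = base_obj C X"
    using X base_obj[of X] by simp
  note ab = fib_cmp[OF b a] and i = fib_ide[OF X(1)]
  note A = left_aut_fib[OF X(1) a X(2)] and B = left_aut_fib[OF X(1) b X(2)]
    and AB = left_aut_fib[OF X(1) ab X(2)]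
  note ta = tens_fib[OF a i base] and tb = tens_fib[OF b i base]
  have l: "lunit C X \<in> fib_homs T C (I \<odot> X) X"
    using lunit_fib X by simp
  have "left_aut C (a \<bullet> b) X \<bullet> lunit C X = lunit C X \<bullet> ((a \<star> ide C X) \<bullet> (b \<star> ide C X))"
    using AB(2) tens_fib_cmp[OF b i base a i] X by simp
  also have "\<dots> = (lunit C X \<bullet> (a \<star> ide C X)) \<bullet> (b \<star> ide C X)"
    using l ta tb by (intro assoc[symmetric]) (auto simp: fib_homs_iff)
  also have "\<dots> = left_aut C a X \<bullet> (lunit C X \<bullet> (b \<star> ide C X))"
    unfolding A(2)[symmetric] using l A tb by (intro assoc) (auto simp: fib_homs_iff)
  also have "\<dots> = (left_aut C a X \<bullet> left_aut C b X) \<bullet> lunit C X"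
    unfolding B(2)[symmetric] using l A B by (intro assoc[symmetric]) (auto simp: fib_homs_iff)
  finally show ?thesis
    using fib_epi[OF l AB(1)[unfolded fib_homs_def] fib_cmp[OF B(1) A(1), unfolded fib_homs_def]] by simp
qed

text \<open>This is the surjectivity in the identification of automorphisms of \<open>X\<close> with
  those of the unit: conjugating by the left unit constraint reduces it to fullness of tensoring
  with \<open>X\<close>.\<close>

lemma left_aut_surj:
  assumes X: "X \<in> obj C" "I = unit_obj C (base_obj C X)" and th: "\<theta> \<in> fib_homs T C X X"
  obtains a where "a \<in> fib_homs T C I I" "left_aut C a X = \<theta>"
proof -
  have l: "lunit C X \<in> fib_homs T C (I \<odot> X) X"
    using lunit_fib X by simp
  note l' = fib_inv[OF l]
  obtain a where a: "a \<in> fib_homs T C I I" "a \<star> ide C X = arr_inv C (lunit C X) \<bullet> \<theta> \<bullet> lunit C X"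
    by (rule tens_right_full_unit[OF X fib_cmp[OF fib_cmp[OF l th] l'(1)]])
  have "lunit C X \<bullet> (arr_inv C (lunit C X) \<bullet> (\<theta> \<bullet> lunit C X))
      = (lunit C X \<bullet> arr_inv C (lunit C X)) \<bullet> (\<theta> \<bullet> lunit C X)"
    using l l'(1) th by (intro assoc[symmetric]) (auto simp: fib_homs_iff)
  also have "\<dots> = \<theta> \<bullet> lunit C X"
    using l l'(3) th by (auto simp: fib_homs_iff)
  finally have "left_aut C a X \<bullet> lunit C X = \<theta> \<bullet> lunit C X"
    using left_aut_fib(2)[OF X(1) a(1) X(2)] a(2) by simp
  then have "left_aut C a X = \<theta>"
    using fib_epi[OF l left_aut_fib(1)[OF X(1) a(1) X(2), unfolded fib_homs_def] th[unfolded fib_homs_def]]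
    by simp
  with a(1) show ?thesis by (rule that)
qed


subsection \<open>Classes of objects\<close>

lemma iso_class_eq_iff:
  assumes "X \<in> obj_over C U" "Y \<in> obj_over C U"
  shows "iso_class T C X = iso_class T C Y \<longleftrightarrow> fib_homs T C X Y \<noteq> {}"
proof
  assume "iso_class T C X = iso_class T C Y"
  moreover have "Y \<in> iso_class T C Y"
    using assms fib_ide[of Y] by (auto simp: iso_class_def obj_over_def)
  ultimately show "fib_homs T C X Y \<noteq> {}"
    by (auto simp: iso_class_def)
next
  assume "fib_homs T C X Y \<noteq> {}"
  then obtain p where p: "p \<in> fib_homs T C X Y" by blast
  show "iso_class T C X = iso_class T C Y"
    using assms fib_cmp[OF p] fib_cmp[OF fib_inv(1)[OF p]] by (fastforce simp: iso_class_def obj_over_def)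
qed

lemma iso_class_mult:
  assumes X: "X \<in> obj_over C U" and Y: "Y \<in> obj_over C U"
  shows "iso_class T C X \<otimes>\<^bsub>sec (iso_classes T C) U\<^esub> iso_class T C Y = iso_class T C (X \<odot> Y)"
proof -
  have "iso_class T C (X' \<odot> Y') = iso_class T C (X \<odot> Y)"
    if "X' \<in> iso_class T C X" "Y' \<in> iso_class T C Y" for X' Y'
  proof -
    from that obtain p q where p: "p \<in> fib_homs T C X X'" and q: "q \<in> fib_homs T C Y Y'"
      by (auto simp: iso_class_def)
    have "p \<star> q \<in> fib_homs T C (X \<odot> Y) (X' \<odot> Y')"
      using X Y by (intro tens_fib[OF p q]) (simp add: obj_over_def)
    then show ?thesis
      using that X Y iso_class_eq_iff[OF tens_obj[OF X Y] tens_obj, of X' Y']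
      by (auto simp: iso_class_def obj_over_def)
  qed
  moreover have "X \<in> iso_class T C X" "Y \<in> iso_class T C Y"
    using X Y fib_ide by (auto simp: iso_class_def obj_over_def)
  ultimately have "(\<Union>X'\<in>iso_class T C X. \<Union>Y'\<in>iso_class T C Y. iso_class T C (X' \<odot> Y'))
      = iso_class T C (X \<odot> Y)"
    by blast
  then show ?thesis
    by (simp add: iso_classes_def)
qed

lemma iso_class_res:
  assumes h: "h \<in> homs_over C f X' X"
  shows "res (iso_classes T C) f (iso_class T C X) = iso_class T C X'"
proof -
  note b = homs_over_base[OF h]
  have "(\<exists>Z\<in>iso_class T C X. homs_over C f Y Z \<noteq> {}) \<longleftrightarrow> Y \<in> iso_class T C X'" (is "?L \<longleftrightarrow> ?R") for Y
  proof
    assume ?L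
    then obtain Z p k where "p \<in> fib_homs T C X Z" and k: "k \<in> homs_over C f Y Z"
      by (auto simp: iso_class_def)
    from over_factor_fib[OF h fib_cmp_over[OF k fib_inv(1)[OF this(1)]]]
    obtain l where "l \<in> fib_homs T C Y X'" by blast
    from fib_inv(1)[OF this] fib_homs_base[OF this] show ?R
      by (auto simp: iso_class_def obj_over_def)
  next
    assume ?R
    then obtain p where "p \<in> fib_homs T C X' Y" by (auto simp: iso_class_def)
    from over_cmp_fib[OF fib_inv(1)[OF this] h] show ?L
      using b fib_ide[of X] by (auto simp: iso_class_def obj_over_def)
  qed
  then show ?thesis
    by (auto simp: iso_classes_def)
qed

lemma iso_classes_carrier: "carrier (sec (iso_classes T C) U) = iso_class T C ` obj_over C U"
  by (simp add: iso_classes_def)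

lemma lift_obj:
  assumes "f \<in> arr T" "tgt T f = U" "X \<in> obj_over C U"
  obtains X' h where "h \<in> homs_over C f X' X"
  using lift[of f "src T f" U X] assms by (auto simp: homs_def)

lemma iso_classes_magma_presheaf: "magma_presheaf T (iso_classes T C)"
proof
  show "x \<otimes>\<^bsub>sec (iso_classes T C) U\<^esub> y \<in> carrier (sec (iso_classes T C) U)"
    if "x \<in> carrier (sec (iso_classes T C) U)" "y \<in> carrier (sec (iso_classes T C) U)" for U x y
    using that tens_obj unfolding iso_classes_carrier by (auto simp: iso_class_mult)
next
  fix f x assume f: "f \<in> arr T" and "x \<in> carrier (sec (iso_classes T C) (tgt T f))"
  then obtain X where X: "X \<in> obj_over C (tgt T f)" "x = iso_class T C X"
    unfolding iso_classes_carrier by blast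
  from lift_obj[OF f refl X(1)] obtain X' h where h: "h \<in> homs_over C f X' X" .
  show "res (iso_classes T C) f x \<in> carrier (sec (iso_classes T C) (src T f))"
    using homs_over_base[OF h] unfolding iso_classes_carrier X(2) iso_class_res[OF h]
    by (auto simp: obj_over_def)
  fix y assume "y \<in> carrier (sec (iso_classes T C) (tgt T f))"
  then obtain Y where Y: "Y \<in> obj_over C (tgt T f)" "y = iso_class T C Y"
    unfolding iso_classes_carrier by blast
  from lift_obj[OF f refl Y(1)] obtain Y' k where k: "k \<in> homs_over C f Y' Y" .
  show "res (iso_classes T C) f (x \<otimes>\<^bsub>sec (iso_classes T C) (tgt T f)\<^esub> y)
      = res (iso_classes T C) f x \<otimes>\<^bsub>sec (iso_classes T C) (src T f)\<^esub> res (iso_classes T C) f y"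
    unfolding X(2) Y(2) iso_class_mult[OF X(1) Y(1)] iso_class_res[OF h] iso_class_res[OF k]
      iso_class_res[OF tens_arr[OF h k]]
    using homs_over_base[OF h] homs_over_base[OF k]
    by (intro iso_class_mult[symmetric]) (auto simp: obj_over_def)
next
  fix f g x assume fg: "f \<in> arr T" "g \<in> arr T" "tgt T g = src T f"
    and "x \<in> carrier (sec (iso_classes T C) (tgt T f))"
  then obtain X where X: "X \<in> obj_over C (tgt T f)" "x = iso_class T C X"
    unfolding iso_classes_carrier by blast
  from lift_obj[OF fg(1) refl X(1)] obtain X' h where h: "h \<in> homs_over C f X' X" .
  have "X' \<in> obj_over C (tgt T g)"
    using homs_over_base[OF h] fg by (auto simp: obj_over_def)
  from lift_obj[OF fg(2) refl this] obtain X'' k where k: "k \<in> homs_over C g X'' X'" .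
  show "res (iso_classes T C) (f \<bullet>\<^bsub>T\<^esub> g) x = res (iso_classes T C) g (res (iso_classes T C) f x)"
    unfolding X(2) iso_class_res[OF h] iso_class_res[OF k] iso_class_res[OF homs_over_cmp[OF k h]] ..
qed

end

section \<open>Classes of objects as sections of \<open>B\<close>\<close>

locale gr_stack_invariants = gr_stack T C + gr_invariants T C B be A al
  for T :: "('u, 's) site" and C :: "('u, 's, 'o, 'm) monoidal" (structure)
    and B :: "('u, 's, 'b) presheaf" and be :: "'u \<Rightarrow> ('s, ('s, 'o set) germ) germ \<Rightarrow> 'b"
    and A :: "('u, 's, 'a) presheaf" and al :: "'u \<Rightarrow> 'a \<Rightarrow> 'm" +
  assumes invariants: "has_invariants T C B be A al"
    and action_trivial: trivial_action
begin

lemma B_sheaf: "abelian_sheaf T B" and A_sheaf: "abelian_sheaf T A"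
  and be_iso: "U \<in> obj T \<Longrightarrow> be U \<in> iso (sec (pi0 T C) U) (sec B U)"
  and be_res: "\<lbrakk>f \<in> arr T; x \<in> carrier (sec (pi0 T C) (tgt T f))\<rbrakk>
    \<Longrightarrow> be (src T f) (res (pi0 T C) f x) = res B f (be (tgt T f) x)"
  and al_iso: "U \<in> obj T \<Longrightarrow> al U \<in> iso (sec A U) (sec (pi1 T C) U)"
  and al_res: "\<lbrakk>f \<in> arr T; a \<in> carrier (sec A (tgt T f))\<rbrakk>
    \<Longrightarrow> al (src T f) (res A f a) = res (pi1 T C) f (al (tgt T f) a)"
  using invariants by (auto simp: has_invariants_def presheaf_iso_def)

lemma sheafify_unit_pi0:
  assumes "X \<in> obj_over C U"
  shows "sheafify_unit T (iso_classes T C) U (iso_class T C X) \<in> carrier (sec (pi0 T C) U)"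
  unfolding pi0_def
  using assms base_obj[of X] by (intro magma_presheaf.sheafify_unit_closed[OF iso_classes_magma_presheaf])
    (auto simp: iso_classes_carrier obj_over_def)

lemma cls_closed:
  assumes "X \<in> obj_over C U"
  shows "cls X \<in> carrier (sec B U)"
  using sheafify_unit_pi0[OF assms] be_iso[of U] base_obj[of X] assms
  by (auto simp: cls_def obj_over_def iso_def bij_betw_def)

lemma cls_tens:
  assumes X: "X \<in> obj_over C U" and Y: "Y \<in> obj_over C U"
  shows "cls (X \<odot> Y) = cls X \<otimes>\<^bsub>sec B U\<^esub> cls Y"
proof -
  have U: "U \<in> obj T" and b: "base_obj C X = U" "base_obj C Y = U" "base_obj C (X \<odot> Y) = U"
    using X Y base_obj[of X] tens_obj[OF X Y] by (auto simp: obj_over_def)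
  have "sheafify_unit T (iso_classes T C) U (iso_class T C (X \<odot> Y))
      = sheafify_unit T (iso_classes T C) U (iso_class T C X)
        \<otimes>\<^bsub>sec (pi0 T C) U\<^esub> sheafify_unit T (iso_classes T C) U (iso_class T C Y)"
    unfolding iso_class_mult[OF X Y, symmetric] pi0_def
    using X Y by (intro magma_presheaf.sheafify_unit_mult[OF iso_classes_magma_presheaf U])
      (auto simp: iso_classes_carrier)
  then show ?thesis
    using be_iso[OF U] sheafify_unit_pi0[OF X] sheafify_unit_pi0[OF Y]
    unfolding cls_def b by (auto simp: iso_def hom_def)
qed

lemma cls_res:
  assumes h: "h \<in> homs_over C f X' X"
  shows "cls X' = res B f (cls X)"
proof -
  note b = homs_over_base[OF h]
  have X: "X \<in> obj_over C (tgt T f)" using b by (simp add: obj_over_def)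
  have "sheafify_unit T (iso_classes T C) (src T f) (iso_class T C X')
      = res (pi0 T C) f (sheafify_unit T (iso_classes T C) (tgt T f) (iso_class T C X))"
    unfolding iso_class_res[OF h, symmetric] pi0_def
    using X b(5) by (intro magma_presheaf.sheafify_unit_res[OF iso_classes_magma_presheaf, symmetric])
      (auto simp: iso_classes_carrier)
  then show ?thesis
    using be_res[OF b(5) sheafify_unit_pi0[OF X]] unfolding cls_def b by simp
qed

text \<open>Classes live in the associated sheaf, whose canonical map is only locally injective, so
  equal classes give isomorphic restrictions on a cover. Composing with such an isomorphism lets one
  object \<open>W\<close> serve as restriction of both \<open>X\<close> and
  \<open>Y\<close>.\<close>

lemma cls_eq_local:
  assumes X: "X \<in> obj_over C U" and Y: "Y \<in> obj_over C U" and eq: "cls X = cls Y"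
  obtains R where "R \<in> cov T U"
    "\<And>f. f \<in> R \<Longrightarrow> \<exists>W. \<exists>p\<in>homs_over C f W X. \<exists>q\<in>homs_over C f W Y. True"
proof -
  have U: "U \<in> obj T" and b: "base_obj C X = U" "base_obj C Y = U"
    using X Y base_obj[of X] by (auto simp: obj_over_def)
  let ?F = "iso_classes T C"
  have "sheafify_unit T ?F U (iso_class T C X) = sheafify_unit T ?F U (iso_class T C Y)"
    using eq be_iso[OF U] sheafify_unit_pi0[OF X] sheafify_unit_pi0[OF Y]
    unfolding cls_def b by (auto simp: iso_def bij_betw_def inj_on_def)
  then have R: "{f \<in> arr T. tgt T f = U \<and> res ?F f (iso_class T C X) = res ?F f (iso_class T C Y)} \<in> cov T U"
    using X Y by (intro magma_presheaf.sheafify_unit_locally_inj[OF iso_classes_magma_presheaf U])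
      (auto simp: iso_classes_carrier)
  show ?thesis
  proof (rule that[OF R])
    fix f assume "f \<in> {f \<in> arr T. tgt T f = U \<and> res ?F f (iso_class T C X) = res ?F f (iso_class T C Y)}"
    then have f: "f \<in> arr T" "tgt T f = U" "res ?F f (iso_class T C X) = res ?F f (iso_class T C Y)"
      by auto
    from lift_obj[OF f(1,2) X] obtain X' h where h: "h \<in> homs_over C f X' X" .
    from lift_obj[OF f(1,2) Y] obtain Y' k where k: "k \<in> homs_over C f Y' Y" .
    have "iso_class T C X' = iso_class T C Y'"
      using f(3) iso_class_res[OF h] iso_class_res[OF k] by simp
    then obtain r where "r \<in> fib_homs T C X' Y'"
      using iso_class_eq_iff[of X' "src T f" Y'] homs_over_base[OF h] homs_over_base[OF k]
      by (auto simp: obj_over_def)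
    from over_cmp_fib[OF this k] h show "\<exists>W. \<exists>p\<in>homs_over C f W X. \<exists>q\<in>homs_over C f W Y. True"
      by blast
  qed
qed


subsection \<open>Centrality of automorphisms\<close>

lemma al_bij: "U \<in> obj T \<Longrightarrow> bij_betw (al U) (carrier (sec A U)) (fib_homs T C (unit_obj C U) (unit_obj C U))"
  using al_iso[of U] by (auto simp: iso_def pi1_def)

lemma al_surj:
  assumes "U \<in> obj T" "a \<in> fib_homs T C (unit_obj C U) (unit_obj C U)"
  obtains x where "x \<in> carrier (sec A U)" "al U x = a"
  using bij_betw_imp_surj_on[OF al_bij[OF assms(1)]] assms(2) by (metis imageE)

lemma unit_auts_commute:
  assumes U: "U \<in> obj T" and a: "a \<in> fib_homs T C (unit_obj C U) (unit_obj C U)"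
    and b: "b \<in> fib_homs T C (unit_obj C U) (unit_obj C U)"
  shows "a \<bullet> b = b \<bullet> a"
proof -
  obtain a' where a': "a' \<in> carrier (sec A U)" "al U a' = a"
    by (rule al_surj[OF U a])
  obtain b' where b': "b' \<in> carrier (sec A U)" "al U b' = b"
    by (rule al_surj[OF U b])
  interpret G: comm_group "sec A U"
    using abelian_sheaf.sec_comm_group[OF A_sheaf U] .
  have hom: "al U (x \<otimes>\<^bsub>sec A U\<^esub> y) = al U x \<bullet> al U y"
    if "x \<in> carrier (sec A U)" "y \<in> carrier (sec A U)" for x y
    using al_iso[OF U] that by (auto simp: iso_def hom_def pi1_def)
  show ?thesis
    using hom[OF a'(1) b'(1)] hom[OF b'(1) a'(1)] a' b' G.m_comm by simp
qed

text \<open>Both automorphisms come from the unit through the multiplicative map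
  \<open>left_aut\<close>, and the automorphisms of the unit commute because they form a copy of the
  abelian group of sections of \<open>A\<close>.\<close>

lemma auts_commute:
  assumes "\<theta> \<in> fib_homs T C X X" "\<psi> \<in> fib_homs T C X X"
  shows "\<theta> \<bullet> \<psi> = \<psi> \<bullet> \<theta>"
proof -
  have X: "X \<in> obj C" using fib_homs_base[OF assms(1)] by simp
  obtain a where a: "a \<in> fib_homs T C (unit_obj C (base_obj C X)) (unit_obj C (base_obj C X))" "left_aut C a X = \<theta>"
    by (rule left_aut_surj[OF X refl assms(1)])
  obtain b where b: "b \<in> fib_homs T C (unit_obj C (base_obj C X)) (unit_obj C (base_obj C X))" "left_aut C b X = \<psi>"
    by (rule left_aut_surj[OF X refl assms(2)])
  show ?thesis
    using left_aut_cmp[OF X refl a(1) b(1)] left_aut_cmp[OF X refl b(1) a(1)]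
      unit_auts_commute[OF base_obj[OF X] a(1) b(1)] a b by simp
qed

text \<open>Automorphism groups being commutative, every isomorphism carries equivalent automorphisms
  to each other.\<close>

lemma aut_equivD:
  assumes eq: "aut_equiv \<theta> \<psi>" and q: "q \<in> fib_homs T C (src C \<theta>) (src C \<psi>)"
  shows "q \<bullet> \<theta> = \<psi> \<bullet> q"
proof -
  from eq obtain P Q p where p: "\<theta> \<in> fib_homs T C P P" "\<psi> \<in> fib_homs T C Q Q"
      "p \<in> fib_homs T C P Q" "p \<bullet> \<theta> = \<psi> \<bullet> p"
    unfolding aut_equiv_def by blast
  have q': "q \<in> fib_homs T C P Q"
    using q p by (simp add: fib_homs_iff)
  from over_factor_fib[OF p(3)[unfolded fib_homs_def] q'[unfolded fib_homs_def]]
  obtain r where r: "r \<in> fib_homs T C P P" "p \<bullet> r = q" .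
  have "q \<bullet> \<theta> = p \<bullet> (r \<bullet> \<theta>)"
    unfolding r(2)[symmetric] using p r by (intro assoc) (auto simp: fib_homs_iff)
  also have "\<dots> = (p \<bullet> \<theta>) \<bullet> r"
    unfolding auts_commute[OF r(1) p(1)] using p r by (intro assoc[symmetric]) (auto simp: fib_homs_iff)
  also have "\<dots> = \<psi> \<bullet> q"
    unfolding p(4) r(2)[symmetric] using p r by (intro assoc) (auto simp: fib_homs_iff)
  finally show ?thesis .
qed

text \<open>Restriction in \<open>pi1\<close> is a definite description. Recasting it as a square
  over \<open>f\<close> makes compatibility of \<open>al\<close> with restriction available to
  \<open>square_left_aut\<close> and \<open>square_right_aut\<close>.\<close>

lemma al_square:
  assumes f: "f \<in> arr T" and a: "a \<in> carrier (sec A (tgt T f))"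
  shows "square f (unit_arr C f) (al (src T f) (res A f a)) (al (tgt T f) a) (unit_arr C f)"
proof -
  let ?V = "src T f" and ?U = "tgt T f"
  have obj: "?V \<in> obj T" "?U \<in> obj T"
    using f category.src_obj[OF category_site] category.tgt_obj[OF category_site] by auto
  note u = unit_arr_over[OF f]
  have aU: "al ?U a \<in> fib_homs T C (unit_obj C ?U) (unit_obj C ?U)"
    using al_bij[OF obj(2)] a by (auto simp: bij_betw_def)
  from over_factor_fib[OF u fib_cmp_over[OF u aU]]
  obtain a' where a': "a' \<in> fib_homs T C (unit_obj C ?V) (unit_obj C ?V)"
    "unit_arr C f \<bullet> a' = al ?U a \<bullet> unit_arr C f" .
  have "res (pi1 T C) f (al ?U a) = a'"
    unfolding pi1_def
  proof (simp, rule the_equality)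
    show "a'' = a'" if "a'' \<in> fib_homs T C (unit_obj C ?V) (unit_obj C ?V)
        \<and> unit_arr C f \<bullet> a'' = al ?U a \<bullet> unit_arr C f" for a''
      using over_cancel[OF u] that a' unfolding fib_homs_def by metis
  qed (use a' in simp)
  then have "al ?V (res A f a) = a'"
    using al_res[OF f a] by simp
  then show ?thesis
    using squareI[OF u u a'(1) aU] a'(2) by simp
qed

text \<open>Triviality of the action gives information only if the description defining
  \<open>action\<close> has exactly one solution at the class of \<open>Y\<close>. The proof
  exhibits this solution \<open>x0\<close>, so that triviality reads \<open>x0 = x\<close>.\<close>

lemma right_aut_eq_left_aut:
  assumes Y: "Y \<in> obj C" "I = unit_obj C (base_obj C Y)" and a: "a \<in> fib_homs T C I I"
  shows "right_aut C Y a = left_aut C a Y"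
proof -
  let ?U = "base_obj C Y" and ?b = "cls Y"
  have U: "?U \<in> obj T" using base_obj[OF Y(1)] .
  have YU: "Y \<in> obj_over C ?U" using Y by (simp add: obj_over_def)
  have b: "?b \<in> carrier (sec B ?U)" using cls_closed[OF YU] .
  obtain x where x: "x \<in> carrier (sec A ?U)" "al ?U x = a"
    using al_surj[OF U a[unfolded Y(2)]] .
  note ra = right_aut_fib(1)[OF Y(1) a Y(2)]
  \<comment> \<open>The value of the action is read off at \<open>Y\<close> itself: the automorphism
    \<open>Y \<otimes> a\<close> is rewritten as \<open>a0 \<otimes> Y\<close>, and
    \<open>x0\<close> is the section of \<open>A\<close> corresponding to \<open>a0\<close>.\<close>
  obtain a0 where a0: "a0 \<in> fib_homs T C I I" "left_aut C a0 Y = right_aut C Y a"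
    by (rule left_aut_surj[OF Y ra])
  obtain x0 where x0: "x0 \<in> carrier (sec A ?U)" "al ?U x0 = a0"
    using al_surj[OF U a0(1)[unfolded Y(2)]] .
  have natural: "right_aut C X (al (src T f) (res A f x)) = left_aut C (al (src T f) (res A f x0)) X"
    if h: "h \<in> homs_over C f X Y" for f X h
  proof -
    note hb = homs_over_base[OF h]
    have sq: "square f h (right_aut C X (al (src T f) (res A f x))) (right_aut C Y a) h"
      "square f h (left_aut C (al (src T f) (res A f x0)) X) (left_aut C a0 Y) h"
      using square_right_aut[OF h al_square[of f x]] square_left_aut[OF h al_square[of f x0]] x x0 hb
      by auto
    from squareE[OF sq(1) h h] squareE[OF sq(2) h h] show ?thesis
      using over_cancel[OF h] a0(2) unfolding fib_homs_def by metis
  qed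
  let ?P = "\<lambda>a'. a' \<in> carrier (sec A ?U)
     \<and> (\<forall>f\<in>arr T. tgt T f = ?U \<longrightarrow> (\<forall>X\<in>objs_of_class (src T f) (res B f ?b).
          right_aut C X (al (src T f) (res A f x)) = left_aut C (al (src T f) (res A f a')) X))"
  have ex: "?P x0"
  proof (intro conjI ballI impI x0(1))
    fix f X assume f: "f \<in> arr T" "tgt T f = ?U" and X: "X \<in> objs_of_class (src T f) (res B f ?b)"
    let ?V = "src T f"
    have XV: "X \<in> obj_over C ?V" and cX: "cls X = res B f ?b"
      using X by (auto simp: objs_of_class_def)
    from lift_obj[OF f YU] obtain Y1 r where r: "r \<in> homs_over C f Y1 Y" .
    have Y1: "Y1 \<in> obj_over C ?V" using homs_over_base[OF r] by (simp add: obj_over_def)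
    \<comment> \<open>An object of the class of \<open>Y\<close> need not be a restriction of
      \<open>Y\<close>. It shares restrictions with \<open>Y1\<close> on a cover, where
      \<open>natural\<close> gives the identity, and \<open>separated\<close> descends it.\<close>
    have "cls X = cls Y1" using cX cls_res[OF r] by simp
    from cls_eq_local[OF XV Y1 this] obtain R where R: "R \<in> cov T ?V"
      "\<And>f. f \<in> R \<Longrightarrow> \<exists>W. \<exists>p\<in>homs_over C f W X. \<exists>q\<in>homs_over C f W Y1. True" by blast
    have V: "?V \<in> obj T" using f category.src_obj[OF category_site] by auto
    have rx: "res A f x \<in> carrier (sec A ?V)" "res A f x0 \<in> carrier (sec A ?V)"
      using abelian_sheaf.res_hom[OF A_sheaf f(1)] x x0 f(2) by (auto simp: hom_def)
    have XVb: "X \<in> obj C" "base_obj C X = ?V" using XV by (auto simp: obj_over_def)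
    have auts: "al ?V (res A f x) \<in> fib_homs T C (unit_obj C ?V) (unit_obj C ?V)"
      "al ?V (res A f x0) \<in> fib_homs T C (unit_obj C ?V) (unit_obj C ?V)"
      using al_bij[OF V] rx by (auto simp: bij_betw_def)
    show "right_aut C X (al ?V (res A f x)) = left_aut C (al ?V (res A f x0)) X"
    proof (rule separated)
      show "R \<in> cov T (base_obj C X)" using R XVb by simp
      show "right_aut C X (al ?V (res A f x)) \<in> homs_over C (ide T ?V) X X"
        using right_aut_fib(1)[OF XVb(1) auts(1)] XVb by (simp add: fib_homs_def)
      show "left_aut C (al ?V (res A f x0)) X \<in> homs_over C (ide T ?V) X X"
        using left_aut_fib(1)[OF XVb(1) auts(2)] XVb by (simp add: fib_homs_def)
    next
      fix g assume "g \<in> R"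
      then obtain W p q where p: "p \<in> homs_over C g W X" and q: "q \<in> homs_over C g W Y1"
        using R(2) by blast
      note pb = homs_over_base[OF p]
      have gf: "tgt T g = src T f" using pb XVb by simp
      have rg: "res A (f \<bullet>\<^bsub>T\<^esub> g) x = res A g (res A f x)" "res A (f \<bullet>\<^bsub>T\<^esub> g) x0 = res A g (res A f x0)"
        using abelian_sheaf.res_cmp[OF A_sheaf f(1) pb(5) gf] x x0 f by auto
      have "right_aut C W (al (src T g) (res A g (res A f x))) = left_aut C (al (src T g) (res A g (res A f x0))) W"
        using natural[OF homs_over_cmp[OF q r]] rg category.cmp_simps[OF category_site pb(5) f(1)] gf
        by simp
      moreover have "right_aut C X (al ?V (res A f x)) \<bullet> p = p \<bullet> right_aut C W (al (src T g) (res A g (res A f x)))"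
        using squareD[OF square_right_aut[OF p al_square[OF pb(5), of "res A f x"]]] rx gf by simp
      moreover have "left_aut C (al ?V (res A f x0)) X \<bullet> p = p \<bullet> left_aut C (al (src T g) (res A g (res A f x0))) W"
        using squareD[OF square_left_aut[OF p al_square[OF pb(5), of "res A f x0"]]] rx gf by simp
      ultimately show "\<exists>W. \<exists>h\<in>homs_over C g W X.
          right_aut C X (al ?V (res A f x)) \<bullet> h = left_aut C (al ?V (res A f x0)) X \<bullet> h"
        using p by metis
    qed
  qed
  \<comment> \<open>Uniqueness already follows from the condition at the identity of the base and at
    \<open>Y\<close>, since tensoring with \<open>Y\<close> is faithful.\<close>
  have "x' = x0" if "?P x'" for x'
  proof -
    have i: "ide T ?U \<in> arr T" "tgt T (ide T ?U) = ?U" "src T (ide T ?U) = ?U"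
      using category.ide_simps[OF category_site U] by auto
    have "res B (ide T ?U) ?b = ?b" "res A (ide T ?U) x = x" "res A (ide T ?U) x' = x'"
      using abelian_sheaf.res_ide[OF B_sheaf U b] abelian_sheaf.res_ide[OF A_sheaf U] x that by auto
    then have eq: "right_aut C Y a = left_aut C (al ?U x') Y"
      using that i x YU by (auto simp: objs_of_class_def)
    have a': "al ?U x' \<in> fib_homs T C I I"
      using that al_bij[OF U] Y(2) by (auto simp: bij_betw_def)
    have l: "lunit C Y \<in> fib_homs T C (I \<odot> Y) Y"
      using lunit_fib[OF Y(1)] Y by simp
    have Ib: "base_obj C I = ?U" using Y U by simp
    have "lunit C Y \<bullet> (al ?U x' \<star> ide C Y) = lunit C Y \<bullet> (a0 \<star> ide C Y)"
      using left_aut_fib(2)[OF Y(1) a' Y(2)] left_aut_fib(2)[OF Y(1) a0(1) Y(2)] eq a0(2) by simp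
    then have "al ?U x' \<star> ide C Y = a0 \<star> ide C Y"
      by (rule fib_cancel[OF l tens_fib[OF a' fib_ide[OF Y(1)] Ib, unfolded fib_homs_def]
            tens_fib[OF a0(1) fib_ide[OF Y(1)] Ib, unfolded fib_homs_def]])
    then have "al ?U x' = a0"
      by (rule tens_right_faithful[OF Y(1) Ib[symmetric] a' a0(1)])
    then show "x' = x0"
      using al_bij[OF U] x0 that by (auto simp: bij_betw_def inj_on_def)
  qed
  with ex have "action ?U ?b x = x0"
    unfolding action_def by (rule the_equality)
  moreover have "action ?U ?b x = x"
    using action_trivial U b x(1) by (simp add: trivial_action_def)
  ultimately show ?thesis
    using x x0 a0 by simp
qed

text \<open>With \<theta> written as \<open>a \<otimes> Z\<close>, the automorphism \<open>a\<close>
  is reassociated next to \<open>Y\<close>, moved to the other side of \<open>Y\<close> by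
  triviality of the action, brought in front of \<open>Y \<odot> Z\<close>, and finally reassociated
  with \<open>Z\<close> after \<open>Y\<close> and \<open>Z\<close> are exchanged.\<close>

lemma aut_equiv_tens_swap:
  assumes Y: "Y \<in> obj C" "base_obj C Y = base_obj C Z" and th: "\<theta> \<in> fib_homs T C Z Z"
    and rho: "\<rho> \<in> fib_homs T C (Y \<odot> Z) (Z \<odot> Y)"
  shows "aut_equiv (ide C Y \<star> \<theta>) (\<theta> \<star> ide C Y)"
proof -
  let ?U = "base_obj C Z"
  define I where "I = unit_obj C ?U"
  have Z: "Z \<in> obj C" using fib_homs_base[OF th] by simp
  have I: "I \<in> obj C" "base_obj C I = ?U"
    using base_obj[OF Z] by (auto simp: I_def)
  obtain a where a: "a \<in> fib_homs T C I I" "left_aut C a Z = \<theta>"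
    by (rule left_aut_surj[OF Z _ th]) (auto simp: I_def)
  have aZ: "aut_equiv (a \<star> ide C Z) \<theta>"
    using aut_equiv_left_aut[OF Z a(1)] a(2) by (simp add: I_def)
  have saZ: "base_obj C (src C (a \<star> ide C Z)) = ?U" "base_obj C (src C (ide C Y \<star> a)) = ?U"
    "base_obj C (src C (a \<star> ide C Y)) = ?U"
    using tens_fib[OF a(1) fib_ide[OF Z]] tens_fib[OF a(1) fib_ide[OF Y(1)]] tens_fib[OF fib_ide[OF Y(1)] a(1)]
      I Y Z by (auto simp: fib_homs_iff)
  have ra: "aut_equiv (ide C Y \<star> a) (left_aut C a Y)"
    using aut_equiv_right_aut[OF Y(1) a(1)] right_aut_eq_left_aut[OF Y(1) _ a(1)] Y(2) by (simp add: I_def)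
  have la: "aut_equiv (a \<star> ide C Y) (left_aut C a Y)"
    using aut_equiv_left_aut[OF Y(1) a(1)] Y(2) by (simp add: I_def)
  have sl: "base_obj C (src C (left_aut C a Y)) = ?U"
    using left_aut_fib(1)[OF Y(1) a(1)] Y(2) by (simp add: I_def fib_homs_iff)
  have "aut_equiv (ide C Y \<star> \<theta>) (ide C Y \<star> (a \<star> ide C Z))"
    using aut_equiv_tens_left[OF aZ Y(1)] Y saZ by - (rule aut_equiv_sym, simp)
  moreover have "aut_equiv (ide C Y \<star> (a \<star> ide C Z)) ((ide C Y \<star> a) \<star> ide C Z)"
    using aut_equiv_asc[OF fib_ide[OF Y(1)] a(1) fib_ide[OF Z]] I Y by simp
  moreover have "aut_equiv ((ide C Y \<star> a) \<star> ide C Z) (left_aut C a Y \<star> ide C Z)"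
    using aut_equiv_tens_right[OF ra Z] saZ by simp
  moreover have "aut_equiv (left_aut C a Y \<star> ide C Z) ((a \<star> ide C Y) \<star> ide C Z)"
    using aut_equiv_tens_right[OF aut_equiv_sym[OF la] Z] sl by simp
  moreover have "aut_equiv ((a \<star> ide C Y) \<star> ide C Z) (a \<star> (ide C Y \<star> ide C Z))"
    using aut_equiv_sym[OF aut_equiv_asc[OF a(1) fib_ide[OF Y(1)] fib_ide[OF Z]]] I Y by simp
  \<comment> \<open>Exchanging \<open>Y\<close> and \<open>Z\<close> requires some isomorphism
    between the two products; any \<rho> serves, since \<open>a\<close> and \<rho> act on different
    tensor factors.\<close>
  moreover have "aut_equiv (a \<star> (ide C Y \<star> ide C Z)) (a \<star> (ide C Z \<star> ide C Y))"
    using tens_fib_cmp[OF fib_ide[OF I(1)] rho _ a(1) fib_ide] tens_fib_cmp[OF a(1) fib_ide _ fib_ide[OF I(1)] rho] rho a(1)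
      I Y Z tens_fib[OF a(1) fib_ide] tens_fib[OF fib_ide[OF I(1)] rho]
    by (intro aut_equivI[where p = "ide C I \<star> \<rho>"]) (auto simp: fib_homs_iff)
  moreover have "aut_equiv (a \<star> (ide C Z \<star> ide C Y)) ((a \<star> ide C Z) \<star> ide C Y)"
    using aut_equiv_asc[OF a(1) fib_ide[OF Z] fib_ide[OF Y(1)]] I Y by simp
  moreover have "aut_equiv ((a \<star> ide C Z) \<star> ide C Y) (\<theta> \<star> ide C Y)"
    using aut_equiv_tens_right[OF aZ Y(1)] saZ Y by simp
  ultimately show ?thesis
    by (meson aut_equiv_trans)
qed

text \<open>The swap is known up to conjugacy, hence with respect to every isomorphism by
  \<open>aut_equivD\<close>. For the second form, the inverse of the given arrow supplies the \<rho>
  required by the swap.\<close>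

lemma tens_central:
  assumes Y: "Y \<in> obj C" "base_obj C Y = base_obj C Z" and th: "\<theta> \<in> fib_homs T C Z Z"
  shows "\<rho> \<in> fib_homs T C (Y \<odot> Z) (Z \<odot> Y) \<Longrightarrow> \<rho> \<bullet> (ide C Y \<star> \<theta>) = (\<theta> \<star> ide C Y) \<bullet> \<rho>"
    and "\<rho>' \<in> fib_homs T C (Z \<odot> Y) (Y \<odot> Z) \<Longrightarrow> \<rho>' \<bullet> (\<theta> \<star> ide C Y) = (ide C Y \<star> \<theta>) \<bullet> \<rho>'"
proof -
  have src: "src C (ide C Y \<star> \<theta>) = Y \<odot> Z" "src C (\<theta> \<star> ide C Y) = Z \<odot> Y"
    using tens_fib[OF fib_ide[OF Y(1)] th Y(2)] tens_fib[OF th fib_ide[OF Y(1)] Y(2)[symmetric]]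
    by (auto simp: fib_homs_iff)
  show "\<rho> \<bullet> (ide C Y \<star> \<theta>) = (\<theta> \<star> ide C Y) \<bullet> \<rho>" if "\<rho> \<in> fib_homs T C (Y \<odot> Z) (Z \<odot> Y)"
    using aut_equivD[OF aut_equiv_tens_swap[OF Y th that]] that src by simp
  show "\<rho>' \<bullet> (\<theta> \<star> ide C Y) = (ide C Y \<star> \<theta>) \<bullet> \<rho>'" if "\<rho>' \<in> fib_homs T C (Z \<odot> Y) (Y \<odot> Z)"
    using aut_equivD[OF aut_equiv_sym[OF aut_equiv_tens_swap[OF Y th fib_inv(1)[OF that]]]] that src by simp
qed

end

section \<open>The commutativity constraint\<close>

context gr_stack_invariants
begin

text \<open>A candidate compatible with all local expressions is the glued value as soon as one
  expression is available on \<open>X\<close> and \<open>Y\<close> themselves: evaluated at identity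
  arrows, that expression alone pins the candidate down.\<close>

lemma glue_eqI:
  assumes X: "X \<in> obj_over C U" and Y: "Y \<in> obj_over C U"
    and m: "m \<in> fib_homs T C (Y \<odot> X) (X \<odot> Y)" and L: "L (ide T U) X Y \<noteq> {}"
    and ok: "\<And>g X' Y' h k l. \<lbrakk>g \<in> arr T; tgt T g = U; h \<in> homs_over C g X' X; k \<in> homs_over C g Y' Y;
      l \<in> L g X' Y'\<rbrakk> \<Longrightarrow> m \<bullet> (k \<star> h) = (h \<star> k) \<bullet> l"
  shows "glue U (cls X) (cls Y) L (ide T U, X, Y) = m"
proof -
  have b: "X \<in> obj C" "Y \<in> obj C" "base_obj C X = U" "base_obj C Y = U" and U: "U \<in> obj T"
    using X Y base_obj[of X] by (auto simp: obj_over_def)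
  note i = category.ide_simps[OF category_site U]
  have ch: "(ide T U, X, Y) \<in> choices U (cls X) (cls Y)"
    using X Y i cls_closed[OF X] cls_closed[OF Y] abelian_sheaf.res_ide[OF B_sheaf U]
    by (auto simp: choices_def objs_of_class_def)
  have "(THE m. m \<in> fib_homs T C (Y \<odot> X) (X \<odot> Y)
     \<and> (\<forall>g\<in>arr T. tgt T g = src T (ide T U) \<longrightarrow>
          (\<forall>X' Y'. \<forall>h\<in>homs_over C g X' X. \<forall>k\<in>homs_over C g Y' Y. \<forall>l\<in>L (ide T U \<bullet>\<^bsub>T\<^esub> g) X' Y'.
             m \<bullet> (k \<star> h) = (h \<star> k) \<bullet> l))) = m"
  proof (rule the_equality)
    show "m \<in> fib_homs T C (Y \<odot> X) (X \<odot> Y)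
     \<and> (\<forall>g\<in>arr T. tgt T g = src T (ide T U) \<longrightarrow>
          (\<forall>X' Y'. \<forall>h\<in>homs_over C g X' X. \<forall>k\<in>homs_over C g Y' Y. \<forall>l\<in>L (ide T U \<bullet>\<^bsub>T\<^esub> g) X' Y'.
             m \<bullet> (k \<star> h) = (h \<star> k) \<bullet> l))"
      using m ok i category.ide_cmp'[OF category_site] by auto
  next
    fix m' assume m': "m' \<in> fib_homs T C (Y \<odot> X) (X \<odot> Y)
     \<and> (\<forall>g\<in>arr T. tgt T g = src T (ide T U) \<longrightarrow>
          (\<forall>X' Y'. \<forall>h\<in>homs_over C g X' X. \<forall>k\<in>homs_over C g Y' Y. \<forall>l\<in>L (ide T U \<bullet>\<^bsub>T\<^esub> g) X' Y'.
             m' \<bullet> (k \<star> h) = (h \<star> k) \<bullet> l))"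
    obtain l where l: "l \<in> L (ide T U) X Y" using L by blast
    have iXY: "ide C X \<in> homs_over C (ide T U) X X" "ide C Y \<in> homs_over C (ide T U) Y Y"
      using b fib_ide[of X] fib_ide[of Y] by (auto simp: fib_homs_def)
    have "ide T U \<bullet>\<^bsub>T\<^esub> ide T U = ide T U"
      using i category.ide_cmp'[OF category_site] by auto
    then have "m' \<bullet> (ide C Y \<star> ide C X) = (ide C X \<star> ide C Y) \<bullet> l"
      using m' i l iXY by metis
    also have "\<dots> = m \<bullet> (ide C Y \<star> ide C X)"
      using ok[OF i(1,3) iXY l] by simp
    finally show "m' = m"
      using m m' b by (auto simp: fib_homs_iff)
  qed
  then show ?thesis
    unfolding glue_def using ch by simp
qed

text \<open>The local expressions of both partial laws conjugate an arrow \<open>\<ell>\<close> by an isomorphism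
  \<open>c : P \<odot> P' \<rightarrow> Z\<close>. Objects of the same class being locally isomorphic, two such choices of
  \<open>P\<close>, \<open>P'\<close>, \<open>c\<close> differ locally by an automorphism of \<open>P \<odot> P'\<close>, which is central. The parameters
  \<open>ta\<close>, \<open>to\<close> are the tensor product or its opposite.\<close>

lemma law_independent:
  fixes ta :: "'m \<Rightarrow> 'm \<Rightarrow> 'm" and to :: "'o \<Rightarrow> 'o \<Rightarrow> 'o" and ell :: "'o \<Rightarrow> 'o \<Rightarrow> 'o \<Rightarrow> 'm"
  assumes tensor: "ta = (\<lambda>h k. h \<star> k) \<and> to = (\<lambda>X Y. X \<odot> Y) \<or> ta = (\<lambda>h k. k \<star> h) \<and> to = (\<lambda>X Y. Y \<odot> X)"
    and natural: "\<And>f W P p W' P' p' N M k. \<lbrakk>p \<in> homs_over C f W P; p' \<in> homs_over C f W' P';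
        k \<in> homs_over C f M N\<rbrakk>
      \<Longrightarrow> square f (ta k (p \<star> p')) (ell W W' M) (ell P P' N) (ta (p \<star> p') k)"
    and P: "P \<in> obj C" "P' \<in> obj C" "base_obj C P = base_obj C P'"
    and h: "h \<in> homs_over C g Z (P \<odot> P')" and k: "k \<in> homs_over C g M N"
    and Q: "Q \<in> objs_of_class (src T g) (res B g (cls P))" "Q' \<in> objs_of_class (src T g) (res B g (cls P'))"
    and c: "c \<in> fib_homs T C (Q \<odot> Q') Z"
  shows "ell P P' N \<bullet> ta k h = ta h k \<bullet> (ta c (ide C M) \<bullet> ell Q Q' M \<bullet> ta (ide C M) (arr_inv C c))"
proof -
  let ?V = "src T g"
  have ta_over: "ta u v \<in> homs_over C f (to X Y) (to X' Y')"
    if "u \<in> homs_over C f X X'" "v \<in> homs_over C f Y Y'" for u v f X X' Y Y'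
    using tensor tens_arr that by auto
  have ta_fib: "ta u v \<in> fib_homs T C (to X Y) (to X' Y')"
    if "u \<in> fib_homs T C X X'" "v \<in> fib_homs T C Y Y'" "base_obj C X = base_obj C Y" for u v X X' Y Y'
    using tensor tens_fib that by auto
  have ta_cmp: "ta (u' \<bullet> u) (v' \<bullet> v) = ta u' v' \<bullet> ta u v"
    if "u \<in> homs_over C f X X'" "v \<in> homs_over C f Y Y'" "u' \<in> homs_over C f' X' X''" "v' \<in> homs_over C f' Y' Y''"
    for u v u' v' f f' X Y X' Y' X'' Y''
    using tensor tens_cmp[OF that] tens_cmp[OF that(2,1,4,3)] by auto
  have to_base: "base_obj C (to X Y) = base_obj C X \<and> to X Y \<in> obj C"
    if "X \<in> obj C" "Y \<in> obj C" "base_obj C X = base_obj C Y" for X Y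
    using tensor that by auto
  have central: "\<rho> \<bullet> ta (ide C Y) \<theta> = ta \<theta> (ide C Y) \<bullet> \<rho>"
    if "Y \<in> obj C" "base_obj C Y = base_obj C X" "\<theta> \<in> fib_homs T C X X" "\<rho> \<in> fib_homs T C (to Y X) (to X Y)"
    for X Y \<theta> \<rho>
    using tensor tens_central[OF that(1-3)] that(4) by auto
  have Qo: "Q \<in> obj C" "Q' \<in> obj C" "base_obj C Q = ?V" "base_obj C Q' = ?V"
    and Qc: "cls Q = res B g (cls P)" "cls Q' = res B g (cls P')"
    using Q by (auto simp: objs_of_class_def obj_over_def)
  note hb = homs_over_base[OF h] and kb = homs_over_base[OF k]
  have Pg: "base_obj C P = tgt T g" "base_obj C P' = tgt T g"
    using hb(4) P by auto
  have ellQ: "ell Q Q' M \<in> fib_homs T C (to M (Q \<odot> Q')) (to (Q \<odot> Q') M)"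
    if "Q \<in> obj C" "Q' \<in> obj C" "M \<in> obj C" "base_obj C Q = base_obj C M" "base_obj C Q' = base_obj C M" for Q Q' M
  proof -
    have ids: "ide C Q \<in> homs_over C (ide T (base_obj C M)) Q Q" "ide C Q' \<in> homs_over C (ide T (base_obj C M)) Q' Q'"
      "ide C M \<in> homs_over C (ide T (base_obj C M)) M M"
      using fib_homs_over_ide[OF fib_ide] that by auto
    show ?thesis
      using squareE(1)[OF natural[OF ids] ta_over[OF ids(3) tens_arr[OF ids(1,2)]] ta_over[OF tens_arr[OF ids(1,2)] ids(3)]] .
  qed
  \<comment> \<open>The local expression for the choice \<open>Q\<close>, \<open>Q'\<close>,
    \<open>c\<close>. It is used through the square \<open>sqc\<close> with
    \<open>ell Q Q' M\<close>, which can be pasted to naturality squares.\<close>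
  define d where "d = ta c (ide C M) \<bullet> ell Q Q' M \<bullet> ta (ide C M) (arr_inv C c)"
  have M: "base_obj C M = ?V" "M \<in> obj C" using kb by auto
  have lQ: "ell Q Q' M \<in> fib_homs T C (to M (Q \<odot> Q')) (to (Q \<odot> Q') M)"
    using ellQ Qo M by simp
  have cM: "ta c (ide C M) \<in> fib_homs T C (to (Q \<odot> Q') M) (to Z M)"
    "ta (ide C M) c \<in> fib_homs T C (to M (Q \<odot> Q')) (to M Z)"
    "ta (ide C M) (arr_inv C c) \<in> fib_homs T C (to M Z) (to M (Q \<odot> Q'))"
    using Qo M hb c by (auto intro!: ta_fib fib_ide fib_inv(1))
  have d: "d \<in> fib_homs T C (to M Z) (to Z M)"
    unfolding d_def by (rule fib_cmp[OF fib_cmp[OF cM(3) lQ] cM(1)])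
  have iM: "ide C M \<in> homs_over C (ide T ?V) M M" and c': "c \<in> homs_over C (ide T ?V) (Q \<odot> Q') Z"
    and ci: "arr_inv C c \<in> homs_over C (ide T ?V) Z (Q \<odot> Q')"
    using M Qo hb fib_homs_over_ide[OF fib_ide] fib_homs_over_ide[OF c] fib_homs_over_ide[OF fib_inv(1)[OF c]]
    by auto
  have "ta (ide C M) (arr_inv C c) \<bullet> ta (ide C M) c = ta (ide C M \<bullet> ide C M) (arr_inv C c \<bullet> c)"
    by (rule ta_cmp[OF iM c' iM ci, symmetric])
  also have "\<dots> = ta (ide C M) (ide C (Q \<odot> Q'))"
    using fib_inv[OF c] M by simp
  also have "\<dots> = ide C (to M (Q \<odot> Q'))"
    using tensor Qo M by auto
  finally have cc: "ta (ide C M) (arr_inv C c) \<bullet> ta (ide C M) c = ide C (to M (Q \<odot> Q'))" .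
  have "d \<bullet> ta (ide C M) c = ta c (ide C M) \<bullet> (ell Q Q' M \<bullet> (ta (ide C M) (arr_inv C c) \<bullet> ta (ide C M) c))"
    unfolding d_def using cM lQ by (auto simp: assoc fib_homs_iff)
  then have dc: "d \<bullet> ta (ide C M) c = ta c (ide C M) \<bullet> ell Q Q' M"
    unfolding cc using lQ by (auto simp: fib_homs_iff)
  have sqc: "square (ide T ?V) (ta (ide C M) c) (ell Q Q' M) d (ta c (ide C M))"
    using Qo M hb to_base[of "Q \<odot> Q'" M] to_base[of M "Q \<odot> Q'"]
    by (intro squareI[OF fib_homs_over_ide[OF cM(2)] fib_homs_over_ide[OF cM(1)] lQ d dc]) auto
  \<comment> \<open>Restricting \<open>P\<close> and \<open>P'\<close> along \<open>g\<close> puts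
    them in the same fibre and classes as \<open>Q\<close> and \<open>Q'\<close>, so that
    \<open>cls_eq_local\<close> applies to each pair.\<close>
  obtain P2 r where r: "r \<in> homs_over C g P2 P"
    by (rule lift_obj[OF hb(5) refl, of P]) (use P Pg in \<open>auto simp: obj_over_def\<close>)
  obtain P2' r' where r': "r' \<in> homs_over C g P2' P'"
    by (rule lift_obj[OF hb(5) refl, of P']) (use P Pg in \<open>auto simp: obj_over_def\<close>)
  note rb = homs_over_base[OF r] homs_over_base[OF r']
  obtain R where R: "R \<in> cov T ?V"
    "\<And>f. f \<in> R \<Longrightarrow> \<exists>W. \<exists>p\<in>homs_over C f W P2. \<exists>q\<in>homs_over C f W Q. True"
    by (rule cls_eq_local[of P2 ?V Q]) (use rb Qo Qc cls_res[OF r] in \<open>auto simp: obj_over_def\<close>)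
  obtain R' where R': "R' \<in> cov T ?V"
    "\<And>f. f \<in> R' \<Longrightarrow> \<exists>W. \<exists>p\<in>homs_over C f W P2'. \<exists>q\<in>homs_over C f W Q'. True"
    by (rule cls_eq_local[of P2' ?V Q']) (use rb Qo Qc cls_res[OF r'] in \<open>auto simp: obj_over_def\<close>)
  have V: "?V \<in> obj T"
    using base_obj[OF Qo(1)] Qo(3) by simp
  have "ell P P' N \<bullet> ta k h = ta h k \<bullet> d"
  proof (rule separated)
    show "R \<inter> R' \<in> cov T (base_obj C (to M Z))"
      using cov_inter[OF V R(1) R'(1)] to_base[of M Z] M hb by simp
    show "ell P P' N \<bullet> ta k h \<in> homs_over C g (to M Z) (to (P \<odot> P') N)"
      using ellQ[of P P' N] P Pg kb by (intro fib_cmp_over[OF ta_over[OF k h]]) auto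
    show "ta h k \<bullet> d \<in> homs_over C g (to M Z) (to (P \<odot> P') N)"
      by (rule over_cmp_fib[OF d ta_over[OF h k]])
  next
    fix f assume f: "f \<in> R \<inter> R'"
    obtain W p0 q where p0: "p0 \<in> homs_over C f W P2" and q: "q \<in> homs_over C f W Q"
      using R(2) f by blast
    obtain W' p0' q' where p0': "p0' \<in> homs_over C f W' P2'" and q': "q' \<in> homs_over C f W' Q'"
      using R'(2) f by blast
    note p = homs_over_cmp[OF p0 r] homs_over_cmp[OF p0' r']
    note fb = homs_over_base[OF q] homs_over_base[OF q']
    obtain M2 k2 where k2: "k2 \<in> homs_over C f M2 M"
      by (rule lift_obj[of f ?V M]) (use fb Qo M in \<open>auto simp: obj_over_def\<close>)
    note kk = homs_over_cmp[OF k2 k] and k2b = homs_over_base[OF k2]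
    define z where "z = c \<bullet> (q \<star> q')"
    note qq = tens_arr[OF q q'] and pp = tens_arr[OF p]
    have z: "z \<in> homs_over C f (W \<odot> W') Z"
      unfolding z_def by (rule fib_cmp_over[OF qq c])
    note hz = homs_over_cmp[OF z h]
    have iW: "ide C M2 \<in> homs_over C (ide T (src T f)) M2 M2"
      using k2b fib_homs_over_ide[OF fib_ide] by simp
    \<comment> \<open>There are two arrows from \<open>W \<odot> W'\<close> to
      \<open>P \<odot> P'\<close>: one from restricting the factors, one through
      \<open>Q \<odot> Q'\<close>, \<open>c\<close> and \<open>h\<close>. Their discrepancy \<theta>
      need not be a tensor product of automorphisms of the factors, so naturality of
      \<open>ell\<close> cannot absorb it and centrality is called upon.\<close>
    obtain \<theta> where th: "\<theta> \<in> fib_homs T C (W \<odot> W') (W \<odot> W')" "((r \<bullet> p0) \<star> (r' \<bullet> p0')) \<bullet> \<theta> = h \<bullet> z"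
      by (rule over_factor_fib[OF pp hz])
    have th': "\<theta> \<in> homs_over C (ide T (src T f)) (W \<odot> W') (W \<odot> W')"
      using fib_homs_over_ide[OF th(1)] fb by simp
    have fid: "(g \<bullet>\<^bsub>T\<^esub> f) \<bullet>\<^bsub>T\<^esub> ide T (src T f) = g \<bullet>\<^bsub>T\<^esub> f" "ide T ?V \<bullet>\<^bsub>T\<^esub> f = f"
      using fb Qo category.cmp_simps[OF category_site, of f g] category.cmp_ide'[OF category_site]
        category.ide_cmp'[OF category_site] hb by auto
    have lW: "ell W W' M2 \<in> fib_homs T C (to M2 (W \<odot> W')) (to (W \<odot> W') M2)"
      using ellQ[of W W' M2] fb k2b by simp
    have "square (ide T (src T f)) (ta (ide C M2) \<theta>) (ell W W' M2) (ell W W' M2) (ta \<theta> (ide C M2))"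
      using central[OF k2b(1) _ th(1) lW] fb k2b
      by (intro squareI[OF ta_over[OF iW th'] ta_over[OF th' iW] lW lW]) simp
    from square_hcmp[OF this natural[OF p kk]]
    have "square (g \<bullet>\<^bsub>T\<^esub> f) (ta (k \<bullet> k2) (h \<bullet> z)) (ell W W' M2) (ell P P' N) (ta (h \<bullet> z) (k \<bullet> k2))"
      using ta_cmp[OF iW th' kk pp] ta_cmp[OF th' iW pp kk] kk fid th(2) by (simp add: homs_over_iff)
    from squareD[OF this]
    have 1: "ell P P' N \<bullet> (ta k h \<bullet> ta k2 z) = (ta h k \<bullet> ta z k2) \<bullet> ell W W' M2"
      using ta_cmp[OF k2 z k h] ta_cmp[OF z k2 h k] by simp
    \<comment> \<open>Through \<open>Q\<close> and \<open>Q'\<close> no discrepancy arises: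
      \<open>z\<close> is \<open>c\<close> after a tensor product of arrows, so naturality of
      \<open>ell\<close> pastes with \<open>sqc\<close>.\<close>
    have "square f (ta k2 z) (ell W W' M2) d (ta z k2)"
      using square_hcmp[OF natural[OF q q' k2] sqc] ta_cmp[OF k2 qq iM c'] ta_cmp[OF qq k2 c' iM] k2 fid
      by (simp add: homs_over_iff z_def)
    from squareD[OF this] have 2: "d \<bullet> ta k2 z = ta z k2 \<bullet> ell W W' M2" .
    note ty = ta_over[OF k h] ta_over[OF h k] ta_over[OF k2 z] ta_over[OF z k2] lW d ellQ[of P P' N]
    have "(ell P P' N \<bullet> ta k h) \<bullet> ta k2 z = (ta h k \<bullet> d) \<bullet> ta k2 z"
      using 1 2 ty P Pg kb by (auto simp: assoc homs_over_iff fib_homs_iff)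
    then show "\<exists>W. \<exists>u\<in>homs_over C f W (to M Z). (ell P P' N \<bullet> ta k h) \<bullet> u = (ta h k \<bullet> d) \<bullet> u"
      using ta_over[OF k2 z] by blast
  qed
  then show ?thesis
    by (simp add: d_def)
qed

end

section \<open>The constraint read off from the trivializing section\<close>

locale trivialized_commutator = gr_stack_invariants T C B be A al
  for T :: "('u, 's) site" and C :: "('u, 's, 'o, 'm) monoidal" (structure)
    and B :: "('u, 's, 'b) presheaf" and be :: "'u \<Rightarrow> ('s, ('s, 'o set) germ) germ \<Rightarrow> 'b"
    and A :: "('u, 's, 'a) presheaf" and al :: "'u \<Rightarrow> 'a \<Rightarrow> 'm" +
  fixes s :: "'u \<Rightarrow> 'b \<Rightarrow> 'b \<Rightarrow> ('s \<times> 'o \<times> 'o \<Rightarrow> 'm)"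
  assumes s_E: "\<lbrakk>U \<in> obj T; x \<in> carrier (sec B U); y \<in> carrier (sec B U)\<rbrakk> \<Longrightarrow> s U x y \<in> E U x y"
    and s_res: "\<lbrakk>g \<in> arr T; x \<in> carrier (sec B (tgt T g)); y \<in> carrier (sec B (tgt T g))\<rbrakk>
      \<Longrightarrow> s (src T g) (res B g x) (res B g y) = E_res g x y (s (tgt T g) x y)"
    and s_law1: "\<lbrakk>U \<in> obj T; x \<in> carrier (sec B U); x' \<in> carrier (sec B U); y \<in> carrier (sec B U)\<rbrakk>
      \<Longrightarrow> s U (x \<otimes>\<^bsub>sec B U\<^esub> x') y = law1 U x x' y (s U x y) (s U x' y)"
    and s_law2: "\<lbrakk>U \<in> obj T; x \<in> carrier (sec B U); y \<in> carrier (sec B U); y' \<in> carrier (sec B U)\<rbrakk>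
      \<Longrightarrow> s U x (y \<otimes>\<^bsub>sec B U\<^esub> y') = law2 U x y y' (s U x y) (s U x y')"
    and s_diag: "\<lbrakk>U \<in> obj T; x \<in> carrier (sec B U)\<rbrakk> \<Longrightarrow> s U x x = diag U x"
begin

definition comm :: "'o \<Rightarrow> 'o \<Rightarrow> 'm" where
  "comm X Y = s (base_obj C X) (cls X) (cls Y) (ide T (base_obj C X), X, Y)"

text \<open>Compatibility with restriction moves the index \<open>f\<close> into the base, so every
  component of every section \<open>s U x y\<close> is a value of the single function
  \<open>comm\<close> of two objects.\<close>

lemma s_component:
  assumes f: "f \<in> arr T" "tgt T f = U" and x: "x \<in> carrier (sec B U)" "y \<in> carrier (sec B U)"
    and X: "X \<in> objs_of_class (src T f) (res B f x)" and Y: "Y \<in> objs_of_class (src T f) (res B f y)"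
  shows "s U x y (f, X, Y) = comm X Y"
proof -
  let ?V = "src T f"
  have V: "?V \<in> obj T" using category.src_obj[OF category_site f(1)] .
  have c: "X \<in> obj_over C ?V" "Y \<in> obj_over C ?V" "cls X = res B f x" "cls Y = res B f y" "base_obj C X = ?V"
    using X Y by (auto simp: objs_of_class_def obj_over_def)
  note i = category.ide_simps[OF category_site V]
  have ch: "(ide T ?V, X, Y) \<in> choices ?V (res B f x) (res B f y)"
    using X Y i cls_closed[OF c(1)] cls_closed[OF c(2)] abelian_sheaf.res_ide[OF B_sheaf V] c
    by (auto simp: choices_def)
  have "comm X Y = E_res f x y (s U x y) (ide T ?V, X, Y)"
    using s_res[OF f(1)] x f c by (simp add: comm_def)
  also have "\<dots> = s U x y (f, X, Y)"
    using ch f category.cmp_ide'[OF category_site f(1) refl] by (simp add: E_res_def)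
  finally show ?thesis ..
qed

text \<open>The gluing condition in \<open>E\<close> relates the component at the identity of
  \<open>tgt T f\<close> to the component at \<open>f\<close>; by \<open>s_component\<close> the
  latter is \<open>comm X Y\<close>.\<close>

lemma square_comm:
  assumes h: "h \<in> homs_over C f X X'" and k: "k \<in> homs_over C f Y Y'"
  shows "square f (k \<star> h) (comm X Y) (comm X' Y') (h \<star> k)"
proof -
  note b = homs_over_base[OF h] homs_over_base[OF k]
  let ?U = "tgt T f"
  have comm_fib: "comm X Y \<in> fib_homs T C (Y \<odot> X) (X \<odot> Y)" and ch: "(ide T U, X, Y) \<in> choices U (cls X) (cls Y)"
    and sE: "s U (cls X) (cls Y) \<in> E U (cls X) (cls Y)"
    if "X \<in> obj_over C U" "Y \<in> obj_over C U" for X Y U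
  proof -
    have U: "U \<in> obj T" "base_obj C X = U" using that base_obj[of X] by (auto simp: obj_over_def)
    note cl = cls_closed[OF that(1)] cls_closed[OF that(2)]
    show ch: "(ide T U, X, Y) \<in> choices U (cls X) (cls Y)"
      using that cl abelian_sheaf.res_ide[OF B_sheaf U(1)] category.ide_simps[OF category_site U(1)]
      by (auto simp: choices_def objs_of_class_def)
    show sE: "s U (cls X) (cls Y) \<in> E U (cls X) (cls Y)"
      by (rule s_E[OF U(1) cl])
    show "comm X Y \<in> fib_homs T C (Y \<odot> X) (X \<odot> Y)"
      using sE ch U unfolding E_def comm_def by (auto simp: PiE_iff)
  qed
  have o: "X \<in> obj_over C (src T f)" "Y \<in> obj_over C (src T f)" "X' \<in> obj_over C ?U" "Y' \<in> obj_over C ?U"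
    using b by (auto simp: obj_over_def)
  have U: "?U \<in> obj T" using category.tgt_obj[OF category_site b(5)] .
  note i = category.ide_simps[OF category_site U]
  have "\<forall>g\<in>arr T. tgt T g = src T (ide T ?U) \<longrightarrow>
       (\<forall>V W. \<forall>h\<in>homs_over C g V X'. \<forall>k\<in>homs_over C g W Y'.
          s ?U (cls X') (cls Y') (ide T ?U, X', Y') \<bullet> (k \<star> h)
            = (h \<star> k) \<bullet> s ?U (cls X') (cls Y') (ide T ?U \<bullet>\<^bsub>T\<^esub> g, V, W))"
    using sE[OF o(3,4)] ch[OF o(3,4)] unfolding E_def by blast
  then have "comm X' Y' \<bullet> (k \<star> h) = (h \<star> k) \<bullet> s ?U (cls X') (cls Y') (f, X, Y)"
    using h k b i category.ide_cmp'[OF category_site b(5) refl] by (simp add: comm_def)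
  also have "s ?U (cls X') (cls Y') (f, X, Y) = comm X Y"
    using o cls_res[OF h] cls_res[OF k] cls_closed[OF o(3)] cls_closed[OF o(4)]
    by (intro s_component[OF b(5) refl]) (auto simp: objs_of_class_def)
  finally show ?thesis
    by (rule squareI[OF tens_arr[OF k h] tens_arr[OF h k] comm_fib[OF o(1,2)] comm_fib[OF o(3,4)]])
qed

lemma comm_fib:
  assumes "X \<in> obj C" "Y \<in> obj C" "base_obj C X = base_obj C Y"
  shows "comm X Y \<in> fib_homs T C (Y \<odot> X) (X \<odot> Y)"
proof -
  have i: "ide C X \<in> homs_over C (ide T (base_obj C Y)) X X" "ide C Y \<in> homs_over C (ide T (base_obj C Y)) Y Y"
    using assms fib_homs_over_ide[OF fib_ide] by auto
  from squareE(1)[OF square_comm[OF i] tens_arr[OF i(2,1)] tens_arr[OF i]] show ?thesis .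
qed

section \<open>Hexagons from the partial laws\<close>

definition hexagon_left :: "'o \<Rightarrow> 'o \<Rightarrow> 'o \<Rightarrow> 'm" where
  "hexagon_left X X' Y = asc C X X' Y \<bullet> (ide C X \<star> comm X' Y) \<bullet> arr_inv C (asc C X Y X')
     \<bullet> (comm X Y \<star> ide C X') \<bullet> asc C Y X X'"

text \<open>The two factors of the tensor product come first among the arguments, so that both
  hexagons have the shape of \<open>ell\<close> in \<open>law_independent\<close>, for the tensor
  product and for its opposite.\<close>

definition hexagon_right :: "'o \<Rightarrow> 'o \<Rightarrow> 'o \<Rightarrow> 'm" where
  "hexagon_right Y Y' X = arr_inv C (asc C X Y Y') \<bullet> (comm X Y \<star> ide C Y') \<bullet> asc C Y X Y'
     \<bullet> (ide C Y \<star> comm X Y') \<bullet> arr_inv C (asc C Y Y' X)"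

lemma square_hexagon_left:
  assumes "p \<in> homs_over C f W X" "p' \<in> homs_over C f W' X'" "k \<in> homs_over C f M Y"
  shows "square f (k \<star> (p \<star> p')) (hexagon_left W W' M) (hexagon_left X X' Y) ((p \<star> p') \<star> k)"
  unfolding hexagon_left_def
  by (rule square_cmp[OF square_cmp[OF square_cmp[OF square_cmp[OF
          square_asc[OF assms(3,1,2)]
          square_tens[OF square_comm[OF assms(1,3)] square_ide[OF assms(2)]]]
          square_inv[OF square_asc[OF assms(1,3,2)]]]
          square_tens[OF square_ide[OF assms(1)] square_comm[OF assms(2,3)]]]
          square_asc[OF assms(1,2,3)]])

lemma square_hexagon_right:
  assumes "p \<in> homs_over C f W Y" "p' \<in> homs_over C f W' Y'" "k \<in> homs_over C f M X"
  shows "square f ((p \<star> p') \<star> k) (hexagon_right W W' M) (hexagon_right Y Y' X) (k \<star> (p \<star> p'))"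
  unfolding hexagon_right_def
  by (rule square_cmp[OF square_cmp[OF square_cmp[OF square_cmp[OF
          square_inv[OF square_asc[OF assms(1,2,3)]]
          square_tens[OF square_ide[OF assms(1)] square_comm[OF assms(3,2)]]]
          square_asc[OF assms(1,3,2)]]
          square_tens[OF square_comm[OF assms(3,1)] square_ide[OF assms(2)]]]
          square_inv[OF square_asc[OF assms(3,1,2)]]])

text \<open>Since \<open>cls\<close> is multiplicative, additivity of \<open>s\<close> expresses the
  left side as a value of \<open>law1\<close>, a glued section. The hexagon is its value because all
  local expressions agree with it by \<open>law_independent\<close>.\<close>

lemma comm_tens_left:
  assumes X: "X \<in> obj_over C U" and X': "X' \<in> obj_over C U" and Y: "Y \<in> obj_over C U"
  shows "comm (X \<odot> X') Y = hexagon_left X X' Y"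
proof -
  have b: "X \<in> obj C" "X' \<in> obj C" "Y \<in> obj C" "base_obj C X = U" "base_obj C X' = U" "base_obj C Y = U"
    and U: "U \<in> obj T"
    using X X' Y base_obj[of X] by (auto simp: obj_over_def)
  note cl = cls_closed[OF X] cls_closed[OF X'] cls_closed[OF Y]
  note i = category.ide_simps[OF category_site U]
  have XX: "X \<odot> X' \<in> obj_over C U" by (rule tens_obj[OF X X'])
  let ?u = "s U (cls X) (cls Y)" and ?v = "s U (cls X') (cls Y)"
  let ?L = "\<lambda>f Z Y'. {(c \<star> ide C Y') \<bullet> asc C Q Q' Y' \<bullet> (ide C Q \<star> ?v (f, Q', Y')) \<bullet> arr_inv C (asc C Q Y' Q')
        \<bullet> (?u (f, Q, Y') \<star> ide C Q') \<bullet> asc C Y' Q Q' \<bullet> (ide C Y' \<star> arr_inv C c)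
      | Q Q' c. Q \<in> objs_of_class (src T f) (res B f (cls X)) \<and> Q' \<in> objs_of_class (src T f) (res B f (cls X'))
          \<and> c \<in> fib_homs T C (Q \<odot> Q') Z}"
  have "comm (X \<odot> X') Y = law1 U (cls X) (cls X') (cls Y) ?u ?v (ide T U, X \<odot> X', Y)"
    using s_law1[OF U cl] cls_tens[OF X X'] b by (simp add: comm_def)
  also have "\<dots> = glue U (cls (X \<odot> X')) (cls Y) ?L (ide T U, X \<odot> X', Y)"
    by (simp add: law1_def cls_tens[OF X X'])
  also have "\<dots> = hexagon_left X X' Y"
  proof (rule glue_eqI[OF XX Y])
    have ids: "ide C X \<in> homs_over C (ide T U) X X" "ide C X' \<in> homs_over C (ide T U) X' X'"
      "ide C Y \<in> homs_over C (ide T U) Y Y"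
      using fib_homs_over_ide[OF fib_ide] b by auto
    from squareE(1)[OF square_hexagon_left[OF ids] tens_arr[OF ids(3) tens_arr[OF ids(1,2)]] tens_arr[OF tens_arr[OF ids(1,2)] ids(3)]]
    show "hexagon_left X X' Y \<in> fib_homs T C (Y \<odot> (X \<odot> X')) ((X \<odot> X') \<odot> Y)" .
    have "X \<in> objs_of_class (src T (ide T U)) (res B (ide T U) (cls X))"
      "X' \<in> objs_of_class (src T (ide T U)) (res B (ide T U) (cls X'))"
      using X X' i cl abelian_sheaf.res_ide[OF B_sheaf U] by (auto simp: objs_of_class_def)
    \<comment> \<open>At the identity of the base the objects \<open>X\<close>, \<open>X'\<close>
      with \<open>c\<close> the identity are an admissible choice, which provides the expression
      that \<open>glue_eqI\<close> asks for.\<close>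
    moreover have "ide C (X \<odot> X') \<in> fib_homs T C (X \<odot> X') (X \<odot> X')"
      using b by (intro fib_ide) auto
    ultimately show "?L (ide T U) (X \<odot> X') Y \<noteq> {}" by blast
  next
    fix g Z Y' h k l
    assume g: "g \<in> arr T" "tgt T g = U" and h: "h \<in> homs_over C g Z (X \<odot> X')" and k: "k \<in> homs_over C g Y' Y"
      and "l \<in> ?L g Z Y'"
    then obtain Q Q' c where Q: "Q \<in> objs_of_class (src T g) (res B g (cls X))"
        "Q' \<in> objs_of_class (src T g) (res B g (cls X'))" and c: "c \<in> fib_homs T C (Q \<odot> Q') Z"
      and l: "l = (c \<star> ide C Y') \<bullet> asc C Q Q' Y' \<bullet> (ide C Q \<star> ?v (g, Q', Y')) \<bullet> arr_inv C (asc C Q Y' Q')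
        \<bullet> (?u (g, Q, Y') \<star> ide C Q') \<bullet> asc C Y' Q Q' \<bullet> (ide C Y' \<star> arr_inv C c)"
      by blast
    note kb = homs_over_base[OF k] and cb = fib_homs_base[OF c]
    have Y': "Y' \<in> objs_of_class (src T g) (res B g (cls Y))"
      using kb cls_res[OF k] by (simp add: objs_of_class_def obj_over_def)
    have Qo: "Q \<in> obj C" "Q' \<in> obj C" "base_obj C Q = src T g" "base_obj C Q' = src T g"
      using Q by (auto simp: objs_of_class_def obj_over_def)
    have ty: "c \<star> ide C Y' \<in> fib_homs T C ((Q \<odot> Q') \<odot> Y') (Z \<odot> Y')"
      "asc C Q Q' Y' \<in> fib_homs T C (Q \<odot> (Q' \<odot> Y')) ((Q \<odot> Q') \<odot> Y')"
      "ide C Q \<star> comm Q' Y' \<in> fib_homs T C (Q \<odot> (Y' \<odot> Q')) (Q \<odot> (Q' \<odot> Y'))"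
      "arr_inv C (asc C Q Y' Q') \<in> fib_homs T C ((Q \<odot> Y') \<odot> Q') (Q \<odot> (Y' \<odot> Q'))"
      "comm Q Y' \<star> ide C Q' \<in> fib_homs T C ((Y' \<odot> Q) \<odot> Q') ((Q \<odot> Y') \<odot> Q')"
      "asc C Y' Q Q' \<in> fib_homs T C (Y' \<odot> (Q \<odot> Q')) ((Y' \<odot> Q) \<odot> Q')"
      "ide C Y' \<star> arr_inv C c \<in> fib_homs T C (Y' \<odot> Z) (Y' \<odot> (Q \<odot> Q'))"
      using Qo kb cb c by (auto intro!: tens_fib asc_fib fib_inv(1) fib_ide comm_fib)
    have "l = (c \<star> ide C Y') \<bullet> hexagon_left Q Q' Y' \<bullet> (ide C Y' \<star> arr_inv C c)"
      unfolding l s_component[OF g cl(2,3) Q(2) Y'] s_component[OF g cl(1,3) Q(1) Y'] hexagon_left_def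
      using ty by (simp add: assoc fib_homs_iff)
    then show "hexagon_left X X' Y \<bullet> (k \<star> h) = (h \<star> k) \<bullet> l"
      using law_independent[of "\<lambda>h k. h \<star> k" "\<lambda>X Y. X \<odot> Y" hexagon_left, OF _ square_hexagon_left b(1,2) _ h k Q c] b by simp
  qed
  finally show ?thesis .
qed

lemma comm_tens_right:
  assumes X: "X \<in> obj_over C U" and Y: "Y \<in> obj_over C U" and Y': "Y' \<in> obj_over C U"
  shows "comm X (Y \<odot> Y') = hexagon_right Y Y' X"
proof -
  have b: "X \<in> obj C" "Y \<in> obj C" "Y' \<in> obj C" "base_obj C X = U" "base_obj C Y = U" "base_obj C Y' = U"
    and U: "U \<in> obj T"
    using X Y Y' base_obj[of X] by (auto simp: obj_over_def)
  note cl = cls_closed[OF X] cls_closed[OF Y] cls_closed[OF Y']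
  note i = category.ide_simps[OF category_site U]
  have YY: "Y \<odot> Y' \<in> obj_over C U" by (rule tens_obj[OF Y Y'])
  let ?u = "s U (cls X) (cls Y)" and ?w = "s U (cls X) (cls Y')"
  let ?L = "\<lambda>f X' Z. {(ide C X' \<star> c) \<bullet> arr_inv C (asc C X' Q Q') \<bullet> (?u (f, X', Q) \<star> ide C Q') \<bullet> asc C Q X' Q'
        \<bullet> (ide C Q \<star> ?w (f, X', Q')) \<bullet> arr_inv C (asc C Q Q' X') \<bullet> (arr_inv C c \<star> ide C X')
      | Q Q' c. Q \<in> objs_of_class (src T f) (res B f (cls Y)) \<and> Q' \<in> objs_of_class (src T f) (res B f (cls Y'))
          \<and> c \<in> fib_homs T C (Q \<odot> Q') Z}"
  have "comm X (Y \<odot> Y') = law2 U (cls X) (cls Y) (cls Y') ?u ?w (ide T U, X, Y \<odot> Y')"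
    using s_law2[OF U cl] cls_tens[OF Y Y'] b by (simp add: comm_def)
  also have "\<dots> = glue U (cls X) (cls (Y \<odot> Y')) ?L (ide T U, X, Y \<odot> Y')"
    by (simp add: law2_def cls_tens[OF Y Y'])
  also have "\<dots> = hexagon_right Y Y' X"
  proof (rule glue_eqI[OF X YY])
    have ids: "ide C Y \<in> homs_over C (ide T U) Y Y" "ide C Y' \<in> homs_over C (ide T U) Y' Y'"
      "ide C X \<in> homs_over C (ide T U) X X"
      using fib_homs_over_ide[OF fib_ide] b by auto
    from squareE(1)[OF square_hexagon_right[OF ids] tens_arr[OF tens_arr[OF ids(1,2)] ids(3)] tens_arr[OF ids(3) tens_arr[OF ids(1,2)]]]
    show "hexagon_right Y Y' X \<in> fib_homs T C ((Y \<odot> Y') \<odot> X) (X \<odot> (Y \<odot> Y'))" .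
    have "Y \<in> objs_of_class (src T (ide T U)) (res B (ide T U) (cls Y))"
      "Y' \<in> objs_of_class (src T (ide T U)) (res B (ide T U) (cls Y'))"
      using Y Y' i cl abelian_sheaf.res_ide[OF B_sheaf U] by (auto simp: objs_of_class_def)
    moreover have "ide C (Y \<odot> Y') \<in> fib_homs T C (Y \<odot> Y') (Y \<odot> Y')"
      using b by (intro fib_ide) auto
    ultimately show "?L (ide T U) X (Y \<odot> Y') \<noteq> {}" by blast
  next
    fix g X' Z h k l
    assume g: "g \<in> arr T" "tgt T g = U" and h: "h \<in> homs_over C g X' X" and k: "k \<in> homs_over C g Z (Y \<odot> Y')"
      and "l \<in> ?L g X' Z"
    then obtain Q Q' c where Q: "Q \<in> objs_of_class (src T g) (res B g (cls Y))"
        "Q' \<in> objs_of_class (src T g) (res B g (cls Y'))" and c: "c \<in> fib_homs T C (Q \<odot> Q') Z"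
      and l: "l = (ide C X' \<star> c) \<bullet> arr_inv C (asc C X' Q Q') \<bullet> (?u (g, X', Q) \<star> ide C Q') \<bullet> asc C Q X' Q'
        \<bullet> (ide C Q \<star> ?w (g, X', Q')) \<bullet> arr_inv C (asc C Q Q' X') \<bullet> (arr_inv C c \<star> ide C X')"
      by blast
    note hb = homs_over_base[OF h] and cb = fib_homs_base[OF c]
    have X': "X' \<in> objs_of_class (src T g) (res B g (cls X))"
      using hb cls_res[OF h] by (simp add: objs_of_class_def obj_over_def)
    have Qo: "Q \<in> obj C" "Q' \<in> obj C" "base_obj C Q = src T g" "base_obj C Q' = src T g"
      using Q by (auto simp: objs_of_class_def obj_over_def)
    have ty: "ide C X' \<star> c \<in> fib_homs T C (X' \<odot> (Q \<odot> Q')) (X' \<odot> Z)"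
      "arr_inv C (asc C X' Q Q') \<in> fib_homs T C ((X' \<odot> Q) \<odot> Q') (X' \<odot> (Q \<odot> Q'))"
      "comm X' Q \<star> ide C Q' \<in> fib_homs T C ((Q \<odot> X') \<odot> Q') ((X' \<odot> Q) \<odot> Q')"
      "asc C Q X' Q' \<in> fib_homs T C (Q \<odot> (X' \<odot> Q')) ((Q \<odot> X') \<odot> Q')"
      "ide C Q \<star> comm X' Q' \<in> fib_homs T C (Q \<odot> (Q' \<odot> X')) (Q \<odot> (X' \<odot> Q'))"
      "arr_inv C (asc C Q Q' X') \<in> fib_homs T C ((Q \<odot> Q') \<odot> X') (Q \<odot> (Q' \<odot> X'))"
      "arr_inv C c \<star> ide C X' \<in> fib_homs T C (Z \<odot> X') ((Q \<odot> Q') \<odot> X')"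
      using Qo hb cb c by (auto intro!: tens_fib asc_fib fib_inv(1) fib_ide comm_fib)
    have "l = (ide C X' \<star> c) \<bullet> hexagon_right Q Q' X' \<bullet> (arr_inv C c \<star> ide C X')"
      unfolding l s_component[OF g cl(1,2) X' Q(1)] s_component[OF g cl(1,3) X' Q(2)] hexagon_right_def
      using ty by (simp add: assoc fib_homs_iff)
    \<comment> \<open>The opposite tensor product exchanges the roles of \<open>h\<close> and
      \<open>k\<close>: here \<open>k\<close> is the arrow into the product
      \<open>Y \<odot> Y'\<close>.\<close>
    then show "hexagon_right Y Y' X \<bullet> (k \<star> h) = (h \<star> k) \<bullet> l"
      using law_independent[of "\<lambda>h k. k \<star> h" "\<lambda>X Y. Y \<odot> X" hexagon_right, OF _ square_hexagon_right b(2,3) _ k h Q c] b by simp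
  qed
  finally show ?thesis .
qed

text \<open>The local expression of \<open>diag\<close> exists only where the two restrictions of
  \<open>X\<close> are the same object, but the arrows \<open>h\<close> and \<open>k\<close>
  exhibiting them may still differ by an automorphism. The identity is compatible with such pairs by
  centrality.\<close>

lemma comm_self:
  assumes X: "X \<in> obj_over C U"
  shows "comm X X = ide C (X \<odot> X)"
proof -
  have b: "X \<in> obj C" "base_obj C X = U" and U: "U \<in> obj T"
    using X base_obj[of X] by (auto simp: obj_over_def)
  have "comm X X = diag U (cls X) (ide T U, X, X)"
    using s_diag[OF U cls_closed[OF X]] b by (simp add: comm_def)
  also have "\<dots> = ide C (X \<odot> X)"
    unfolding diag_def
  proof (rule glue_eqI[OF X X])
    show "ide C (X \<odot> X) \<in> fib_homs T C (X \<odot> X) (X \<odot> X)"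
      using b by (intro fib_ide) simp
  next
    fix g X' Y' h k l
    assume g: "g \<in> arr T" and h: "h \<in> homs_over C g X' X" and k: "k \<in> homs_over C g Y' X"
      and "l \<in> (if X' = Y' then {ide C (X' \<odot> X')} else {})"
    then have eq: "Y' = X'" "l = ide C (X' \<odot> X')" by (auto split: if_splits)
    note hb = homs_over_base[OF h]
    obtain \<theta> where th: "\<theta> \<in> fib_homs T C X' X'" "h \<bullet> \<theta> = k"
      using over_factor_fib[OF h k[unfolded eq]] by blast
    have i: "ide C X' \<in> homs_over C (ide T (src T g)) X' X'" "\<theta> \<in> homs_over C (ide T (src T g)) X' X'"
      using hb fib_homs_over_ide[OF fib_ide] fib_homs_over_ide[OF th(1)] by auto
    \<comment> \<open>Centrality with \<rho> the identity of \<open>X' \<odot> X'\<close>.\<close>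
    have "ide C X' \<star> \<theta> = \<theta> \<star> ide C X'"
      using tens_central(1)[OF hb(1) refl th(1), of "ide C (X' \<odot> X')"] hb fib_ide[of "X' \<odot> X'"]
        tens_fib[OF fib_ide th(1), of X'] tens_fib[OF th(1) fib_ide, of X'] by (simp add: fib_homs_iff)
    then have "k \<star> h = h \<star> k"
      using tens_cmp[OF i h h] tens_cmp[OF i(2,1) h h] h th(2) by (simp add: homs_over_iff)
    then show "ide C (X \<odot> X) \<bullet> (k \<star> h) = (h \<star> k) \<bullet> l"
      using tens_arr[OF h k] eq by (simp add: homs_over_iff)
  qed simp
  finally show ?thesis .
qed

text \<open>Polarization: both hexagons expand \<open>comm (X \<odot> Y) (X \<odot> Y) = 1\<close> into the arrow obtained from
  \<open>comm Y X \<bullet> comm X Y\<close> by tensoring with \<open>X\<close> on the left and \<open>Y\<close> on the right.\<close>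

lemma comm_comm:
  assumes X: "X \<in> obj_over C U" and Y: "Y \<in> obj_over C U"
  shows "comm Y X \<bullet> comm X Y = ide C (Y \<odot> X)"
proof -
  have b: "X \<in> obj C" "Y \<in> obj C" "base_obj C X = U" "base_obj C Y = U"
    using X Y by (auto simp: obj_over_def)
  note XY = tens_obj[OF X Y]
  let ?X = "ide C X" and ?Y = "ide C Y" and ?\<sigma> = "comm X Y" and ?\<tau> = "comm Y X"
  let ?a1 = "asc C X Y (X \<odot> Y)" and ?a2 = "asc C Y X Y" and ?a3 = "asc C X (X \<odot> Y) Y"
    and ?a4 = "asc C X (Y \<odot> X) Y" and ?a5 = "asc C X Y X" and ?a6 = "asc C (X \<odot> Y) X Y"
  have a: "?a1 \<in> fib_homs T C (X \<odot> (Y \<odot> (X \<odot> Y))) ((X \<odot> Y) \<odot> (X \<odot> Y))"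
    "?a2 \<in> fib_homs T C (Y \<odot> (X \<odot> Y)) ((Y \<odot> X) \<odot> Y)"
    "?a3 \<in> fib_homs T C (X \<odot> ((X \<odot> Y) \<odot> Y)) ((X \<odot> (X \<odot> Y)) \<odot> Y)"
    "?a4 \<in> fib_homs T C (X \<odot> ((Y \<odot> X) \<odot> Y)) ((X \<odot> (Y \<odot> X)) \<odot> Y)"
    "?a5 \<in> fib_homs T C (X \<odot> (Y \<odot> X)) ((X \<odot> Y) \<odot> X)"
    "?a6 \<in> fib_homs T C ((X \<odot> Y) \<odot> (X \<odot> Y)) (((X \<odot> Y) \<odot> X) \<odot> Y)"
    using b by (auto intro!: asc_fib)
  have i: "?X \<in> fib_homs T C X X" "?Y \<in> fib_homs T C Y Y"
    and st: "?\<sigma> \<in> fib_homs T C (Y \<odot> X) (X \<odot> Y)" "?\<tau> \<in> fib_homs T C (X \<odot> Y) (Y \<odot> X)"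
    using b fib_ide comm_fib by auto
  note inv2 = fib_inv[OF a(2)] and inv3 = fib_inv[OF a(3)] and inv5 = fib_inv[OF a(5)]
  have t: "?X \<star> ?\<sigma> \<in> fib_homs T C (X \<odot> (Y \<odot> X)) (X \<odot> (X \<odot> Y))"
    "?\<sigma> \<star> ?Y \<in> fib_homs T C ((Y \<odot> X) \<odot> Y) ((X \<odot> Y) \<odot> Y)"
    "?\<tau> \<star> ?Y \<in> fib_homs T C ((X \<odot> Y) \<odot> Y) ((Y \<odot> X) \<odot> Y)"
    using b by (auto intro!: tens_fib i st)
  have t': "(?X \<star> ?\<sigma>) \<star> ?Y \<in> fib_homs T C ((X \<odot> (Y \<odot> X)) \<odot> Y) ((X \<odot> (X \<odot> Y)) \<odot> Y)"
    "?X \<star> (?\<sigma> \<star> ?Y) \<in> fib_homs T C (X \<odot> ((Y \<odot> X) \<odot> Y)) (X \<odot> ((X \<odot> Y) \<odot> Y))"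
    "?X \<star> ?a2 \<in> fib_homs T C (X \<odot> (Y \<odot> (X \<odot> Y))) (X \<odot> ((Y \<odot> X) \<odot> Y))"
    "?a5 \<star> ?Y \<in> fib_homs T C ((X \<odot> (Y \<odot> X)) \<odot> Y) (((X \<odot> Y) \<odot> X) \<odot> Y)"
    "arr_inv C ?a5 \<star> ?Y \<in> fib_homs T C (((X \<odot> Y) \<odot> X) \<odot> Y) ((X \<odot> (Y \<odot> X)) \<odot> Y)"
    using b by (auto intro!: tens_fib i t a inv5)
  \<comment> \<open>Strictness turns the factor \<open>comm X X\<close> of the second hexagon into
    an identity, and the associativity constraints on its two sides cancel. The same happens to
    \<open>comm Y Y\<close> in \<open>comm2\<close>.\<close>
  have comm1: "comm X (X \<odot> Y) = (?X \<star> ?\<sigma>) \<bullet> arr_inv C ?a5"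
  proof -
    have "asc C X X Y \<in> fib_homs T C (X \<odot> (X \<odot> Y)) ((X \<odot> X) \<odot> Y)" using b by (auto intro!: asc_fib)
    note l = this fib_inv[OF this]
    have "comm X (X \<odot> Y) = arr_inv C (asc C X X Y) \<bullet> (asc C X X Y \<bullet> ((?X \<star> ?\<sigma>) \<bullet> arr_inv C ?a5))"
      using l t inv5 b by (simp add: comm_tens_right[OF X X Y] hexagon_right_def comm_self[OF X] fib_homs_iff)
    also have "\<dots> = (arr_inv C (asc C X X Y) \<bullet> asc C X X Y) \<bullet> ((?X \<star> ?\<sigma>) \<bullet> arr_inv C ?a5)"
      using l(1,2) t inv5 by (intro assoc[symmetric]) (auto simp: fib_homs_iff)
    also have "\<dots> = (?X \<star> ?\<sigma>) \<bullet> arr_inv C ?a5"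
      using l(3) t inv5 by (simp add: fib_homs_iff)
    finally show ?thesis .
  qed
  have comm2: "comm Y (X \<odot> Y) = arr_inv C ?a2 \<bullet> (?\<tau> \<star> ?Y)"
  proof -
    have "asc C X Y Y \<in> fib_homs T C (X \<odot> (Y \<odot> Y)) ((X \<odot> Y) \<odot> Y)" using b by (auto intro!: asc_fib)
    note l = this fib_inv[OF this]
    then show ?thesis
      using t inv2 b by (simp add: comm_tens_right[OF Y X Y] hexagon_right_def comm_self[OF Y] fib_homs_iff)
  qed
  let ?w = "arr_inv C ?a2 \<bullet> (?\<tau> \<star> ?Y)"
  have w: "?w \<in> fib_homs T C ((X \<odot> Y) \<odot> Y) (Y \<odot> (X \<odot> Y))"
    by (rule fib_cmp[OF t(3) inv2(1)])
  have Xw: "?X \<star> ?w \<in> fib_homs T C (X \<odot> ((X \<odot> Y) \<odot> Y)) (X \<odot> (Y \<odot> (X \<odot> Y)))"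
    using b by (intro tens_fib[OF i(1) w]) simp
  have c1: "((?X \<star> ?\<sigma>) \<bullet> arr_inv C ?a5) \<star> ?Y = ((?X \<star> ?\<sigma>) \<star> ?Y) \<bullet> (arr_inv C ?a5 \<star> ?Y)"
    using tens_fib_cmp[OF inv5(1) i(2) _ t(1) i(2)] b i(2) by (simp add: fib_homs_iff)
  have c2: "(arr_inv C ?a5 \<star> ?Y) \<bullet> (?a5 \<star> ?Y) = ide C ((X \<odot> (Y \<odot> X)) \<odot> Y)"
    using tens_fib_cmp[OF a(5) i(2) _ inv5(1) i(2)] b i(2) inv5(2) by (simp add: fib_homs_iff)
  have pent: "?a6 \<bullet> ?a1 = (?a5 \<star> ?Y) \<bullet> (?a4 \<bullet> (?X \<star> ?a2))"
    using pentagon[OF X Y X Y] .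
  have nat: "?a3 \<bullet> (?X \<star> (?\<sigma> \<star> ?Y)) = ((?X \<star> ?\<sigma>) \<star> ?Y) \<bullet> ?a4"
    using asc_natural[of ?X "ide T U" X X ?\<sigma> "Y \<odot> X" "X \<odot> Y" ?Y Y Y] i st b by (simp add: fib_homs_over_ide)
  \<comment> \<open>The pentagon rewrites the two associativity constraints as a composite ending in
    \<open>?a5 \<star> ?Y\<close>, which cancels the inverse left by \<open>comm1\<close>.
    Naturality then brings \<open>?\<sigma>\<close> inside \<open>X \<odot> (_ \<odot> Y)\<close>,
    where it meets \<open>?\<tau>\<close>.\<close>
  have step: "(((?X \<star> ?\<sigma>) \<bullet> arr_inv C ?a5) \<star> ?Y) \<bullet> (?a6 \<bullet> ?a1) = ?a3 \<bullet> ((?X \<star> (?\<sigma> \<star> ?Y)) \<bullet> (?X \<star> ?a2))"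
  proof -
    have "(((?X \<star> ?\<sigma>) \<bullet> arr_inv C ?a5) \<star> ?Y) \<bullet> (?a6 \<bullet> ?a1)
        = ((?X \<star> ?\<sigma>) \<star> ?Y) \<bullet> (((arr_inv C ?a5 \<star> ?Y) \<bullet> (?a5 \<star> ?Y)) \<bullet> (?a4 \<bullet> (?X \<star> ?a2)))"
      unfolding c1 pent using t' a by (simp add: assoc fib_homs_iff)
    also have "\<dots> = (((?X \<star> ?\<sigma>) \<star> ?Y) \<bullet> ?a4) \<bullet> (?X \<star> ?a2)"
      unfolding c2 using t' a by (simp add: assoc fib_homs_iff)
    also have "\<dots> = ?a3 \<bullet> ((?X \<star> (?\<sigma> \<star> ?Y)) \<bullet> (?X \<star> ?a2))"
      unfolding nat[symmetric] using t' a by (intro assoc) (auto simp: fib_homs_iff)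
    finally show ?thesis .
  qed
  let ?\<theta> = "?\<tau> \<bullet> ?\<sigma>"
  let ?v = "arr_inv C ?a2 \<bullet> ((?\<theta> \<star> ?Y) \<bullet> ?a2)"
  have th: "?\<theta> \<in> fib_homs T C (Y \<odot> X) (Y \<odot> X)"
    by (rule fib_cmp[OF st])
  have thY: "?\<theta> \<star> ?Y \<in> fib_homs T C ((Y \<odot> X) \<odot> Y) ((Y \<odot> X) \<odot> Y)"
    using b by (intro tens_fib[OF th i(2)]) simp
  have v: "?v \<in> fib_homs T C (Y \<odot> (X \<odot> Y)) (Y \<odot> (X \<odot> Y))"
    by (rule fib_cmp[OF fib_cmp[OF a(2) thY] inv2(1)])
  have Xv: "?X \<star> ?v \<in> fib_homs T C (X \<odot> (Y \<odot> (X \<odot> Y))) (X \<odot> (Y \<odot> (X \<odot> Y)))"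
    using b by (intro tens_fib[OF i(1) v]) simp
  \<comment> \<open>Precomposition with \<open>?a1\<close> completes the last constraint of the
    first hexagon, \<open>?a6\<close>, to a side of the pentagon.\<close>
  have "comm (X \<odot> Y) (X \<odot> Y) \<bullet> ?a1
      = ?a1 \<bullet> ((?X \<star> ?w) \<bullet> (arr_inv C ?a3 \<bullet> ((((?X \<star> ?\<sigma>) \<bullet> arr_inv C ?a5) \<star> ?Y) \<bullet> (?a6 \<bullet> ?a1))))"
    unfolding comm_tens_left[OF X Y XY] hexagon_left_def comm1 comm2 c1
    using a Xw t' inv3(1) by (simp add: assoc fib_homs_iff)
  also have "\<dots> = ?a1 \<bullet> ((?X \<star> ?w) \<bullet> ((arr_inv C ?a3 \<bullet> ?a3) \<bullet> ((?X \<star> (?\<sigma> \<star> ?Y)) \<bullet> (?X \<star> ?a2))))"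
    unfolding step using a Xw t' inv3(1) by (simp add: assoc fib_homs_iff)
  also have "\<dots> = ?a1 \<bullet> ((?X \<star> ?w) \<bullet> ((?X \<star> (?\<sigma> \<star> ?Y)) \<bullet> (?X \<star> ?a2)))"
    unfolding inv3(2) using t' by (simp add: fib_homs_iff)
  also have "(?X \<star> (?\<sigma> \<star> ?Y)) \<bullet> (?X \<star> ?a2) = ?X \<star> ((?\<sigma> \<star> ?Y) \<bullet> ?a2)"
    using tens_fib_cmp[OF i(1) a(2) _ i(1) t(2)] b i by (simp add: fib_homs_iff)
  also have "(?X \<star> ?w) \<bullet> (?X \<star> ((?\<sigma> \<star> ?Y) \<bullet> ?a2)) = ?X \<star> (?w \<bullet> ((?\<sigma> \<star> ?Y) \<bullet> ?a2))"
    using tens_fib_cmp[OF i(1) fib_cmp[OF a(2) t(2)] _ i(1) w] b i by (simp add: fib_homs_iff)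
  also have "?w \<bullet> ((?\<sigma> \<star> ?Y) \<bullet> ?a2) = arr_inv C ?a2 \<bullet> (((?\<tau> \<star> ?Y) \<bullet> (?\<sigma> \<star> ?Y)) \<bullet> ?a2)"
    using a t inv2(1) by (simp add: assoc fib_homs_iff)
  also have "(?\<tau> \<star> ?Y) \<bullet> (?\<sigma> \<star> ?Y) = ?\<theta> \<star> ?Y"
    using tens_fib_cmp[OF st(1) i(2) _ st(2) i(2)] b i by (simp add: fib_homs_iff)
  finally have "?a1 \<bullet> (?X \<star> ?v) = ?a1 \<bullet> (?X \<star> ide C (Y \<odot> (X \<odot> Y)))"
    using comm_self[OF XY] a(1) b by (simp add: fib_homs_iff)
  moreover have iYXY: "ide C (Y \<odot> (X \<odot> Y)) \<in> fib_homs T C (Y \<odot> (X \<odot> Y)) (Y \<odot> (X \<odot> Y))"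
    using b by (intro fib_ide) simp
  moreover have "?X \<star> ide C (Y \<odot> (X \<odot> Y)) \<in> fib_homs T C (X \<odot> (Y \<odot> (X \<odot> Y))) (X \<odot> (Y \<odot> (X \<odot> Y)))"
    using b by (intro tens_fib[OF i(1) iYXY]) simp
  ultimately have "?X \<star> ?v = ?X \<star> ide C (Y \<odot> (X \<odot> Y))"
    using fib_cancel[OF a(1)] Xv unfolding fib_homs_def by blast
  \<comment> \<open>Tensoring with \<open>X\<close> is faithful and is stripped first. Undoing the
    conjugation by \<open>?a2\<close> leaves an equality tensored with \<open>Y\<close>, stripped in
    the same way on the right.\<close>
  then have "?v = ide C (Y \<odot> (X \<odot> Y))"
    using b by (intro tens_left_faithful[OF b(1) _ v iYXY]) simp_all
  then have "arr_inv C ?a2 \<bullet> ((?\<theta> \<star> ?Y) \<bullet> ?a2) = arr_inv C ?a2 \<bullet> ?a2"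
    using inv2(2) by simp
  then have "(?\<theta> \<star> ?Y) \<bullet> ?a2 = ?a2"
    by (rule fib_cancel[OF inv2(1) fib_cmp[OF a(2) thY, unfolded fib_homs_def] a(2)[unfolded fib_homs_def]])
  also have "?a2 = (ide C (Y \<odot> X) \<star> ?Y) \<bullet> ?a2"
    using b a(2) by (simp add: fib_homs_iff)
  finally have eq: "(?\<theta> \<star> ?Y) \<bullet> ?a2 = (ide C (Y \<odot> X) \<star> ?Y) \<bullet> ?a2" .
  have iYX: "ide C (Y \<odot> X) \<in> fib_homs T C (Y \<odot> X) (Y \<odot> X)"
    using b by (intro fib_ide) simp
  have iYXY': "ide C (Y \<odot> X) \<star> ?Y \<in> fib_homs T C ((Y \<odot> X) \<odot> Y) ((Y \<odot> X) \<odot> Y)"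
    using b by (intro tens_fib[OF iYX i(2)]) simp
  have "?\<theta> \<star> ?Y = ide C (Y \<odot> X) \<star> ?Y"
    by (rule fib_epi[OF a(2) thY[unfolded fib_homs_def] iYXY'[unfolded fib_homs_def] eq])
  then show ?thesis
    using b by (intro tens_right_faithful[OF b(2) _ th iYX]) simp_all
qed

section \<open>The strict Picard structure\<close>

lemma strict_picard_stack_comm: "strict_picard_stack T C comm"
proof
  show "comm X Y \<in> fib_homs T C (Y \<odot> X) (X \<odot> Y)" if "X \<in> obj_over C U" "Y \<in> obj_over C U" for X Y U
    using that comm_fib by (simp add: obj_over_def)
  show "comm X' Y' \<bullet> (k \<star> h) = (h \<star> k) \<bullet> comm X Y"
    if "h \<in> homs_over C f X X'" "k \<in> homs_over C f Y Y'" for h f X X' k Y Y'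
    using squareD[OF square_comm[OF that]] .
  show "comm (X \<odot> X') Y = asc C X X' Y \<bullet> (ide C X \<star> comm X' Y) \<bullet> arr_inv C (asc C X Y X')
      \<bullet> (comm X Y \<star> ide C X') \<bullet> asc C Y X X'"
    if "X \<in> obj_over C U" "X' \<in> obj_over C U" "Y \<in> obj_over C U" for X X' Y U
    using comm_tens_left[OF that] by (simp add: hexagon_left_def)
  show "comm X (Y \<odot> Y') = arr_inv C (asc C X Y Y') \<bullet> (comm X Y \<star> ide C Y') \<bullet> asc C Y X Y'
      \<bullet> (ide C Y \<star> comm X Y') \<bullet> arr_inv C (asc C Y Y' X)"
    if "X \<in> obj_over C U" "Y \<in> obj_over C U" "Y' \<in> obj_over C U" for X Y Y' U
    using comm_tens_right[OF that] by (simp add: hexagon_right_def)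
qed (fact comm_comm comm_self)+

end

theorem corollary6p1:
  fixes T :: "('u, 's) site"
    and C :: "('u, 's, 'o, 'm) monoidal"
    and B :: "('u, 's, 'b) presheaf" and be :: "'u \<Rightarrow> ('s, ('s, 'o set) germ) germ \<Rightarrow> 'b"
    and A :: "('u, 's, 'a) presheaf" and al :: "'u \<Rightarrow> 'a \<Rightarrow> 'm"
  assumes "grothendieck_site T"
    and "gr_stack T C"
    and "has_invariants T C B be A al"
    and "gr_invariants.trivial_action T C B be A al"
    and "gr_invariants.trivial_phi T C B be A al"
    and "gr_invariants.trivial_alternating_biextension T C B be"
  shows "\<exists>s. strict_picard_stack T C s"
proof -
  interpret gr_stack_invariants T C B be A al
    using assms by (intro gr_stack_invariants.intro gr_stack_invariants_axioms.intro)
  from assms(6) have "\<exists>s. trivialized_commutator T C B be A al s"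
    unfolding trivial_alternating_biextension_def
    by (rule ex_forward) (intro trivialized_commutator.intro trivialized_commutator_axioms.intro
      gr_stack_invariants_axioms; elim conjE; simp)
  then show ?thesis
    using trivialized_commutator.strict_picard_stack_comm by blast
qed

end
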